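(* For every constant $k$, $Q(\mathrm{Sym}_{n-k})=\Theta(1)$, $Q^{a}(\mathrm{Sym}_{n-k})=\Theta(\log n)$, $Q^{p}(\mathrm{Sym}_{n-k})=\Theta(n^{1/4}\sqrt{\log n})$, and $Q^{\ell}(\mathrm{Sym}_{n-k})=\Theta(\sqrt{n})$.
   Context: Boolean functions are maps $f:\mathbb{Z}_2^n\to\mathbb{Z}_2$. For a family $\mathcal{P}$, $f$ is $\epsilon$-far from $\mathcal{P}$ if $|\{x:f(x)\ne g(x)\}|\ge\epsilon2^n$ for all $g\in\mathcal{P}$, and $\epsilon$-close to $g$ if $|\{x:f(x)\ne g(x)\}|<\epsilon 2^n$. A $q$-query $\epsilon$-tester (classical) is a randomized algorithm that queries $f$ on $q$ inputs of its choice from $\mathbb{Z}_2^n$, accepts with probability $\ge2/3$ if $f\in\mathcal{P}$ and rejects with probability $\ge2/3$ if $f$ is $\epsilon$-far from $\mathcal{P}$; $Q_\epsilon(\mathcal{P})$ is the minimal such $q$. A $u$-sample $q$-query $\epsilon$-tester is the same except that it is given a uniformly random set $U\subseteq\mathbb{Z}_2^n$ with $|U|=u$ and may only query points of $U$; $Q^a_\epsilon(\mathcal{P},u)$ is the minimal such $q$, and $Q^a(\mathcal{P})$ denotes this for sample size $u=\mathrm{poly}(n)$. $Q^p_\epsilon(\mathcal{P})$ is the minimal $q$ for which a $q$-sample $q$-query tester exists (passive testing). A proper $q$-query $\epsilon$-learner for $\mathcal{P}$, given the values of an unknown $f\in\mathcal{P}$ on $q$ uniformly random inputs, outputs some $g\in\mathcal{P}$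 that is $\epsilon$-close to $f$ with probability $\ge2/3$; $Q^\ell_\epsilon(\mathcal{P})$ is the minimal such $q$. $\epsilon$ is a fixed small constant (e.g. $0.001$) omitted from notation; asymptotics as $n\to\infty$. For $T\subseteq[n]$, $f$ is $T$-symmetric if permuting the variables indexed by $T$ does not change $f$; $\mathrm{Sym}_t$ is the family of functions that are $T$-symmetric for some $T$ with $|T|\ge t$.
   Formalization: The constant k is taken to be at least 1: for k = 0 (fully symmetric functions) the claim fails, since comparing O(1/ε) equal-weight pairs from a polynomial-size sample gives Q^a = O(1) rather than Θ(log n). *)

theory Defs
  imports "HOL-Probability.Probability" "HOL-Library.Z2" "HOL-Library.Extended_Nat"
begin

section \<open>Boolean functions\<close>

text \<open>
  Points of the cube are extensional functions on the index set \<open>{..<n}\<close>, and Boolean functions are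
  extensional functions on the cube, so that equality of points and of Boolean functions is
  equality in HOL.  The type \<^typ>\<open>bit\<close> is the field with two elements.
\<close>

definition cube :: "nat \<Rightarrow> (nat \<Rightarrow> bit) set" where
  "cube n = {..<n} \<rightarrow>\<^sub>E UNIV"

definition bool_funs :: "nat \<Rightarrow> ((nat \<Rightarrow> bit) \<Rightarrow> bit) set" where
  "bool_funs n = cube n \<rightarrow>\<^sub>E UNIV"

definition disagree :: "nat \<Rightarrow> ((nat \<Rightarrow> bit) \<Rightarrow> bit) \<Rightarrow> ((nat \<Rightarrow> bit) \<Rightarrow> bit) \<Rightarrow> (nat \<Rightarrow> bit) set" where
  "disagree n f g = {x \<in> cube n. f x \<noteq> g x}"

definition close_to :: "nat \<Rightarrow> real \<Rightarrow> ((nat \<Rightarrow> bit) \<Rightarrow> bit) \<Rightarrow> ((nat \<Rightarrow> bit) \<Rightarrow> bit) \<Rightarrow> bool" where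
  "close_to n \<epsilon> f g \<longleftrightarrow> real (card (disagree n f g)) < \<epsilon> * 2 ^ n"

definition far_from :: "nat \<Rightarrow> real \<Rightarrow> ((nat \<Rightarrow> bit) \<Rightarrow> bit) \<Rightarrow> ((nat \<Rightarrow> bit) \<Rightarrow> bit) set \<Rightarrow> bool" where
  "far_from n \<epsilon> f P \<longleftrightarrow> (\<forall>g\<in>P. real (card (disagree n f g)) \<ge> \<epsilon> * 2 ^ n)"

text \<open>
  A permutation \<open>\<pi>\<close> of \<open>T\<close> is the identity outside \<open>T\<close>, so \<open>x \<circ> \<pi>\<close> permutes exactly the
  coordinates of \<open>x\<close> in \<open>T\<close>.
\<close>

definition symmetric_on :: "nat \<Rightarrow> nat set \<Rightarrow> ((nat \<Rightarrow> bit) \<Rightarrow> bit) \<Rightarrow> bool" where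
  "symmetric_on n T f \<longleftrightarrow> (\<forall>\<pi>. \<pi> permutes T \<longrightarrow> (\<forall>x\<in>cube n. f (x \<circ> \<pi>) = f x))"

definition SymF :: "nat \<Rightarrow> nat \<Rightarrow> ((nat \<Rightarrow> bit) \<Rightarrow> bit) set" where
  "SymF n t = {f \<in> bool_funs n. \<exists>T\<subseteq>{..<n}. t \<le> card T \<and> symmetric_on n T f}"


section \<open>Query algorithms\<close>

text \<open>
  A deterministic adaptive query algorithm is a decision tree: at \<open>Query x l r\<close> it asks for \<open>f x\<close> and
  continues with \<open>l\<close> if the answer is \<open>0\<close> and with \<open>r\<close> if it is \<open>1\<close>.  A randomized algorithm is a
  probability distribution on decision trees, all of depth at most \<open>q\<close> if it makes \<open>q\<close> queries;
  spending fewer queries is harmless, since a tree can be padded with queries whose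
  answers are ignored.
\<close>

datatype 'a dtree = Answer bool | Query 'a "'a dtree" "'a dtree"

primrec depth :: "'a dtree \<Rightarrow> nat" where
  "depth (Answer b) = 0"
| "depth (Query x l r) = Suc (max (depth l) (depth r))"

primrec queried :: "'a dtree \<Rightarrow> 'a set" where
  "queried (Answer b) = {}"
| "queried (Query x l r) = insert x (queried l \<union> queried r)"

primrec accepts :: "'a dtree \<Rightarrow> ('a \<Rightarrow> bit) \<Rightarrow> bool" where
  "accepts (Answer b) f = b"
| "accepts (Query x l r) f = (if f x = 0 then accepts l f else accepts r f)"

text \<open>The correctness requirement on (the distribution of the decision tree run by) a tester.\<close>

definition tests :: "nat \<Rightarrow> real \<Rightarrow> ((nat \<Rightarrow> bit) \<Rightarrow> bit) set \<Rightarrow> (nat \<Rightarrow> bit) dtree pmf \<Rightarrow> bool" where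
  "tests n \<epsilon> P D \<longleftrightarrow>
     (\<forall>f\<in>P. measure_pmf.prob D {t. accepts t f} \<ge> 2 / 3) \<and>
     (\<forall>f\<in>bool_funs n. far_from n \<epsilon> f P \<longrightarrow> measure_pmf.prob D {t. \<not> accepts t f} \<ge> 2 / 3)"

definition is_tester ::
    "nat \<Rightarrow> real \<Rightarrow> ((nat \<Rightarrow> bit) \<Rightarrow> bit) set \<Rightarrow> nat \<Rightarrow> (nat \<Rightarrow> bit) dtree pmf \<Rightarrow> bool" where
  "is_tester n \<epsilon> P q D \<longleftrightarrow>
     (\<forall>t\<in>set_pmf D. depth t \<le> q \<and> queried t \<subseteq> cube n) \<and> tests n \<epsilon> P D"

text \<open>
  For a tester restricted to a random sample \<open>U\<close>, the distribution on trees may depend on \<open>U\<close>.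
  The bound \<open>u \<le> 2 ^ n\<close> says that there are sets \<open>U\<close> of size \<open>u\<close> at all;
  \<^const>\<open>pmf_of_set\<close> is unspecified on the empty set.
\<close>

definition samples :: "nat \<Rightarrow> nat \<Rightarrow> (nat \<Rightarrow> bit) set set" where
  "samples n u = {U. U \<subseteq> cube n \<and> card U = u}"

definition is_sample_tester ::
    "nat \<Rightarrow> real \<Rightarrow> ((nat \<Rightarrow> bit) \<Rightarrow> bit) set \<Rightarrow> nat \<Rightarrow> nat \<Rightarrow>
     ((nat \<Rightarrow> bit) set \<Rightarrow> (nat \<Rightarrow> bit) dtree pmf) \<Rightarrow> bool" where
  "is_sample_tester n \<epsilon> P u q A \<longleftrightarrow>
     u \<le> 2 ^ n \<and>
     (\<forall>U\<in>samples n u. \<forall>t\<in>set_pmf (A U). depth t \<le> q \<and> queried t \<subseteq> U) \<and>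
     tests n \<epsilon> P (pmf_of_set (samples n u) \<bind> A)"

text \<open>
  A learner receives a list of labelled examples whose inputs are drawn independently and uniformly;
  it may be randomized.
\<close>

definition input_lists :: "nat \<Rightarrow> nat \<Rightarrow> (nat \<Rightarrow> bit) list set" where
  "input_lists n q = {xs. set xs \<subseteq> cube n \<and> length xs = q}"

definition is_proper_learner ::
    "nat \<Rightarrow> real \<Rightarrow> ((nat \<Rightarrow> bit) \<Rightarrow> bit) set \<Rightarrow> nat \<Rightarrow>
     (((nat \<Rightarrow> bit) \<times> bit) list \<Rightarrow> ((nat \<Rightarrow> bit) \<Rightarrow> bit) pmf) \<Rightarrow> bool" where
  "is_proper_learner n \<epsilon> P q L \<longleftrightarrow>
     (\<forall>f\<in>P. measure_pmf.prob
        (pmf_of_set (input_lists n q) \<bind> (\<lambda>xs. L (map (\<lambda>x. (x, f x)) xs)))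
        {g \<in> P. close_to n \<epsilon> f g} \<ge> 2 / 3)"


section \<open>Query complexities\<close>

text \<open>The infimum in \<^typ>\<open>enat\<close> is attained, and it is \<open>\<infinity>\<close> if there is no suitable algorithm.\<close>

definition Q_classical :: "nat \<Rightarrow> real \<Rightarrow> ((nat \<Rightarrow> bit) \<Rightarrow> bit) set \<Rightarrow> enat" where
  "Q_classical n \<epsilon> P = Inf {enat q |q. \<exists>D. is_tester n \<epsilon> P q D}"

definition Q_active :: "nat \<Rightarrow> real \<Rightarrow> ((nat \<Rightarrow> bit) \<Rightarrow> bit) set \<Rightarrow> nat \<Rightarrow> enat" where
  "Q_active n \<epsilon> P u = Inf {enat q |q. \<exists>A. is_sample_tester n \<epsilon> P u q A}"

definition Q_passive :: "nat \<Rightarrow> real \<Rightarrow> ((nat \<Rightarrow> bit) \<Rightarrow> bit) set \<Rightarrow> enat" where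
  "Q_passive n \<epsilon> P = Inf {enat q |q. \<exists>A. is_sample_tester n \<epsilon> P q q A}"

definition Q_learn :: "nat \<Rightarrow> real \<Rightarrow> ((nat \<Rightarrow> bit) \<Rightarrow> bit) set \<Rightarrow> enat" where
  "Q_learn n \<epsilon> P = Inf {enat q |q. \<exists>L. is_proper_learner n \<epsilon> P q L}"


section \<open>Asymptotics of extended natural sequences\<close>

text \<open>
  The Landau classes of the library need values in a normed field.  For an eventually finite \<open>F\<close> and an
  eventually nonnegative \<open>g\<close> the following relations agree with them; an upper bound
  includes eventual finiteness.
\<close>

definition enat_bigo :: "(nat \<Rightarrow> enat) \<Rightarrow> (nat \<Rightarrow> real) \<Rightarrow> bool" where
  "enat_bigo F g \<longleftrightarrow> (\<exists>c>0. \<forall>\<^sub>F n in sequentially. ereal_of_enat (F n) \<le> ereal (c * g n))"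

definition enat_bigomega :: "(nat \<Rightarrow> enat) \<Rightarrow> (nat \<Rightarrow> real) \<Rightarrow> bool" where
  "enat_bigomega F g \<longleftrightarrow> (\<exists>c>0. \<forall>\<^sub>F n in sequentially. ereal (c * g n) \<le> ereal_of_enat (F n))"

definition enat_bigtheta :: "(nat \<Rightarrow> enat) \<Rightarrow> (nat \<Rightarrow> real) \<Rightarrow> bool" where
  "enat_bigtheta F g \<longleftrightarrow> enat_bigo F g \<and> enat_bigomega F g"

definition poly_bounded :: "(nat \<Rightarrow> nat) \<Rightarrow> bool" where
  "poly_bounded u \<longleftrightarrow> (\<exists>d. \<forall>\<^sub>F n in sequentially. u n \<le> n ^ d)"

text \<open>
  \<open>Q n u\<close> is a complexity for sample size \<open>u\<close>.  "\<open>\<Theta>(g)\<close> for samples of polynomial size" means: the lower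
  bound holds for every polynomially bounded sample size, and the upper bound holds for all
  sufficiently large polynomial sample sizes.  (With too small samples, say of constant size, no
  tester need exist.)
\<close>

definition poly_sample_bigtheta :: "(nat \<Rightarrow> nat \<Rightarrow> enat) \<Rightarrow> (nat \<Rightarrow> real) \<Rightarrow> bool" where
  "poly_sample_bigtheta Q g \<longleftrightarrow>
     (\<forall>u. poly_bounded u \<longrightarrow> enat_bigomega (\<lambda>n. Q n (u n)) g) \<and>
     (\<exists>d. \<forall>u. poly_bounded u \<and> (\<forall>\<^sub>F n in sequentially. n ^ d \<le> u n) \<longrightarrow>
        enat_bigo (\<lambda>n. Q n (u n)) g)"

end

theory Submission
  imports Defs "HOL-Real_Asymp.Real_Asymp"
begin

text \<open>
  With \<open>J\<close> the set of asymmetric coordinates, \<open>f\<close> is symmetric on the complement of \<open>J\<close> iff \<open>f x\<close>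
  depends only on the key \<open>(x restricted to J, |x|)\<close>.  Being far from the property means that for
  every \<open>J\<close> of size \<open>k\<close>, two random points with the same key disagree with constant probability.

  Queries: colour the coordinates with constantly many colours, and for every choice of \<open>k\<close> colours
  compare \<open>f\<close> on random pairs with the same key for the set \<open>J\<close> of coordinates of these colours.
  If \<open>f\<close> is nearly symmetric off \<open>J\<close> and off \<open>J'\<close>, both small, then it is nearly symmetric off
  \<open>J \<inter> J'\<close>; so for a far \<open>f\<close> the sets \<open>J\<close> that fool the tester form a
  \<open>(k + 1)\<close>-intersecting family, which a random colour class hits with tiny probability.

  Active and passive testing accept iff the labels seen are consistent with the property.  There are
  at most \<open>n ^ k\<close> sets \<open>J\<close>, so \<open>log n\<close> random pairs of equal weight suffice.  In \<open>q\<close> random points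
  there are about \<open>q\<^sup>2 / sqrt n\<close> such pairs.  Conversely, random coordinate functions look uniformly
  random on fewer than \<open>c log n\<close> points, and \<open>g |x| + x i\<close> looks uniformly random
  on samples with fewer than \<open>c log n\<close> pairs of equal weight.

  Learning: about \<open>sqrt n\<close> layers carry almost all points, and each carries at most a
  \<open>1 / sqrt n\<close> fraction.
\<close>

section \<open>Points of the cube and their weights\<close>

text \<open>A far function violates every \<open>J\<close>, but there are about \<open>n ^ k\<close>
  sets \<open>J\<close>, so a union bound over them asks for \<open>log n\<close> witnesses. Active
  and passive testing pay this price; \<open>O(1)\<close> queries cannot. Colouring leaves
  constantly many candidates, the unions of \<open>k\<close> out of \<open>r\<close> colour classes,
  and moves the price to the randomness of the colouring: as the fooling sets are
  \<open>(k + 1)\<close>-intersecting, a fooling bucket has probability of order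
  \<open>(k / r) ^ (k + 1)\<close>, against at most \<open>r ^ k\<close> choices of colours. The
  exponent \<open>k + 1\<close> is what makes the product small for large \<open>r\<close>.

  The passive rate solves \<open>q^2 / sqrt n = log n\<close>. For the lower bound the second moment
  must be truncated: two planted functions with the same coordinate \<open>i\<close> agree too often
  on samples with many points of equal weight, and only the factor \<open>1 / n\<close> for equal
  coordinates compensates for this.

  All testers built here accept members with certainty. Random sets are handled as lists of
  independent points, at the cost of a factor \<open>1 - u^2 / 2 ^ n\<close>.\<close>

lemma UNIV_bit: "(UNIV :: bit set) = {0, 1}"
  by (auto intro: bit.exhaust)

lemma card_UNIV_bit [simp]: "card (UNIV :: bit set) = 2"
  by (simp add: UNIV_bit)

lemma finite_UNIV_bit [simp]: "finite (UNIV :: bit set)"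
  by (simp add: UNIV_bit)

lemma sum_UNIV_bit: "(\<Sum>b\<in>UNIV. f b) = f (0::bit) + f 1"
  by (simp add: UNIV_bit)

lemma finite_cube [simp, intro]: "finite (cube n)"
  by (simp add: cube_def finite_PiE)

lemma card_cube: "card (cube n) = 2 ^ n"
  by (simp add: cube_def card_PiE)

lemma cube_nonempty [simp]: "cube n \<noteq> {}"
  by (simp add: cube_def PiE_eq_empty_iff)

lemma finite_bool_funs [simp, intro]: "finite (bool_funs n)"
  by (simp add: bool_funs_def finite_PiE)

lemma card_bool_funs: "card (bool_funs n) = 2 ^ 2 ^ n"
  by (simp add: bool_funs_def card_PiE card_cube)

lemma bool_funs_nonempty [simp]: "bool_funs n \<noteq> {}"
  by (simp add: bool_funs_def PiE_eq_empty_iff)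

text \<open>The index set is a parameter because the resampling argument needs the weights on blocks
  of coordinates; \<open>wt {..<n}\<close> is the Hamming weight.\<close>

definition wt :: "nat set \<Rightarrow> (nat \<Rightarrow> bit) \<Rightarrow> nat" where
  "wt Z x = card {i \<in> Z. x i = 1}"

lemma wt_le: "finite Z \<Longrightarrow> wt Z x \<le> card Z"
  unfolding wt_def by (rule card_mono) auto

lemma wt_le_n: "wt {..<n} x \<le> n"
  using wt_le[of "{..<n}" x] by simp

lemma wt_cong: "(\<And>i. i \<in> Z \<Longrightarrow> x i = y i) \<Longrightarrow> wt Z x = wt Z y"
  unfolding wt_def by (rule arg_cong[where f = card]) auto

lemma wt_insert:
  assumes "finite Z" "a \<notin> Z"
  shows "wt (insert a Z) x = (if x a = 1 then Suc (wt Z x) else wt Z x)"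
proof -
  have "{i \<in> insert a Z. x i = 1} = (if x a = 1 then insert a {i \<in> Z. x i = 1} else {i \<in> Z. x i = 1})"
    by auto
  then show ?thesis using assms by (simp add: wt_def)
qed

lemma wt_Un:
  assumes "finite A" "finite B" "A \<inter> B = {}"
  shows "wt (A \<union> B) x = wt A x + wt B x"
proof -
  have "{i \<in> A \<union> B. x i = 1} = {i \<in> A. x i = 1} \<union> {i \<in> B. x i = 1}" by auto
  then show ?thesis unfolding wt_def using assms by (subst card_Un_disjoint[symmetric]) auto
qed

lemma sum_PiE_insert:
  assumes "finite Z" "a \<notin> Z" 
  shows "(\<Sum>x\<in>PiE (insert a Z) (\<lambda>_. R). \<phi> x) = (\<Sum>r\<in>R. \<Sum>x\<in>PiE Z (\<lambda>_. R). \<phi> (x(a := r)))"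
proof -
  have "(\<Sum>x\<in>PiE (insert a Z) (\<lambda>_. R). \<phi> x) =
      (\<Sum>x\<in>(\<lambda>(r, x). x(a := r)) ` (R \<times> PiE Z (\<lambda>_. R)). \<phi> x)"
    by (simp add: PiE_insert_eq)
  also have "\<dots> = (\<Sum>(r, x)\<in>R \<times> PiE Z (\<lambda>_. R). \<phi> (x(a := r)))"
    using inj_combinator[OF assms(2)] by (subst sum.reindex) (auto simp: case_prod_unfold)
  finally show ?thesis by (simp add: sum.cartesian_product)
qed

text \<open>Pascal's rule under a sum: one more fair coin replaces \<open>\<phi> j\<close> by
  \<open>\<phi> j + \<phi> (Suc j)\<close>. This allows moments to be computed by induction.\<close>

lemma sum_binomial_Suc:
  fixes \<phi> :: "nat \<Rightarrow> real"
  shows "(\<Sum>j\<le>Suc N. (Suc N choose j) * \<phi> j) = (\<Sum>j\<le>N. (N choose j) * (\<phi> j + \<phi> (Suc j)))"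
proof -
  have "(\<Sum>j\<le>Suc N. (Suc N choose j) * \<phi> j) =
      \<phi> 0 + (\<Sum>j\<le>N. real (Suc N choose Suc j) * \<phi> (Suc j))"
    by (subst sum.atMost_Suc_shift) simp
  also have "\<dots> = \<phi> 0 + (\<Sum>j\<le>N. real (N choose Suc j) * \<phi> (Suc j)) + (\<Sum>j\<le>N. (N choose j) * \<phi> (Suc j))"
    by (simp add: sum.distrib algebra_simps)
  also have "\<phi> 0 + (\<Sum>j\<le>N. real (N choose Suc j) * \<phi> (Suc j)) = (\<Sum>j\<le>Suc N. (N choose j) * \<phi> j)"
    by (subst sum.atMost_Suc_shift) simp
  also have "\<dots> = (\<Sum>j\<le>N. (N choose j) * \<phi> j)" by simp
  finally show ?thesis by (simp add: sum.distrib algebra_simps)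
qed

lemma sum_wt_self:
  fixes \<phi> :: "nat \<Rightarrow> real"
  assumes "finite Z"
  shows "(\<Sum>x\<in>PiE Z (\<lambda>_. UNIV). \<phi> (wt Z x)) = (\<Sum>j\<le>card Z. (card Z choose j) * \<phi> j)"
  using assms
proof (induction Z arbitrary: \<phi> rule: finite_induct)
  case empty
  then show ?case by (simp add: wt_def)
next
  case (insert a Z)
  have *: "wt Z (x(a := r)) = wt Z x" for x r
    using insert.hyps by (intro wt_cong) auto
  have "(\<Sum>x\<in>PiE (insert a Z) (\<lambda>_. UNIV). \<phi> (wt (insert a Z) x)) =
     (\<Sum>x\<in>PiE Z (\<lambda>_. UNIV). \<phi> (wt Z x) + \<phi> (Suc (wt Z x)))"
    by (simp add: sum_PiE_insert insert.hyps wt_insert sum_UNIV_bit * sum.distrib)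
  also have "\<dots> = (\<Sum>j\<le>card Z. (card Z choose j) * (\<phi> j + \<phi> (Suc j)))"
    by (rule insert.IH)
  finally show ?case
    unfolding card_insert_disjoint[OF insert.hyps] sum_binomial_Suc .
qed

text \<open>Every coordinate outside \<open>Z\<close> merely doubles the sum, so the weight on
  \<open>Z\<close> of a uniform point is binomial.\<close>

lemma sum_wt:
  fixes \<phi> :: "nat \<Rightarrow> real"
  assumes "Z \<subseteq> {..<n}"
  shows "(\<Sum>x\<in>cube n. \<phi> (wt Z x)) = 2 ^ (n - card Z) * (\<Sum>j\<le>card Z. (card Z choose j) * \<phi> j)"
proof -
  have fZ: "finite Z" using assms finite_subset by blast
  have "finite E \<Longrightarrow> Z \<inter> E = {} \<Longrightarrow> (\<Sum>x\<in>PiE (Z \<union> E) (\<lambda>_. UNIV). \<phi> (wt Z x)) =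
     2 ^ card E * (\<Sum>j\<le>card Z. (card Z choose j) * \<phi> j)" for E
  proof (induction E rule: finite_induct)
    case empty
    then show ?case by (simp add: sum_wt_self fZ)
  next
    case (insert a E)
    have *: "wt Z (x(a := r)) = wt Z x" for x r
      using insert.prems by (intro wt_cong) auto
    have "Z \<union> insert a E = insert a (Z \<union> E)" by simp
    moreover have "a \<notin> Z \<union> E" using insert by auto
    ultimately have "(\<Sum>x\<in>PiE (Z \<union> insert a E) (\<lambda>_. UNIV). \<phi> (wt Z x)) = 2 * (\<Sum>x\<in>PiE (Z \<union> E) (\<lambda>_. UNIV). \<phi> (wt Z x))"
      using insert.hyps fZ by (simp add: sum_PiE_insert * )
    then show ?case using insert by simp
  qed
  from this[of "{..<n} - Z"] assms fZ show ?thesis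
    by (simp add: cube_def Un_absorb1 card_Diff_subset)
qed

text \<open>\<open>N - 2 j\<close> is a sum of \<open>N\<close> signs, \<open>j\<close> of them
  negative. The variance grows by one per sign because
  \<open>(d + 1)^2 + (d - 1)^2 = 2 d^2 + 2\<close>.\<close>

lemma sum_signs_binomial: "(\<Sum>j\<le>N. (N choose j) * (real N - 2 * real j)\<^sup>2) = real N * 2 ^ N"
proof (induction N)
  case (Suc N)
  have "(\<Sum>j\<le>Suc N. (Suc N choose j) * (real (Suc N) - 2 * real j)\<^sup>2) =
     (\<Sum>j\<le>N. (N choose j) * ((real (Suc N) - 2 * real j)\<^sup>2 + (real (Suc N) - 2 * real (Suc j))\<^sup>2))"
    by (rule sum_binomial_Suc)
  also have "\<dots> = (\<Sum>j\<le>N. 2 * ((N choose j) * (real N - 2 * real j)\<^sup>2) + 2 * real (N choose j))"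
    by (intro sum.cong) (auto simp: power2_eq_square algebra_simps)
  also have "\<dots> = 2 * (real N * 2 ^ N) + 2 * real (\<Sum>j\<le>N. N choose j)"
    by (simp only: sum.distrib sum_distrib_left[symmetric] Suc.IH of_nat_sum)
  also have "\<dots> = real (Suc N) * 2 ^ Suc N" by (simp add: choose_row_sum algebra_simps)
  finally show ?case .
qed simp

lemma sum_signs_sq:
  assumes "Z \<subseteq> {..<n}"
  shows "(\<Sum>x\<in>cube n. (real (card Z) - 2 * real (wt Z x))\<^sup>2) = real (card Z) * 2 ^ n"
proof -
  have "card Z \<le> n" using card_mono[OF _ assms] by simp
  then have "(2::real) ^ (n - card Z) * 2 ^ card Z = 2 ^ n"
    by (simp flip: power_add)
  then show ?thesis
    by (simp only: sum_wt[OF assms, where \<phi> = "\<lambda>w. (real (card Z) - 2 * real w)\<^sup>2"]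
      sum_signs_binomial) (simp add: mult.commute mult.left_commute)
qed

text \<open>Cauchy-Schwarz in pointwise form: \<open>\<bar>d\<bar> \<le> (d^2 / s + s) / 2\<close>
  with the standard deviation \<open>s\<close>, summed over the cube.\<close>

lemma sum_abs_signs:
  assumes "Z \<subseteq> {..<n}"
  shows "(\<Sum>x\<in>cube n. \<bar>real (card Z) - 2 * real (wt Z x)\<bar>) \<le> sqrt (card Z) * 2 ^ n"
proof (cases "card Z = 0")
  case True
  then show ?thesis using assms finite_subset by (fastforce simp: wt_def)
next
  case False
  define s where "s = sqrt (card Z)"
  have s: "s > 0" "s * s = card Z" using False by (auto simp: s_def)
  have "\<bar>d\<bar> \<le> (d\<^sup>2 / s + s) / 2" for d :: real
  proof -
    have "0 \<le> (\<bar>d\<bar> - s)\<^sup>2" by simp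
    then show ?thesis using s by (simp add: field_simps power2_eq_square)
  qed
  then have "(\<Sum>x\<in>cube n. \<bar>real (card Z) - 2 * real (wt Z x)\<bar>) \<le>
     (\<Sum>x\<in>cube n. ((real (card Z) - 2 * real (wt Z x))\<^sup>2 / s + s) / 2)"
    by (rule sum_mono)
  also have "\<dots> = (real (card Z) * 2 ^ n / s + 2 ^ n * s) / 2"
    by (simp add: sum_divide_distrib[symmetric] sum.distrib sum_signs_sq[OF assms] card_cube)
  also have "\<dots> = s * 2 ^ n" using s by (simp add: field_simps flip: s(2))
  finally show ?thesis by (simp add: s_def)
qed

section \<open>Concentration of the weight and the size of layers\<close>

lemma chebyshev_weight:
  assumes "t > 0" "n > 0"
  shows "real (card {x \<in> cube n. t * sqrt n \<le> \<bar>real n - 2 * real (wt {..<n} x)\<bar>}) \<le> 2 ^ n / t\<^sup>2"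
proof -
  let ?A = "{x \<in> cube n. t * sqrt n \<le> \<bar>real n - 2 * real (wt {..<n} x)\<bar>}"
  have "real (card ?A) * (t\<^sup>2 * n) = (\<Sum>x\<in>?A. (t * sqrt n)\<^sup>2)" by (simp add: power_mult_distrib)
  also have "\<dots> \<le> (\<Sum>x\<in>?A. (real n - 2 * real (wt {..<n} x))\<^sup>2)"
    using assms by (intro sum_mono) (metis (mono_tags, lifting) abs_of_nonneg abs_le_square_iff mem_Collect_eq mult_nonneg_nonneg less_imp_le real_sqrt_ge_zero of_nat_0_le_iff)
  also have "\<dots> \<le> (\<Sum>x\<in>cube n. (real n - 2 * real (wt {..<n} x))\<^sup>2)"
    by (rule sum_mono2) auto
  also have "\<dots> = n * 2 ^ n" using sum_signs_sq[of "{..<n}" n] by simp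
  finally show ?thesis using assms by (simp add: field_simps)
qed

text \<open>The factor \<open>2 m + 1\<close> is chosen so that the induction closes: it reduces to
  \<open>4 (2 m + 1) (2 m + 3) \<le> 16 (m + 1)^2\<close>. The squared form keeps square roots
  out.\<close>

lemma central_binomial_upper: "(2 * m choose m)\<^sup>2 * (2 * m + 1) \<le> (16::nat) ^ m"
proof (induction m)
  case (Suc m)
  have e: "Suc m * (2 * Suc m choose Suc m) = 2 * (2 * m + 1) * (2 * m choose m)"
  proof -
    have a: "Suc m * (Suc (2 * m + 1) choose Suc m) = Suc (2 * m + 1) * (2 * m + 1 choose m)"
      by (rule Suc_times_binomial)
    have b: "(2 * m + 1 choose m) = (2 * m + 1 choose Suc m)"
      by (subst binomial_symmetric) auto
    have c: "Suc m * (Suc (2 * m) choose Suc m) = Suc (2 * m) * (2 * m choose m)"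
      by (rule Suc_times_binomial)
    have "Suc (2 * m + 1) * (2 * m + 1 choose m) = 2 * (Suc m * (Suc (2 * m) choose Suc m))"
      using b by simp
    then show ?thesis using a c by simp
  qed
  have "(Suc m)\<^sup>2 * ((2 * Suc m choose Suc m)\<^sup>2 * (2 * Suc m + 1)) =
      (Suc m * (2 * Suc m choose Suc m))\<^sup>2 * (2 * Suc m + 1)"
    by (simp only: power_mult_distrib mult.assoc)
  also have "\<dots> = (4 * (2 * m + 1) * (2 * m + 3)) * ((2 * m choose m)\<^sup>2 * (2 * m + 1))"
    unfolding e power_mult_distrib by (simp only: power2_eq_square) (simp add: algebra_simps)
  also have "\<dots> \<le> (4 * (2 * m + 1) * (2 * m + 3)) * 16 ^ m"
    using Suc.IH by (rule mult_le_mono2)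
  also have "4 * (2 * m + 1) * (2 * m + 3) \<le> 16 * (Suc m)\<^sup>2"
    by (simp add: power2_eq_square algebra_simps)
  finally have "(Suc m)\<^sup>2 * ((2 * Suc m choose Suc m)\<^sup>2 * (2 * Suc m + 1)) \<le> (Suc m)\<^sup>2 * 16 ^ Suc m"
    by (simp add: mult.commute mult.left_commute)
  then show ?case by (subst (asm) mult_le_cancel1) simp
qed simp

text \<open>The middle coefficient of a row is its largest. An odd row reduces to the next even one,
  whose central coefficient is exactly twice the middle one.\<close>

lemma binomial_sq_le: "(n choose w)\<^sup>2 * (n + 1) \<le> (4::nat) ^ n"
proof -
  have "(n choose w)\<^sup>2 \<le> (n choose (n div 2))\<^sup>2"
    by (intro power_mono binomial_maximum) auto
  moreover have "(n choose (n div 2))\<^sup>2 * (n + 1) \<le> 4 ^ n"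
  proof (cases "even n")
    case True
    then obtain m where "n = 2 * m" by blast
    then show ?thesis using central_binomial_upper[of m] by (simp add: power_mult)
  next
    case False
    then obtain m where n: "n = 2 * m + 1" using oddE by blast
    have "(2 * Suc m choose Suc m) = (2 * m + 1 choose m) + (2 * m + 1 choose Suc m)"
      by simp
    moreover have "(2 * m + 1 choose m) = (2 * m + 1 choose Suc m)"
      by (subst binomial_symmetric) auto
    ultimately have e: "(2 * Suc m choose Suc m) = 2 * (2 * m + 1 choose m)" by simp
    have "4 * ((2 * m + 1 choose m)\<^sup>2 * (2 * m + 3)) = (2 * Suc m choose Suc m)\<^sup>2 * (2 * Suc m + 1)"
      unfolding e by (simp only: power_mult_distrib) (simp add: algebra_simps)
    also have "\<dots> \<le> 16 ^ Suc m" by (rule central_binomial_upper)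
    also have "\<dots> = 4 * 4 ^ n" by (simp add: n power_mult)
    finally have "(2 * m + 1 choose m)\<^sup>2 * (2 * m + 3) \<le> 4 ^ n" by simp
    moreover have "(2 * m + 1 choose m)\<^sup>2 * (n + 1) \<le> (2 * m + 1 choose m)\<^sup>2 * (2 * m + 3)"
      by (rule mult_le_mono2) (simp add: n)
    moreover have "n div 2 = m" by (simp add: n)
    ultimately show ?thesis unfolding n by (metis le_trans n)
  qed
  ultimately show ?thesis by (meson le_trans mult_le_mono1)
qed

lemma binomial_le_sqrt: "real (n choose w) \<le> 2 ^ n / sqrt (real n + 1)"
proof -
  have "real ((n choose w)\<^sup>2 * (n + 1)) \<le> real (4 ^ n)"
    using binomial_sq_le of_nat_mono by blast
  moreover have "(2 ^ n)\<^sup>2 = (4::real) ^ n"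
    by (simp add: power2_eq_square power_mult_distrib[symmetric])
  ultimately have "(real (n choose w) * sqrt (real n + 1))\<^sup>2 \<le> (2 ^ n)\<^sup>2"
    by (simp add: power_mult_distrib algebra_simps)
  then have "real (n choose w) * sqrt (real n + 1) \<le> 2 ^ n"
    by (rule power2_le_imp_le) simp
  then show ?thesis by (simp add: field_simps)
qed

lemma real_card_Collect_eq_sum: "finite A \<Longrightarrow> real (card {x \<in> A. P x}) = (\<Sum>x\<in>A. of_bool (P x))"
  by (simp add: Int_def of_bool_def sum.If_cases)

lemma card_layer: "card {x \<in> cube n. wt {..<n} x = w} = n choose w"
proof -
  have "real (card {x \<in> cube n. wt {..<n} x = w}) = (\<Sum>x\<in>cube n. of_bool (wt {..<n} x = w))"
    by (simp add: real_card_Collect_eq_sum)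
  also have "\<dots> = (\<Sum>j\<le>n. (n choose j) * of_bool (j = w))"
    by (subst sum_wt) auto
  also have "\<dots> = real (n choose w)" by (simp add: of_bool_def if_distrib cong: if_cong)
  finally show ?thesis by simp
qed

lemma card_layer_le:
  assumes "n > 0"
  shows "real (card {x \<in> cube n. wt {..<n} x = w}) \<le> 2 ^ n / sqrt n"
proof -
  have "real (n choose w) \<le> 2 ^ n / sqrt (real n + 1)" by (rule binomial_le_sqrt)
  also have "\<dots> \<le> 2 ^ n / sqrt n" using assms by (intro divide_left_mono) auto
  finally show ?thesis by (simp only: card_layer)
qed

lemma card_layers_le:
  assumes "n > 0" "finite W" "card W \<le> q"
  shows "real (card {x \<in> cube n. wt {..<n} x \<in> W}) \<le> real q * (2 ^ n / sqrt n)"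
proof -
  have "card {x \<in> cube n. wt {..<n} x \<in> W} \<le> card (\<Union>w\<in>W. {x \<in> cube n. wt {..<n} x = w})"
    using assms(2) by (intro card_mono) auto
  also have "\<dots> \<le> (\<Sum>w\<in>W. card {x \<in> cube n. wt {..<n} x = w})" by (rule card_UN_le[OF assms(2)])
  finally have "real (card {x \<in> cube n. wt {..<n} x \<in> W}) \<le> real (\<Sum>w\<in>W. card {x \<in> cube n. wt {..<n} x = w})"
    by (rule of_nat_mono)
  also have "\<dots> = (\<Sum>w\<in>W. real (card {x \<in> cube n. wt {..<n} x = w}))" by simp
  also have "\<dots> \<le> real (card W) * (2 ^ n / sqrt n)"
    by (rule sum_bounded_above) (rule card_layer_le[OF assms(1)])
  also have "\<dots> \<le> real q * (2 ^ n / sqrt n)"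
    using assms(3) by (intro mult_right_mono) auto
  finally show ?thesis .
qed

lemma card_wt_image_le: "length xs = q \<Longrightarrow> card (wt Z ` set xs) \<le> q"
  by (metis card_image_le card_length finite_set le_trans)

lemma card_le_cube: "W \<subseteq> cube n \<Longrightarrow> real (card W) \<le> 2 ^ n"
  using of_nat_mono[OF card_mono[OF finite_cube], of W n, where 'a = real] by (simp add: card_cube)

lemma card_cube_diff: "W \<subseteq> cube n \<Longrightarrow> real (card (cube n - W)) = 2 ^ n - real (card W)"
  using card_mono[OF finite_cube, of W n]
  by (simp add: card_Diff_subset finite_subset card_cube of_nat_diff)

section \<open>Exponential estimates for powers\<close>

lemma two_power_le_exp: "(2::real) ^ m \<le> exp (real m)"
proof -
  have "(2::real) ^ m \<le> exp 1 ^ m" using exp_ge_add_one_self[of 1] by (intro power_mono) auto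
  then show ?thesis by (simp add: exp_of_nat_mult[symmetric])
qed

lemma one_minus_power_le_exp:
  assumes "x \<le> (1::real)"
  shows "(1 - x) ^ m \<le> exp (- (x * real m))"
proof -
  have "(1 - x) ^ m \<le> exp (- x) ^ m"
    using exp_ge_add_one_self[of "- x"] assms by (intro power_mono) auto
  then show ?thesis by (simp add: exp_of_nat_mult[symmetric] mult.commute)
qed

section \<open>Classes of points with the same key\<close>

text \<open>The weight \<open>w\<close> is separate from \<open>x\<close>, since resampling combines
  the restriction of one point to \<open>J\<close> with the weight of another.\<close>

definition cl :: "nat \<Rightarrow> nat set \<Rightarrow> (nat \<Rightarrow> bit) \<Rightarrow> nat \<Rightarrow> (nat \<Rightarrow> bit) set" where
  "cl n J x w = {y \<in> cube n. (\<forall>i\<in>J. y i = x i) \<and> wt {..<n} y = w}"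

abbreviation cls :: "nat \<Rightarrow> nat set \<Rightarrow> (nat \<Rightarrow> bit) \<Rightarrow> (nat \<Rightarrow> bit) set" where
  "cls n J x \<equiv> cl n J x (wt {..<n} x)"

definition class_const :: "nat \<Rightarrow> nat set \<Rightarrow> ((nat \<Rightarrow> bit) \<Rightarrow> bit) \<Rightarrow> bool" where
  "class_const n J f \<longleftrightarrow> (\<forall>x\<in>cube n. \<forall>y\<in>cls n J x. f y = f x)"

lemma finite_cl [simp, intro]: "finite (cl n J x w)"
  by (simp add: cl_def)

lemma cl_subset: "cl n J x w \<subseteq> cube n"
  by (auto simp: cl_def)

lemma self_in_cls: "x \<in> cube n \<Longrightarrow> x \<in> cls n J x"
  by (simp add: cl_def)

lemma cls_eq: "y \<in> cls n J x \<Longrightarrow> cls n J y = cls n J x"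
  by (auto simp: cl_def)

lemma card_cls_pos: "x \<in> cube n \<Longrightarrow> card (cls n J x) > 0"
  using self_in_cls by (metis card_gt_0_iff empty_iff finite_cl)

text \<open>A canonical name for a class. It lives in an explicit product, which bounds the number
  of classes.\<close>

definition key :: "nat \<Rightarrow> nat set \<Rightarrow> (nat \<Rightarrow> bit) \<Rightarrow> (nat \<Rightarrow> bit) \<times> nat" where
  "key n J x = (restrict x J, wt {..<n} x)"

lemma key_eq_iff: "y \<in> cube n \<Longrightarrow> key n J y = key n J x \<longleftrightarrow> y \<in> cls n J x"
  by (auto simp: key_def cl_def fun_eq_iff restrict_def)

lemma card_keys:
  assumes "finite J" "finite W" "wt {..<n} ` M \<subseteq> W"
  shows "card (key n J ` M) \<le> 2 ^ card J * card W"
proof -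
  have "key n J ` M \<subseteq> (J \<rightarrow>\<^sub>E UNIV) \<times> W" using assms(3) by (auto simp: key_def)
  then have "card (key n J ` M) \<le> card ((J \<rightarrow>\<^sub>E (UNIV :: bit set)) \<times> W)"
    using assms by (intro card_mono) (auto simp: finite_PiE)
  then show ?thesis using assms by (simp add: card_cartesian_product card_PiE)
qed

text \<open>The permutation is glued from a bijection between the ones of \<open>y\<close> and of
  \<open>x\<close> in \<open>T\<close> and a bijection between the zeros.\<close>

lemma exists_rearrangement:
  fixes x y :: "nat \<Rightarrow> bit"
  assumes "finite T" "\<And>i. i \<notin> T \<Longrightarrow> x i = y i" "wt T x = wt T y"
  shows "\<exists>\<pi>. \<pi> permutes T \<and> y = x \<circ> \<pi>"
proof -
  let ?X = "{i \<in> T. x i = 1}" and ?Y = "{i \<in> T. y i = 1}"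
  have fin: "finite ?X" "finite ?Y" using assms(1) by auto
  have c: "card ?Y = card ?X" using assms(3) by (simp add: wt_def)
  obtain g where g: "bij_betw g ?Y ?X"
    using finite_same_card_bij[OF fin(2,1) c] by blast
  have "card (T - ?Y) = card (T - ?X)"
    using c fin by (simp add: card_Diff_subset)
  then obtain h where h: "bij_betw h (T - ?Y) (T - ?X)"
    using finite_same_card_bij assms(1) by (metis finite_Diff)
  define \<pi> where "\<pi> = (\<lambda>i. if i \<in> T then if y i = 1 then g i else h i else i)"
  have "bij_betw \<pi> ?Y ?X"
    using g by (rule bij_betw_cong[THEN iffD1, rotated]) (auto simp: \<pi>_def)
  moreover have "bij_betw \<pi> (T - ?Y) (T - ?X)"
    using h by (rule bij_betw_cong[THEN iffD1, rotated]) (auto simp: \<pi>_def)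
  ultimately have "bij_betw \<pi> (?Y \<union> (T - ?Y)) (?X \<union> (T - ?X))"
    by (rule bij_betw_combine) auto
  moreover have "?Y \<union> (T - ?Y) = T" "?X \<union> (T - ?X) = T" by auto
  ultimately have "bij_betw \<pi> T T" by simp
  then have perm: "\<pi> permutes T" by (rule bij_imp_permutes) (simp add: \<pi>_def)
  have "y i = x (\<pi> i)" for i
  proof (cases "i \<in> T")
    case True
    show ?thesis
    proof (cases "y i = 1")
      case y: True
      then have "g i \<in> ?X" using True g by (auto simp: bij_betw_def)
      then show ?thesis using True y by (simp add: \<pi>_def)
    next
      case False
      then have "h i \<in> T - ?X" using True bij_betwE[OF h] by blast
      then have "x (h i) = 0" by auto
      then show ?thesis using True False by (simp add: \<pi>_def)
    qed
  qed (simp add: \<pi>_def assms(2))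
  then show ?thesis using perm by (intro exI[of _ \<pi>]) (auto simp: fun_eq_iff)
qed

text \<open>Once the coordinates outside \<open>T\<close> are fixed, the weight on \<open>T\<close>
  and the total weight determine each other, and the points with a given weight on \<open>T\<close>
  form one orbit of the permutations of \<open>T\<close>.\<close>

lemma symmetric_on_iff_class_const:
  assumes "T \<subseteq> {..<n}"
  shows "symmetric_on n T f \<longleftrightarrow> class_const n ({..<n} - T) f"
proof
  have fT: "finite T" using assms finite_subset by blast
  have split: "wt {..<n} x = wt T x + wt ({..<n} - T) x" for x
    using wt_Un[of T "{..<n} - T" x] fT assms by (simp add: Un_absorb1)
  {
    assume sym: "symmetric_on n T f"
    show "class_const n ({..<n} - T) f"
      unfolding class_const_def
    proof (intro ballI)
      fix x y assume x: "x \<in> cube n" and "y \<in> cls n ({..<n} - T) x"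
      then have y: "y \<in> cube n" "\<forall>i\<in>{..<n} - T. y i = x i" "wt {..<n} y = wt {..<n} x"
        by (auto simp: cl_def)
      have "x i = y i" if "i \<notin> T" for i
        using x y that by (cases "i < n") (auto simp: cube_def PiE_def extensional_def)
      moreover have "wt T x = wt T y"
        using y(3) wt_cong[of "{..<n} - T" y x] y(2) by (simp add: split)
      ultimately obtain \<pi> where "\<pi> permutes T" "y = x \<circ> \<pi>"
        using exists_rearrangement[OF fT] by blast
      then show "f y = f x" using sym x by (auto simp: symmetric_on_def)
    qed
  }
  {
    assume cc: "class_const n ({..<n} - T) f"
    show "symmetric_on n T f"
      unfolding symmetric_on_def
    proof (intro allI impI ballI)
      fix \<pi> x assume p: "\<pi> permutes T" and x: "x \<in> cube n"
      have pn: "\<pi> permutes {..<n}" using p assms by (rule permutes_subset)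
      have "x \<circ> \<pi> \<in> cube n"
        using x pn by (auto simp: cube_def PiE_def extensional_def permutes_in_image permutes_not_in)
      moreover have "\<forall>i\<in>{..<n} - T. (x \<circ> \<pi>) i = x i"
        using p by (auto simp: permutes_not_in)
      moreover have "wt {..<n} (x \<circ> \<pi>) = wt {..<n} x"
      proof -
        have "{i \<in> {..<n}. x i = 1} = \<pi> ` {i \<in> {..<n}. (x \<circ> \<pi>) i = 1}"
        proof (rule set_eqI)
          fix i
          have "\<pi> (inv \<pi> i) = i" using pn by (simp add: permutes_inverses)
          moreover have "i < n \<longleftrightarrow> inv \<pi> i < n"
            using permutes_in_image[OF permutes_inv[OF pn], of i] by simp
          moreover have "inv \<pi> (\<pi> j) = j" for j using pn by (simp add: permutes_inverses)
          moreover have "\<pi> j < n \<longleftrightarrow> j < n" for j using permutes_in_image[OF pn, of j] by simp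
          ultimately show "i \<in> {i \<in> {..<n}. x i = 1} \<longleftrightarrow> i \<in> \<pi> ` {i \<in> {..<n}. (x \<circ> \<pi>) i = 1}"
            unfolding image_iff mem_Collect_eq lessThan_iff comp_apply Bex_def by metis
        qed
        then show ?thesis
          unfolding wt_def using card_image[OF inj_on_subset[OF permutes_inj[OF pn] subset_UNIV]] by metis
      qed
      ultimately have "x \<circ> \<pi> \<in> cls n ({..<n} - T) x" by (simp add: cl_def)
      then show "f (x \<circ> \<pi>) = f x" using cc x by (simp add: class_const_def)
    qed
  }
qed

lemma class_const_mono:
  assumes "class_const n J f" "J \<subseteq> J'"
  shows "class_const n J' f"
proof -
  have "cls n J' x \<subseteq> cls n J x" for x using assms(2) by (auto simp: cl_def)
  then show ?thesis using assms(1) unfolding class_const_def by blast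
qed

text \<open>A witness set with fewer than \<open>k\<close> asymmetric coordinates may be enlarged,
  so sets of size exactly \<open>k\<close> suffice. The union bounds below range over these.\<close>

lemma SymF_iff:
  assumes "k \<le> n"
  shows "f \<in> SymF n (n - k) \<longleftrightarrow> f \<in> bool_funs n \<and> (\<exists>J\<subseteq>{..<n}. card J = k \<and> class_const n J f)"
proof
  assume "f \<in> SymF n (n - k)"
  then obtain T where T: "T \<subseteq> {..<n}" "n - k \<le> card T" "symmetric_on n T f" and f: "f \<in> bool_funs n"
    by (auto simp: SymF_def)
  have "card ({..<n} - T) = n - card T" using T(1) by (simp add: card_Diff_subset finite_subset)
  then have "card ({..<n} - T) \<le> k" using T(2) by linarith
  then obtain J where J: "{..<n} - T \<subseteq> J" "J \<subseteq> {..<n}" "card J = k"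
    using exists_subset_between[of "{..<n} - T" k "{..<n}"] assms by auto
  have "class_const n J f"
    using T J symmetric_on_iff_class_const class_const_mono by blast
  then show "f \<in> bool_funs n \<and> (\<exists>J\<subseteq>{..<n}. card J = k \<and> class_const n J f)"
    using J f by blast
next
  assume "f \<in> bool_funs n \<and> (\<exists>J\<subseteq>{..<n}. card J = k \<and> class_const n J f)"
  then obtain J where J: "J \<subseteq> {..<n}" "card J = k" "class_const n J f" and f: "f \<in> bool_funs n"
    by blast
  have "{..<n} - ({..<n} - J) = J" using J(1) by auto
  then have "symmetric_on n ({..<n} - J) f"
    using J(3) symmetric_on_iff_class_const[of "{..<n} - J" n f] by simp
  moreover have "n - k \<le> card ({..<n} - J)"
    using J by (simp add: card_Diff_subset finite_subset)
  ultimately show "f \<in> SymF n (n - k)"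
    using f unfolding SymF_def by (intro CollectI conjI exI[of _ "{..<n} - J"]) auto
qed

lemma SymFI:
  assumes "k \<le> n" "f \<in> bool_funs n" "J \<subseteq> {..<n}" "card J \<le> k" "class_const n J f"
  shows "f \<in> SymF n (n - k)"
proof -
  obtain J' where J': "J \<subseteq> J'" "J' \<subseteq> {..<n}" "card J' = k"
    using exists_subset_between[of J k "{..<n}"] assms by auto
  then show ?thesis using assms class_const_mono SymF_iff by blast
qed

section \<open>Violations and majority decoding on classes\<close>

definition viol :: "nat \<Rightarrow> nat set \<Rightarrow> ((nat \<Rightarrow> bit) \<Rightarrow> bit) \<Rightarrow> (nat \<Rightarrow> bit) \<Rightarrow> real" where
  "viol n J f x = card {y \<in> cls n J x. f y \<noteq> f x} / card (cls n J x)"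

text \<open>Divided by \<open>2 ^ n\<close>, this is the probability that a random pair with the
  same key is a violation (\<open>prob_pair_in_class\<close>). It is a testable substitute for the
  distance to the functions that are constant on classes.\<close>

definition total_viol :: "nat \<Rightarrow> nat set \<Rightarrow> ((nat \<Rightarrow> bit) \<Rightarrow> bit) \<Rightarrow> real" where
  "total_viol n J f = (\<Sum>x\<in>cube n. viol n J f x)"

text \<open>Ties go to 1. Only the restriction of \<open>x\<close> to \<open>J\<close> matters
  (\<open>maj_cong\<close>), and \<open>w\<close> need not be the weight of
  \<open>x\<close>.\<close>

definition maj :: "nat \<Rightarrow> nat set \<Rightarrow> ((nat \<Rightarrow> bit) \<Rightarrow> bit) \<Rightarrow> (nat \<Rightarrow> bit) \<Rightarrow> nat \<Rightarrow> bit" where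
  "maj n J f x w = (if card (cl n J x w) \<le> 2 * card {y \<in> cl n J x w. f y = 1} then 1 else 0)"

definition majority :: "nat \<Rightarrow> nat set \<Rightarrow> ((nat \<Rightarrow> bit) \<Rightarrow> bit) \<Rightarrow> (nat \<Rightarrow> bit) \<Rightarrow> bit" where
  "majority n J f = restrict (\<lambda>x. maj n J f x (wt {..<n} x)) (cube n)"

lemma viol_nonneg: "0 \<le> viol n J f x"
  by (simp add: viol_def)

lemma viol_le_1: "viol n J f x \<le> 1"
  unfolding viol_def using card_mono[of "cls n J x" "{y \<in> cls n J x. f y \<noteq> f x}"]
  by (auto simp: divide_le_eq_1)

lemma maj_cong: "(\<And>i. i \<in> J \<Longrightarrow> x i = y i) \<Longrightarrow> maj n J f x w = maj n J f y w"
proof -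
  assume "\<And>i. i \<in> J \<Longrightarrow> x i = y i"
  then have "cl n J x w = cl n J y w" by (auto simp: cl_def)
  then show ?thesis by (simp add: maj_def)
qed

lemma majority_bool_funs: "majority n J f \<in> bool_funs n"
  by (simp add: majority_def bool_funs_def)

lemma class_const_majority: "class_const n J (majority n J f)"
  unfolding class_const_def
proof (intro ballI)
  fix x y assume "x \<in> cube n" "y \<in> cls n J x"
  then show "majority n J f y = majority n J f x"
    by (auto simp: majority_def cl_def intro: maj_cong)
qed

text \<open>A point where \<open>f\<close> differs from the majority of its class disagrees with at
  least half of the class, so its \<open>viol\<close> is at least 1/2.\<close>

lemma disagree_majority_le: "real (card (disagree n f (majority n J f))) \<le> 2 * total_viol n J f"
proof -
  have half: "1 \<le> 2 * viol n J f x" if "x \<in> disagree n f (majority n J f)" for x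
  proof -
    have x: "x \<in> cube n" "f x \<noteq> maj n J f x (wt {..<n} x)"
      using that by (auto simp: disagree_def majority_def)
    let ?C = "cls n J x"
    have 2: "card ?C = card {y \<in> ?C. f y = 1} + card {y \<in> ?C. f y \<noteq> 1}"
      by (subst card_Un_disjoint[symmetric]) (auto intro: arg_cong[where f = card])
    have "card ?C \<le> 2 * card {y \<in> ?C. f y \<noteq> f x}"
    proof (cases "f x = 1")
      case True
      then have "maj n J f x (wt {..<n} x) = 0" using x(2) by (metis bit_not_one_iff)
      then have "2 * card {y \<in> ?C. f y = 1} < card ?C"
        by (simp add: maj_def split: if_splits)
      then show ?thesis using 2 True by simp
    next
      case False
      then have "maj n J f x (wt {..<n} x) = 1" using x(2) by (metis bit_not_one_iff)
      then have "card ?C \<le> 2 * card {y \<in> ?C. f y = 1}"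
        by (simp add: maj_def split: if_splits)
      moreover have "{y \<in> ?C. f y \<noteq> f x} = {y \<in> ?C. f y = 1}"
        using False by (metis bit_not_one_iff bit_not_zero_iff)
      ultimately show ?thesis by simp
    qed
    then show ?thesis using card_cls_pos[OF x(1), of J] by (simp add: viol_def field_simps)
  qed
  have "real (card (disagree n f (majority n J f))) = (\<Sum>x\<in>disagree n f (majority n J f). 1)" by simp
  also have "\<dots> \<le> (\<Sum>x\<in>disagree n f (majority n J f). 2 * viol n J f x)"
    by (rule sum_mono) (rule half)
  also have "\<dots> \<le> (\<Sum>x\<in>cube n. 2 * viol n J f x)"
    by (rule sum_mono2) (auto simp: disagree_def viol_nonneg)
  finally show ?thesis by (simp add: total_viol_def sum_distrib_left)
qed

text \<open>The majority function is a member of the property, so \<open>f\<close> has distance at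
  least \<open>\<epsilon>\<close> from it; the factor 1/2 comes from
  \<open>disagree_majority_le\<close>.\<close>

lemma far_imp_total_viol:
  assumes "k \<le> n" "far_from n \<epsilon> f (SymF n (n - k))" "J \<subseteq> {..<n}" "card J \<le> k"
  shows "\<epsilon> / 2 * 2 ^ n \<le> total_viol n J f"
proof -
  have "majority n J f \<in> SymF n (n - k)"
    by (rule SymFI[OF assms(1) majority_bool_funs assms(3,4) class_const_majority])
  then have "\<epsilon> * 2 ^ n \<le> card (disagree n f (majority n J f))"
    using assms(2) by (auto simp: far_from_def)
  then show ?thesis using disagree_majority_le[of n f J] by linarith
qed

text \<open>The weights fill an open interval of length \<open>s\<close>, because the condition
  bounds \<open>2 w\<close>.\<close>

lemma card_mid_weights:
  assumes "0 \<le> s"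
  shows "finite {w::nat. \<bar>real n - 2 * real w\<bar> < s}"
    and "real (card {w::nat. \<bar>real n - 2 * real w\<bar> < s}) \<le> s + 1"
proof -
  define a where "a = (real n - s) / 2"
  define b where "b = (real n + s) / 2"
  have e: "{w::nat. \<bar>real n - 2 * real w\<bar> < s} = {w. a < real w \<and> real w < b}"
    by (auto simp: a_def b_def abs_less_iff field_simps)
  have ab: "a \<le> b" "b - a = s" using assms by (auto simp: a_def b_def field_simps)
  have s: "int ` {w. a < real w \<and> real w < b} \<subseteq> {\<lfloor>a\<rfloor> + 1..\<lceil>b\<rceil> - 1}" (is "?A \<subseteq> ?B")
  proof
    fix z assume "z \<in> ?A"
    then obtain w where "z = int w" "a < real w" "real w < b" by auto
    then show "z \<in> ?B" by (simp; linarith)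
  qed
  then have fin: "finite ?A" by (rule finite_subset) simp
  then show "finite {w::nat. \<bar>real n - 2 * real w\<bar> < s}"
    unfolding e by (rule finite_imageD) (simp add: inj_on_def)
  have "card {w. a < real w \<and> real w < b} \<le> card ?B"
    using card_mono[OF _ s] by (simp add: card_image)
  moreover have "real (card ?B) \<le> b - a + 1" using ab by (simp; linarith)
  ultimately show "real (card {w::nat. \<bar>real n - 2 * real w\<bar> < s}) \<le> s + 1"
    unfolding e using ab by linarith
qed

text \<open>Only about \<open>sqrt n\<close> layers carry noticeable mass, so small classes cannot matter in total.
  This replaces lower bounds on binomial coefficients.\<close>

lemma light_classes:
  assumes "\<epsilon> > 0"
  obtains \<delta> where "0 < \<delta>" "\<delta> \<le> 1" "\<And>n J. n > 0 \<Longrightarrow> J \<subseteq> {..<n} \<Longrightarrow> card J \<le> k \<Longrightarrow>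
    real (card {x \<in> cube n. real (card (cls n J x)) < \<delta> * 2 ^ n / sqrt n}) \<le> \<epsilon> * 2 ^ n"
proof -
  \<comment> \<open>By Chebyshev the layers beyond \<open>t * sqrt n\<close> carry at most
    \<open>\<epsilon> / 2\<close> of the cube. The layers inside meet at most
    \<open>2 ^ k * (t + 1) * sqrt n\<close> classes, and \<open>\<delta>\<close> makes the light
    ones among them sum to at most the other \<open>\<epsilon> / 2\<close>.\<close>
  define t where "t = sqrt (2 / \<epsilon>)"
  define \<delta> where "\<delta> = min 1 (\<epsilon> / (2 * 2 ^ k * (t + 1)))"
  have t: "t > 0" "t\<^sup>2 = 2 / \<epsilon>" using assms by (auto simp: t_def)
  have \<delta>: "\<delta> > 0" "\<delta> \<le> 1" using assms t by (auto simp: \<delta>_def)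
  have "real (card {x \<in> cube n. real (card (cls n J x)) < \<delta> * 2 ^ n / sqrt n}) \<le> \<epsilon> * 2 ^ n"
    if n: "n > 0" and J: "J \<subseteq> {..<n}" "card J \<le> k" for n J
  proof -
    let ?out = "{x \<in> cube n. t * sqrt n \<le> \<bar>real n - 2 * real (wt {..<n} x)\<bar>}"
    let ?mid = "{x \<in> cube n. \<bar>real n - 2 * real (wt {..<n} x)\<bar> < t * sqrt n}"
    let ?L = "{x \<in> cube n. real (card (cls n J x)) < \<delta> * 2 ^ n / sqrt n}"
    let ?W = "{w. \<bar>real n - 2 * real w\<bar> < t * sqrt n}"
    let ?key = "key n J"
    have fJ: "finite J" using J(1) finite_subset by blast
    have sn: "sqrt n \<ge> 1" using n by simp
    have out: "real (card ?out) \<le> \<epsilon> / 2 * 2 ^ n"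
      using chebyshev_weight[OF t(1) n] t(2) by (simp add: mult.commute)
    have W: "real (card ?W) \<le> t * sqrt n + 1" "finite ?W"
      using card_mid_weights[of "t * sqrt n" n] t by auto
    have "card (?key ` (?L \<inter> ?mid)) \<le> 2 ^ card J * card ?W"
      by (rule card_keys[OF fJ W(2)]) auto
    then have "real (card (?key ` (?L \<inter> ?mid))) \<le> real (2 ^ card J * card ?W)"
      by (rule of_nat_mono)
    also have "\<dots> = 2 ^ card J * real (card ?W)" by simp
    also have "\<dots> \<le> 2 ^ k * (t * sqrt n + 1)"
      using W J by (intro mult_mono power_increasing) auto
    also have "\<dots> \<le> 2 ^ k * ((t + 1) * sqrt n)"
      using sn by (intro mult_left_mono) (auto simp: algebra_simps)
    finally have nkeys: "real (card (?key ` (?L \<inter> ?mid))) \<le> 2 ^ k * ((t + 1) * sqrt n)" .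
    have "?L \<inter> ?mid = (\<Union>c\<in>?key ` (?L \<inter> ?mid). {x \<in> ?L \<inter> ?mid. ?key x = c})" by auto
    then have "card (?L \<inter> ?mid) \<le> (\<Sum>c\<in>?key ` (?L \<inter> ?mid). card {x \<in> ?L \<inter> ?mid. ?key x = c})"
      using card_UN_le[of "?key ` (?L \<inter> ?mid)" "\<lambda>c. {x \<in> ?L \<inter> ?mid. ?key x = c}"] by simp
    then have "real (card (?L \<inter> ?mid)) \<le> (\<Sum>c\<in>?key ` (?L \<inter> ?mid). real (card {x \<in> ?L \<inter> ?mid. ?key x = c}))"
      unfolding of_nat_sum[symmetric] by (rule of_nat_mono)
    also have "\<dots> \<le> (\<Sum>c\<in>?key ` (?L \<inter> ?mid). \<delta> * 2 ^ n / sqrt n)"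
    proof (rule sum_mono)
      fix c assume "c \<in> ?key ` (?L \<inter> ?mid)"
      then obtain x where x: "x \<in> ?L" "c = ?key x" by auto
      have "{x \<in> ?L \<inter> ?mid. ?key x = c} \<subseteq> cls n J x"
        unfolding x(2) by (auto simp: key_eq_iff)
      then have "card {x \<in> ?L \<inter> ?mid. ?key x = c} \<le> card (cls n J x)" by (intro card_mono) auto
      then show "real (card {x \<in> ?L \<inter> ?mid. ?key x = c}) \<le> \<delta> * 2 ^ n / sqrt n" using x(1) by simp
    qed
    also have "\<dots> = real (card (?key ` (?L \<inter> ?mid))) * (\<delta> * 2 ^ n / sqrt n)" by simp
    also have "\<dots> \<le> 2 ^ k * ((t + 1) * sqrt n) * (\<delta> * 2 ^ n / sqrt n)"
      using nkeys \<delta> by (intro mult_right_mono) auto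
    also have "\<dots> = (\<delta> * (2 ^ k * (t + 1))) * 2 ^ n"
      using sn by simp
    also have "\<dots> \<le> \<epsilon> / 2 * 2 ^ n"
    proof (rule mult_right_mono)
      have "\<delta> * (2 ^ k * (t + 1)) \<le> \<epsilon> / (2 * 2 ^ k * (t + 1)) * (2 ^ k * (t + 1))"
        using t by (intro mult_right_mono) (auto simp: \<delta>_def)
      also have "\<dots> = \<epsilon> / 2" using t by (simp add: divide_simps)
      finally show "\<delta> * (2 ^ k * (t + 1)) \<le> \<epsilon> / 2" .
    qed simp
    finally have mid: "real (card (?L \<inter> ?mid)) \<le> \<epsilon> / 2 * 2 ^ n" .
    have "?L \<subseteq> ?out \<union> (?L \<inter> ?mid)" by auto
    then have "card ?L \<le> card (?out \<union> (?L \<inter> ?mid))" by (intro card_mono) auto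
    also have "\<dots> \<le> card ?out + card (?L \<inter> ?mid)" by (rule card_Un_le)
    finally show ?thesis using out mid by simp
  qed
  then show thesis using that \<delta> by blast
qed

section \<open>Decision trees and complexities\<close>

text \<open>Embeds nonadaptive algorithms into decision trees: \<open>h\<close> collects the answers
  along the branch and \<open>P\<close> gives the verdict at the leaf. The initial \<open>h\<close>
  supplies values at points outside the list.\<close>

primrec qtree :: "'a list \<Rightarrow> (('a \<Rightarrow> bit) \<Rightarrow> bool) \<Rightarrow> ('a \<Rightarrow> bit) \<Rightarrow> 'a dtree" where
  "qtree [] P h = Answer (P h)"
| "qtree (x # xs) P h = Query x (qtree xs P (h(x := 0))) (qtree xs P (h(x := 1)))"

lemma accepts_qtree: "accepts (qtree xs P h) f = P (\<lambda>x. if x \<in> set xs then f x else h x)"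
proof (induction xs arbitrary: h)
  case (Cons x xs)
  have "(\<lambda>y. if y \<in> set xs then f y else (h(x := f x)) y) = (\<lambda>y. if y \<in> set (x # xs) then f y else h y)"
    by auto
  moreover have "accepts (qtree (x # xs) P h) f = accepts (qtree xs P (h(x := f x))) f"
    by (cases "f x") auto
  ultimately show ?case by (simp only: Cons.IH)
qed simp

lemma depth_qtree [simp]: "depth (qtree xs P h) = length xs"
  by (induction xs arbitrary: h) auto

lemma queried_qtree [simp]: "queried (qtree xs P h) = set xs"
  by (induction xs arbitrary: h) auto

lemma prob_bind_pmf:
  "measure_pmf.prob (p \<bind> g) A = measure_pmf.expectation p (\<lambda>x. measure_pmf.prob (g x) A)"
proof -
  have "ennreal (measure_pmf.prob (p \<bind> g) A) = (\<integral>\<^sup>+x. ennreal (measure_pmf.prob (g x) A) \<partial>measure_pmf p)"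
    by (simp flip: measure_pmf.emeasure_eq_measure)
  also have "\<dots> = ennreal (measure_pmf.expectation p (\<lambda>x. measure_pmf.prob (g x) A))"
    by (intro nn_integral_eq_integral measure_pmf.integrable_const_bound[where B = 1]) auto
  finally show ?thesis by (simp add: integral_nonneg_AE)
qed

lemma prob_bind_pmf_of_set:
  assumes "finite S" "S \<noteq> {}"
  shows "measure_pmf.prob (pmf_of_set S \<bind> g) A = (\<Sum>s\<in>S. measure_pmf.prob (g s) A) / card S"
  by (simp add: prob_bind_pmf integral_pmf_of_set[OF assms(2,1)])

lemma prob_compl: "measure_pmf.prob p {x. \<not> P x} = 1 - measure_pmf.prob p {x. P x}"
  using measure_pmf.prob_compl[of "{x. P x}" p] by (simp add: Compl_eq_Diff_UNIV[symmetric] Collect_neg_eq)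

section \<open>From algorithms to asymptotic bounds on complexities\<close>

lemma enat_Inf_le: "P q \<Longrightarrow> Inf {enat q |q. P q} \<le> enat q"
  by (rule Inf_lower) auto

text \<open>The first premise has the shape of the definitions of the complexities, so that one
  algorithm for each large \<open>n\<close> gives the upper bound.\<close>

lemma enat_bigoI:
  assumes "\<And>n. F n = Inf {enat q |q. P n q}" "c > 0"
    and "\<forall>\<^sub>F n in sequentially. \<exists>q. P n q \<and> real q \<le> c * g n"
  shows "enat_bigo F g"
  unfolding enat_bigo_def
proof (intro exI conjI)
  show "c > 0" by fact
  show "\<forall>\<^sub>F n in sequentially. ereal_of_enat (F n) \<le> ereal (c * g n)"
    using assms(3)
  proof eventually_elim
    case (elim n)
    then obtain q where q: "P n q" "real q \<le> c * g n" by blast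
    have "F n \<le> enat q" unfolding assms(1) using q(1) by (rule enat_Inf_le)
    then have "ereal_of_enat (F n) \<le> ereal_of_enat (enat q)" by (simp only: ereal_of_enat_le_iff)
    also have "\<dots> \<le> ereal (c * g n)" using q(2) by simp
    finally show ?case .
  qed
qed

text \<open>A finite infimum is attained, so a bound valid for every algorithm transfers to it; an
  infinite one satisfies every lower bound.\<close>

lemma enat_bigomegaI:
  assumes "\<And>n. F n = Inf {enat q |q. P n q}" "c > 0"
    and "\<forall>\<^sub>F n in sequentially. \<forall>q. P n q \<longrightarrow> c * g n \<le> real q"
  shows "enat_bigomega F g"
  unfolding enat_bigomega_def
proof (intro exI conjI)
  show "c > 0" by fact
  show "\<forall>\<^sub>F n in sequentially. ereal (c * g n) \<le> ereal_of_enat (F n)"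
    using assms(3)
  proof eventually_elim
    case (elim n)
    show ?case
    proof (cases "F n")
      case (enat q)
      then have "{enat q |q. P n q} \<noteq> {}" using assms(1)[of n] by (auto simp: Inf_enat_def split: if_splits)
      then have "F n \<in> {enat q |q. P n q}" unfolding assms(1) Inf_enat_def by (auto intro: LeastI)
      then show ?thesis using elim enat by auto
    qed simp
  qed
qed

section \<open>Resampling coordinates\<close>

definition mix :: "nat set \<Rightarrow> (nat \<Rightarrow> bit) \<Rightarrow> (nat \<Rightarrow> bit) \<Rightarrow> nat \<Rightarrow> bit" where
  "mix D y x = (\<lambda>i. if i \<in> D then y i else x i)"

lemma mix_cube: "x \<in> cube n \<Longrightarrow> y \<in> cube n \<Longrightarrow> mix D y x \<in> cube n"
  by (auto simp: mix_def cube_def PiE_def extensional_def)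

lemma mix_mix: "mix D (mix D x y) (mix D y x) = x"
  by (auto simp: mix_def)

text \<open>Exchanging the coordinates in \<open>D\<close> between two points is an involution on
  pairs, so two independent uniform points stay independent and uniform.\<close>

lemma sum_mix:
  "(\<Sum>x\<in>cube n. \<Sum>y\<in>cube n. h (mix D y x) (mix D x y)) = (\<Sum>x\<in>cube n. \<Sum>y\<in>cube n. h x y)"
  unfolding sum.cartesian_product
  by (rule sum.reindex_bij_witness[where
    i = "\<lambda>(x, y). (mix D y x, mix D x y)" and j = "\<lambda>(x, y). (mix D y x, mix D x y)"])
    (auto simp: mix_mix mix_cube)

lemma wt_mix:
  assumes "D \<subseteq> {..<n}"
  shows "wt {..<n} (mix D y x) + wt D x = wt {..<n} x + wt D y"
proof -
  have fD: "finite D" using assms finite_subset by blast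
  have split: "wt {..<n} z = wt D z + wt ({..<n} - D) z" for z
    using wt_Un[of D "{..<n} - D" z] fD assms by (simp add: Un_absorb1)
  have "wt D (mix D y x) = wt D y" "wt ({..<n} - D) (mix D y x) = wt ({..<n} - D) x"
    by (auto intro!: wt_cong simp: mix_def)
  then show ?thesis by (simp add: split)
qed

text \<open>By unimodality the row climbs from 1 to its middle entry and then falls to 0, so its
  total variation is twice the middle entry minus 1.\<close>

lemma binomial_variation:
  "(\<Sum>j\<le>M. \<bar>real (M choose Suc j) - real (M choose j)\<bar>) + 1 \<le> 2 * real (M choose (M div 2))"
proof -
  define m where "m = M div 2"
  have up: "(\<Sum>j<m. \<bar>real (M choose Suc j) - real (M choose j)\<bar>) = real (M choose m) - 1"
  proof -
    have "(\<Sum>j<m. \<bar>real (M choose Suc j) - real (M choose j)\<bar>) = (\<Sum>j<m. real (M choose Suc j) - real (M choose j))"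
    proof (rule sum.cong)
      fix j assume "j \<in> {..<m}"
      then have "(M choose j) \<le> (M choose Suc j)"
        by (intro binomial_mono) (auto simp: m_def)
      then show "\<bar>real (M choose Suc j) - real (M choose j)\<bar> = real (M choose Suc j) - real (M choose j)" by simp
    qed simp
    then show ?thesis using sum_lessThan_telescope[of "\<lambda>j. real (M choose j)" m] by simp
  qed
  have down: "(\<Sum>j=m..M. \<bar>real (M choose Suc j) - real (M choose j)\<bar>) = real (M choose m)"
  proof -
    have "(M choose Suc j) \<le> (M choose j)" if "m \<le> j" "j \<le> M" for j
    proof (cases "j < M")
      case True
      then show ?thesis using that by (intro binomial_antimono) (auto simp: m_def)
    next
      case False
      then have "j = M" using that by simp
      then show ?thesis by (simp add: binomial_eq_0)
    qed
    then have "(\<Sum>j=m..M. \<bar>real (M choose Suc j) - real (M choose j)\<bar>) = (\<Sum>j=m..M. real (M choose j) - real (M choose Suc j))"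
      by (intro sum.cong) auto
    also have "\<dots> = - (\<Sum>j=m..M. real (M choose Suc j) - real (M choose j))"
      by (simp add: sum_negf[symmetric])
    also have "\<dots> = real (M choose m)" 
      by (subst sum_Suc_diff) (auto simp: m_def)
    finally show ?thesis .
  qed
  have "{..M} = {..<m} \<union> {m..M}" by (auto simp: m_def)
  then have "(\<Sum>j\<le>M. \<bar>real (M choose Suc j) - real (M choose j)\<bar>) = (real (M choose m) - 1) + real (M choose m)"
    using up down by (simp add: sum.union_disjoint ivl_disj_int)
  then show ?thesis by (simp add: m_def)
qed

text \<open>Summation by parts moves the shift from \<open>\<beta>\<close> to the coefficients,
  where it costs at most their total variation.\<close>

lemma binomial_shift_Suc:
  fixes \<beta> :: "nat \<Rightarrow> real"
  assumes "\<And>j. 0 \<le> \<beta> j \<and> \<beta> j \<le> 1"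
  shows "\<bar>(\<Sum>j\<le>M. (M choose j) * \<beta> (Suc a + j)) - (\<Sum>j\<le>M. (M choose j) * \<beta> (a + j))\<bar> \<le> 2 * real (M choose (M div 2))"
proof -
  have b: "\<bar>c * \<beta> j\<bar> \<le> \<bar>c\<bar>" for c j using assms[of j] by (simp add: abs_mult mult_left_le)
  have "(\<Sum>j\<le>M. (M choose j) * \<beta> (a + j)) = (\<Sum>j\<le>Suc M. (M choose j) * \<beta> (a + j))" by simp
  also have "\<dots> = \<beta> a + (\<Sum>j\<le>M. (M choose Suc j) * \<beta> (Suc a + j))"
    by (subst sum.atMost_Suc_shift) simp
  finally have "(\<Sum>j\<le>M. (M choose j) * \<beta> (Suc a + j)) - (\<Sum>j\<le>M. (M choose j) * \<beta> (a + j)) =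
     (\<Sum>j\<le>M. (real (M choose j) - real (M choose Suc j)) * \<beta> (Suc a + j)) - \<beta> a"
    by (simp add: sum_subtractf algebra_simps)
  also have "\<bar>\<dots>\<bar> \<le> (\<Sum>j\<le>M. \<bar>(real (M choose j) - real (M choose Suc j)) * \<beta> (Suc a + j)\<bar>) + \<bar>\<beta> a\<bar>"
    by (rule order_trans[OF abs_triangle_ineq4]) (intro add_mono sum_abs order_refl)
  also have "\<dots> \<le> (\<Sum>j\<le>M. \<bar>real (M choose Suc j) - real (M choose j)\<bar>) + 1"
    using b assms[of a] by (intro add_mono sum_mono) (auto simp: abs_minus_commute)
  also have "\<dots> \<le> 2 * real (M choose (M div 2))" by (rule binomial_variation)
  finally show ?thesis .
qed

text \<open>A chain of unit shifts. After division by \<open>2 ^ M\<close>: shifting a binomial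
  variable by \<open>d\<close> changes the mean of a function with values in \<open>[0, 1]\<close>
  by \<open>O(d / sqrt M)\<close>.\<close>

lemma binomial_shift:
  fixes \<beta> :: "nat \<Rightarrow> real"
  assumes "\<And>j. 0 \<le> \<beta> j \<and> \<beta> j \<le> 1"
  shows "\<bar>(\<Sum>j\<le>M. (M choose j) * \<beta> (a + j)) - (\<Sum>j\<le>M. (M choose j) * \<beta> (b + j))\<bar>
    \<le> \<bar>real a - real b\<bar> * (2 * 2 ^ M / sqrt (real M + 1))"
proof -
  define S where "S = (\<lambda>a. \<Sum>j\<le>M. real (M choose j) * \<beta> (a + j))"
  let ?C = "2 * real (M choose (M div 2))"
  have up: "\<bar>S (a + d) - S a\<bar> \<le> real d * ?C" for a d
  proof (induction d)
    case (Suc d)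
    have "\<bar>S (a + Suc d) - S (a + d)\<bar> \<le> ?C"
      using binomial_shift_Suc[where M = M and a = "a + d", OF assms] by (simp add: S_def)
    then show ?case using Suc.IH by (simp add: algebra_simps)
  qed simp
  have "\<bar>S a - S b\<bar> \<le> \<bar>real a - real b\<bar> * ?C"
  proof (cases "a \<le> b")
    case True
    then show ?thesis using up[of a "b - a"] by (simp add: of_nat_diff abs_minus_commute)
  next
    case False
    then show ?thesis using up[of b "a - b"] by (simp add: of_nat_diff)
  qed
  also have "\<dots> \<le> \<bar>real a - real b\<bar> * (2 * (2 ^ M / sqrt (real M + 1)))"
    using binomial_le_sqrt[of M "M div 2"] by (intro mult_left_mono) auto
  finally show ?thesis by (simp add: S_def)
qed

text \<open>Resampling the few coordinates in \<open>D\<close> shifts the weight only by about \<open>sqrt |D|\<close>, which is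
  negligible against the \<open>sqrt M\<close> fluctuations of the weight on the coordinates that
  \<open>\<beta>\<close> does not see.\<close>

lemma resample:
  fixes \<beta> :: "(nat \<Rightarrow> bit) \<Rightarrow> nat \<Rightarrow> real"
  assumes F: "F \<subseteq> {..<n}" "D \<subseteq> F"
    and dep: "\<And>x y w. (\<And>i. i \<in> F \<Longrightarrow> x i = y i) \<Longrightarrow> \<beta> x w = \<beta> y w"
    and bd: "\<And>x w. 0 \<le> \<beta> x w \<and> \<beta> x w \<le> 1"
  shows "(\<Sum>x\<in>cube n. \<Sum>y\<in>cube n. \<beta> (mix D y x) (wt {..<n} x)) \<le>
     2 ^ n * (\<Sum>x\<in>cube n. \<beta> x (wt {..<n} x))
     + 4 ^ n * (2 * sqrt (card D) / sqrt (real (n - card F) + 1))"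
proof -
  define M where "M = n - card F"
  define Z where "Z = {..<n} - F"
  define c where "c = 2 * 2 ^ M / sqrt (real M + 1)"
  have Z: "Z \<subseteq> {..<n}" "card Z = M" using F by (auto simp: Z_def M_def card_Diff_subset finite_subset)
  have Mn: "M \<le> n" by (simp add: M_def)
  have D: "D \<subseteq> {..<n}" using F by auto
  have fF: "finite F" using F finite_subset by blast
  have splitw: "wt {..<n} x = wt F x + wt Z x" for x
    using wt_Un[of F Z x] F fF by (auto simp: Un_absorb1 Z_def)
  \<comment> \<open>The subtraction is on naturals and does not truncate, because
    \<open>D \<subseteq> F\<close> gives \<open>wt D x \<le> wt F x\<close>.\<close>
  have wtn: "wt {..<n} (mix D y (mix Z x' x)) = (wt F x + wt D y - wt D x) + wt Z x'"
    and wtn0: "wt {..<n} (mix Z x' x) = wt F x + wt Z x'" for x x' y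
  proof -
    have a: "wt F (mix Z x' x) = wt F x" "wt Z (mix Z x' x) = wt Z x'" "wt D (mix Z x' x) = wt D x"
      using F by (auto intro!: wt_cong simp: mix_def Z_def)
    then show "wt {..<n} (mix Z x' x) = wt F x + wt Z x'" by (simp add: splitw)
    then have "wt {..<n} (mix D y (mix Z x' x)) + wt D x = wt F x + wt Z x' + wt D y"
      using wt_mix[OF D(1), of y "mix Z x' x"] a by simp
    moreover have "wt D x \<le> wt F x"
      unfolding wt_def using F fF by (intro card_mono) auto
    ultimately show "wt {..<n} (mix D y (mix Z x' x)) = (wt F x + wt D y - wt D x) + wt Z x'" by linarith
  qed
  have depZ: "\<beta> (mix Z x' x) w = \<beta> x w" for x x' w
    by (rule dep) (auto simp: mix_def Z_def)
  \<comment> \<open>Redraw the coordinates in \<open>Z\<close> while keeping the others. As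
    \<open>\<beta>\<close> does not read them, they enter only as a binomial shift of the
    weight.\<close>
  have avg: "2 ^ n * (\<Sum>x\<in>cube n. h x) = (\<Sum>x\<in>cube n. \<Sum>x'\<in>cube n. h (mix Z x' x))" for h :: "(nat \<Rightarrow> bit) \<Rightarrow> real"
    using sum_mix[of "\<lambda>a b. h a" Z n] by (simp add: card_cube sum_distrib_left)
  have shift: "\<bar>(\<Sum>x'\<in>cube n. \<beta> x (a + wt Z x')) - (\<Sum>x'\<in>cube n. \<beta> x (b + wt Z x'))\<bar>
      \<le> \<bar>real a - real b\<bar> * (2 ^ (n - M) * c)" for x a b
  proof -
    have "(\<Sum>x'\<in>cube n. \<beta> x (a + wt Z x')) = 2 ^ (n - M) * (\<Sum>j\<le>M. (M choose j) * \<beta> x (a + j))" for a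
      using sum_wt[OF Z(1), of "\<lambda>j. \<beta> x (a + j)"] Z by simp
    then have "\<bar>(\<Sum>x'\<in>cube n. \<beta> x (a + wt Z x')) - (\<Sum>x'\<in>cube n. \<beta> x (b + wt Z x'))\<bar> =
       2 ^ (n - M) * \<bar>(\<Sum>j\<le>M. (M choose j) * \<beta> x (a + j)) - (\<Sum>j\<le>M. (M choose j) * \<beta> x (b + j))\<bar>"
      by (simp add: right_diff_distrib[symmetric] abs_mult)
    also have "\<dots> \<le> 2 ^ (n - M) * (\<bar>real a - real b\<bar> * (2 * 2 ^ M / sqrt (real M + 1)))"
      by (intro mult_left_mono binomial_shift bd) auto
    finally show ?thesis by (simp add: c_def mult_ac)
  qed
  have pw: "(2::real) ^ (n - M) * 2 ^ M = 2 ^ n" using Mn by (simp flip: power_add)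
  have c2: "2 ^ (n - M) * c = 2 * 2 ^ n / sqrt (real M + 1)" using pw by (simp add: c_def)
  have one: "2 ^ n * (\<Sum>x\<in>cube n. \<beta> x (wt {..<n} (mix D y x))) \<le>
      2 ^ n * (\<Sum>x\<in>cube n. \<beta> x (wt {..<n} x)) + (\<Sum>x\<in>cube n. \<bar>real (wt D y) - real (wt D x)\<bar>) * (2 ^ (n - M) * c)" for y
  proof -
    have "2 ^ n * (\<Sum>x\<in>cube n. \<beta> x (wt {..<n} (mix D y x))) =
       (\<Sum>x\<in>cube n. \<Sum>x'\<in>cube n. \<beta> x ((wt F x + wt D y - wt D x) + wt Z x'))"
      by (subst avg) (simp add: wtn depZ)
    also have "\<dots> \<le> (\<Sum>x\<in>cube n. (\<Sum>x'\<in>cube n. \<beta> x (wt F x + wt Z x')) + \<bar>real (wt D y) - real (wt D x)\<bar> * (2 ^ (n - M) * c))"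
    proof (rule sum_mono)
      fix x
      have "wt D x \<le> wt F x"
        unfolding wt_def using F fF by (intro card_mono) auto
      then have "real (wt F x + wt D y - wt D x) - real (wt F x) = real (wt D y) - real (wt D x)"
        by (simp add: of_nat_diff)
      then show "(\<Sum>x'\<in>cube n. \<beta> x ((wt F x + wt D y - wt D x) + wt Z x')) \<le>
         (\<Sum>x'\<in>cube n. \<beta> x (wt F x + wt Z x')) + \<bar>real (wt D y) - real (wt D x)\<bar> * (2 ^ (n - M) * c)"
        using shift[of x "wt F x + wt D y - wt D x" "wt F x"] by simp
    qed
    also have "\<dots> = 2 ^ n * (\<Sum>x\<in>cube n. \<beta> x (wt {..<n} x)) + (\<Sum>x\<in>cube n. \<bar>real (wt D y) - real (wt D x)\<bar>) * (2 ^ (n - M) * c)"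
      by (subst avg) (simp add: wtn0 depZ sum.distrib sum_distrib_right)
    finally show ?thesis .
  qed
  \<comment> \<open>Both weights deviate from \<open>card D / 2\<close>; the triangle inequality
    reduces the difference to the two deviations.\<close>
  have dev: "(\<Sum>y\<in>cube n. \<Sum>x\<in>cube n. \<bar>real (wt D y) - real (wt D x)\<bar>) \<le> 4 ^ n * sqrt (card D)"
  proof -
    let ?d = "\<lambda>x. \<bar>real (card D) - 2 * real (wt D x)\<bar>"
    have "(\<Sum>y\<in>cube n. \<Sum>x\<in>cube n. \<bar>real (wt D y) - real (wt D x)\<bar>) \<le> (\<Sum>y\<in>cube n. \<Sum>x\<in>cube n. (?d y + ?d x) / 2)"
    proof (intro sum_mono)
      fix x y
      show "\<bar>real (wt D y) - real (wt D x)\<bar> \<le> (?d y + ?d x) / 2"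
        by (simp add: abs_if split: if_splits)
    qed
    also have "\<dots> = 2 ^ n * (\<Sum>x\<in>cube n. ?d x)"
      by (simp add: sum.distrib sum_divide_distrib[symmetric] card_cube sum_distrib_left[symmetric])
    also have "\<dots> \<le> 2 ^ n * (sqrt (card D) * 2 ^ n)"
      by (intro mult_left_mono sum_abs_signs D) auto
    also have "\<dots> = 4 ^ n * sqrt (card D)" by (simp add: power_mult_distrib[symmetric])
    finally show ?thesis .
  qed
  \<comment> \<open>After the exchange the first argument of \<open>\<beta>\<close> is the uniform
    point itself and only the weight argument is perturbed, which is the situation that
    \<open>shift\<close> controls.\<close>
  have swap: "(\<Sum>x\<in>cube n. \<Sum>y\<in>cube n. \<beta> (mix D y x) (wt {..<n} x)) = (\<Sum>y\<in>cube n. \<Sum>x\<in>cube n. \<beta> x (wt {..<n} (mix D y x)))"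
    using sum_mix[of "\<lambda>a b. \<beta> a (wt {..<n} (mix D b a))" D n] by (simp add: mix_mix) (rule sum.swap)
  have "2 ^ n * (\<Sum>x\<in>cube n. \<Sum>y\<in>cube n. \<beta> (mix D y x) (wt {..<n} x)) \<le>
     (\<Sum>y\<in>cube n. 2 ^ n * (\<Sum>x\<in>cube n. \<beta> x (wt {..<n} x)) + (\<Sum>x\<in>cube n. \<bar>real (wt D y) - real (wt D x)\<bar>) * (2 ^ (n - M) * c))"
    unfolding swap sum_distrib_left by (intro sum_mono one[unfolded sum_distrib_left])
  also have "\<dots> = 2 ^ n * (2 ^ n * (\<Sum>x\<in>cube n. \<beta> x (wt {..<n} x))) + (\<Sum>y\<in>cube n. \<Sum>x\<in>cube n. \<bar>real (wt D y) - real (wt D x)\<bar>) * (2 ^ (n - M) * c)"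
    by (simp add: sum.distrib card_cube sum_distrib_right)
  also have "\<dots> \<le> 2 ^ n * (2 ^ n * (\<Sum>x\<in>cube n. \<beta> x (wt {..<n} x))) + (4 ^ n * sqrt (card D)) * (2 ^ (n - M) * c)"
    using dev by (intro add_left_mono mult_right_mono) (auto simp: c_def)
  also have "\<dots> = 2 ^ n * (2 ^ n * (\<Sum>x\<in>cube n. \<beta> x (wt {..<n} x)) + 4 ^ n * (2 * sqrt (card D) / sqrt (real M + 1)))"
    unfolding c2 by (simp add: algebra_simps)
  finally show ?thesis unfolding M_def by simp
qed

text \<open>The majorities \<open>G\<close> for \<open>J1\<close> and \<open>H\<close> for
  \<open>J2\<close> are both near \<open>f\<close>. Since \<open>H\<close> does not read
  \<open>J1 - J2\<close>, resampling these coordinates at a fixed weight argument rarely changes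
  \<open>G\<close>. The majority \<open>h\<close> of \<open>G\<close> over this resampling is
  therefore near \<open>G\<close>, and it reads only \<open>J1 \<inter> J2\<close> and the weight.
  The coefficient 10 of the first violation is 8 for \<open>G\<close> against \<open>h\<close> plus
  2 for \<open>f\<close> against \<open>G\<close>.\<close>

lemma intersection_close:
  assumes J: "J1 \<subseteq> {..<n}" "J2 \<subseteq> {..<n}"
  shows "\<exists>h\<in>bool_funs n. class_const n (J1 \<inter> J2) h \<and>
    real (card (disagree n f h)) \<le> 10 * total_viol n J1 f + 8 * total_viol n J2 f
      + 2 * 2 ^ n * (2 * sqrt (card (J1 - J2)) / sqrt (real (n - card (J1 \<union> J2)) + 1))"
proof -
  define D where "D = J1 - J2"
  define F where "F = J1 \<union> J2"
  define \<tau> where "\<tau> = 2 * sqrt (card D) / sqrt (real (n - card F) + 1)"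
  define G where "G = maj n J1 f"
  define H where "H = maj n J2 f"
  define \<beta> :: "(nat \<Rightarrow> bit) \<Rightarrow> nat \<Rightarrow> real" where "\<beta> = (\<lambda>x w. of_bool (G x w \<noteq> H x w))"
  let ?w = "wt {..<n}"
  define h where "h = restrict (\<lambda>x. if 2 ^ n \<le> 2 * card {y \<in> cube n. G (mix D y x) (?w x) = 1} then 1 else 0 :: bit) (cube n)"
  have hb: "h \<in> bool_funs n" by (simp add: h_def bool_funs_def)
  have hc: "class_const n (J1 \<inter> J2) h"
    unfolding class_const_def
  proof (intro ballI)
    fix x x' assume x: "x \<in> cube n" "x' \<in> cls n (J1 \<inter> J2) x"
    then have x': "x' \<in> cube n" "\<forall>i\<in>J1 \<inter> J2. x' i = x i" "?w x' = ?w x" by (auto simp: cl_def)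
    have "G (mix D y x') w = G (mix D y x) w" for y w
      unfolding G_def using x'(2) by (intro maj_cong) (auto simp: mix_def D_def)
    then show "h x' = h x" using x x' by (simp add: h_def)
  qed
  have dG: "(\<Sum>x\<in>cube n. of_bool (f x \<noteq> G x (?w x))) \<le> 2 * total_viol n J1 f"
    using disagree_majority_le[of n f J1]
    by (simp add: real_card_Collect_eq_sum[symmetric] disagree_def majority_def G_def restrict_def cong: conj_cong del: sum_of_bool_eq)
  have dH: "(\<Sum>x\<in>cube n. of_bool (f x \<noteq> H x (?w x))) \<le> 2 * total_viol n J2 f"
    using disagree_majority_le[of n f J2]
    by (simp add: real_card_Collect_eq_sum[symmetric] disagree_def majority_def H_def restrict_def cong: conj_cong del: sum_of_bool_eq)
  have "(\<Sum>x\<in>cube n. \<beta> x (?w x)) \<le> (\<Sum>x\<in>cube n. of_bool (f x \<noteq> G x (?w x)) + of_bool (f x \<noteq> H x (?w x)))"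
    by (rule sum_mono) (auto simp: \<beta>_def)
  then have GH: "(\<Sum>x\<in>cube n. \<beta> x (?w x)) \<le> 2 * total_viol n J1 f + 2 * total_viol n J2 f"
    using dG dH by (simp add: sum.distrib)
  \<comment> \<open>\<open>G\<close> and \<open>H\<close> are known to agree mostly when their
    weight argument is the weight of the point. Here the point is resampled but the old weight is
    kept, and \<open>resample\<close> bounds the cost of this mismatch.\<close>
  have res: "(\<Sum>x\<in>cube n. \<Sum>y\<in>cube n. \<beta> (mix D y x) (?w x)) \<le> 2 ^ n * (\<Sum>x\<in>cube n. \<beta> x (?w x)) + 4 ^ n * \<tau>"
    unfolding \<tau>_def
  proof (rule resample)
    show "F \<subseteq> {..<n}" "D \<subseteq> F" using J by (auto simp: F_def D_def)
    fix x y :: "nat \<Rightarrow> bit" and w assume "\<And>i. i \<in> F \<Longrightarrow> x i = y i"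
    then have "G x w = G y w" "H x w = H y w"
      unfolding G_def H_def by (auto intro!: maj_cong simp: F_def)
    then show "\<beta> x w = \<beta> y w" by (simp add: \<beta>_def)
  qed (simp add: \<beta>_def)
  define E where "E = (\<lambda>x. \<Sum>y\<in>cube n. of_bool (G x (?w x) \<noteq> G (mix D y x) (?w x)) :: real)"
  have "E x \<le> (\<Sum>y\<in>cube n. \<beta> x (?w x) + \<beta> (mix D y x) (?w x))" for x
    unfolding E_def
  proof (rule sum_mono)
    fix y
    have "H (mix D y x) (?w x) = H x (?w x)"
      unfolding H_def by (intro maj_cong) (auto simp: mix_def D_def)
    then show "of_bool (G x (?w x) \<noteq> G (mix D y x) (?w x)) \<le> \<beta> x (?w x) + \<beta> (mix D y x) (?w x)"
      by (auto simp: \<beta>_def)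
  qed
  then have "(\<Sum>x\<in>cube n. E x) \<le> (\<Sum>x\<in>cube n. \<Sum>y\<in>cube n. \<beta> x (?w x) + \<beta> (mix D y x) (?w x))"
    by (rule sum_mono)
  also have "\<dots> = 2 ^ n * (\<Sum>x\<in>cube n. \<beta> x (?w x)) + (\<Sum>x\<in>cube n. \<Sum>y\<in>cube n. \<beta> (mix D y x) (?w x))"
    by (simp add: sum.distrib card_cube sum_distrib_left)
  also have "\<dots> \<le> 2 ^ n * (4 * total_viol n J1 f + 4 * total_viol n J2 f) + 4 ^ n * \<tau>"
    using res mult_left_mono[OF GH, of "2 ^ n"] by (simp add: algebra_simps)
  finally have sumE: "(\<Sum>x\<in>cube n. E x) \<le> 2 ^ n * (4 * total_viol n J1 f + 4 * total_viol n J2 f) + 4 ^ n * \<tau>" .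
  \<comment> \<open>If \<open>h x\<close> is not the value of \<open>G\<close> at \<open>x\<close>,
    then at least half of the resamplings change that value.\<close>
  have half: "2 ^ n * of_bool (G x (?w x) \<noteq> h x) \<le> 2 * E x" if x: "x \<in> cube n" for x
  proof (cases "G x (?w x) = h x")
    case False
    let ?A = "{y \<in> cube n. G (mix D y x) (?w x) = 1}" and ?B = "{y \<in> cube n. G x (?w x) \<noteq> G (mix D y x) (?w x)}"
    have E: "E x = card ?B" by (simp add: E_def real_card_Collect_eq_sum)
    have "2 ^ n \<le> 2 * card ?B"
    proof (cases "2 ^ n \<le> 2 * card ?A")
      case True
      then have "h x = 1" using x by (simp add: h_def)
      then have "G x (?w x) = 0" using False by (metis bit_not_one_iff)
      then have "?B = ?A" by auto
      then show ?thesis using True by simp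
    next
      case F2: False
      then have "h x = 0" using x by (simp add: h_def)
      then have "G x (?w x) = 1" using False by (metis bit_not_zero_iff)
      then have "?B = cube n - ?A" by auto
      then have "card ?B = 2 ^ n - card ?A" by (simp add: card_Diff_subset card_cube)
      then show ?thesis using F2 by linarith
    qed
    then have "real (2 ^ n) \<le> real (2 * card ?B)" by (rule of_nat_mono)
    then show ?thesis using False E by simp
  qed (simp add: E_def sum_nonneg)
  have "2 ^ n * (\<Sum>x\<in>cube n. of_bool (G x (?w x) \<noteq> h x)) \<le> 2 * (\<Sum>x\<in>cube n. E x)"
    unfolding sum_distrib_left by (rule sum_mono) (rule half)
  also have "\<dots> \<le> 2 ^ n * (8 * total_viol n J1 f + 8 * total_viol n J2 f + 2 * (2 ^ n * \<tau>))"
    using sumE power_mult_distrib[of "2 :: real" 2 n] by (simp add: algebra_simps)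
  finally have dh: "(\<Sum>x\<in>cube n. of_bool (G x (?w x) \<noteq> h x)) \<le> 8 * total_viol n J1 f + 8 * total_viol n J2 f + 2 * (2 ^ n * \<tau>)"
    by simp
  have "real (card (disagree n f h)) = (\<Sum>x\<in>cube n. of_bool (f x \<noteq> h x))"
    by (simp add: disagree_def real_card_Collect_eq_sum)
  also have "\<dots> \<le> (\<Sum>x\<in>cube n. of_bool (f x \<noteq> G x (?w x)) + of_bool (G x (?w x) \<noteq> h x))"
    by (rule sum_mono) auto
  also have "\<dots> \<le> 10 * total_viol n J1 f + 8 * total_viol n J2 f + 2 * 2 ^ n * \<tau>"
    using dG dh by (simp add: sum.distrib)
  finally show ?thesis using hb hc unfolding \<tau>_def D_def F_def by blast
qed

section \<open>Intersecting families\<close>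

text \<open>Divided by \<open>r ^ card Z\<close> this is the biased measure of \<open>\<A>\<close>:
  the bucket of a random colouring contains each element of \<open>Z\<close> independently with
  probability \<open>p = card K / r\<close>.\<close>

definition colcount :: "nat \<Rightarrow> nat set \<Rightarrow> nat set \<Rightarrow> nat set set \<Rightarrow> real" where
  "colcount r K Z \<A> = card {c \<in> Z \<rightarrow>\<^sub>E {..<r}. {i \<in> Z. c i \<in> K} \<in> \<A>}"

lemma colcount_sum: "finite Z \<Longrightarrow> colcount r K Z \<A> = (\<Sum>c\<in>Z \<rightarrow>\<^sub>E {..<r}. of_bool ({i \<in> Z. c i \<in> K} \<in> \<A>))"
  by (simp add: colcount_def real_card_Collect_eq_sum finite_PiE)

lemma sum_if_mem: 
  assumes "K \<subseteq> {..<r}"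
  shows "(\<Sum>q<r. if q \<in> K then X else Y) = real (card K) * X + (real r - real (card K)) * (Y :: real)"
proof -
  have "{..<r} \<inter> K = K" using assms by auto
  moreover have "card ({..<r} \<inter> - K) = r - card K"
    using assms by (simp add: Diff_eq[symmetric] card_Diff_subset finite_subset[OF assms])
  moreover have "card K \<le> r" using card_mono[OF _ assms] by simp
  ultimately show ?thesis by (simp add: sum.If_cases of_nat_diff)
qed

lemma colcount_insert:
  assumes "finite Z" "z \<notin> Z" "K \<subseteq> {..<r}"
  shows "colcount r K (insert z Z) \<A> =
    card K * colcount r K Z {S. insert z S \<in> \<A>} + (real r - card K) * colcount r K Z \<A>"
proof -
  have "{i \<in> insert z Z. (c(z := q)) i \<in> K} = (if q \<in> K then insert z {i \<in> Z. c i \<in> K} else {i \<in> Z. c i \<in> K})" for c q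
    using assms(2) by auto
  then have "colcount r K (insert z Z) \<A> =
     (\<Sum>q<r. \<Sum>c\<in>Z \<rightarrow>\<^sub>E {..<r}. of_bool ((if q \<in> K then insert z {i \<in> Z. c i \<in> K} else {i \<in> Z. c i \<in> K}) \<in> \<A>))"
    using assms by (simp add: colcount_sum sum_PiE_insert)
  also have "\<dots> = (\<Sum>q<r. if q \<in> K then colcount r K Z {S. insert z S \<in> \<A>} else colcount r K Z \<A>)"
    using assms by (intro sum.cong) (auto simp: colcount_sum)
  finally show ?thesis by (simp add: sum_if_mem[OF assms(3)])
qed

lemma colcount_mono:
  assumes "finite Z" "\<And>S. S \<subseteq> Z \<Longrightarrow> S \<in> \<A> \<Longrightarrow> S \<in> \<B>"
  shows "colcount r K Z \<A> \<le> colcount r K Z \<B>"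
  unfolding colcount_sum[OF assms(1)] by (rule sum_mono) (use assms(2) in \<open>auto simp: of_bool_def\<close>)

lemma colcount_nonneg: "0 \<le> colcount r K Z \<A>"
  by (simp add: colcount_def)

lemma colcount_le: "finite Z \<Longrightarrow> colcount r K Z \<A> \<le> r ^ card Z"
  using card_mono[of "Z \<rightarrow>\<^sub>E {..<r}" "{c \<in> Z \<rightarrow>\<^sub>E {..<r}. {i \<in> Z. c i \<in> K} \<in> \<A>}"]
  by (simp add: colcount_def finite_PiE card_PiE flip: of_nat_power)

text \<open>Put \<open>X = a1 * b1\<close>. If \<open>X > Y\<close>, then
  \<open>a0 * b0 \<le> Y^2 / X\<close>, and what has to be bounded is
  \<open>p^2 X + (1 - p)^2 Y^2 / X\<close>. This is convex in \<open>X\<close> and equals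
  \<open>(p^2 + (1 - p)^2) Y\<close> at both ends of the allowed range, \<open>X = Y\<close> and
  \<open>X = ((1 - p) / p)^2 Y\<close>. The product
  \<open>(X - Y) * (p^2 X - (1 - p)^2 Y) \<le> 0\<close> expresses this without division.\<close>

lemma cross_step:
  fixes a0 :: real
  assumes p: "0 \<le> p" "p \<le> 1" and nn: "0 \<le> a0" "a0 \<le> a1" "0 \<le> b0" "b0 \<le> b1"
    and Y: "a0 * b1 \<le> Y" "a1 * b0 \<le> Y" "p\<^sup>2 * (a1 * b1) \<le> (1 - p)\<^sup>2 * Y"
  shows "(p * a1 + (1 - p) * a0) * (p * b1 + (1 - p) * b0) \<le> Y"
proof (cases "a1 * b1 \<le> Y")
  case True
  have "(1 - p) * a0 \<le> (1 - p) * a1" "(1 - p) * b0 \<le> (1 - p) * b1"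
    using p nn by (auto intro: mult_left_mono)
  then have "p * a1 + (1 - p) * a0 \<le> a1" "p * b1 + (1 - p) * b0 \<le> b1"
    by (simp_all add: algebra_simps)
  moreover have "0 \<le> p * b1 + (1 - p) * b0" "0 \<le> a1" using p nn by simp_all
  ultimately have "(p * a1 + (1 - p) * a0) * (p * b1 + (1 - p) * b0) \<le> a1 * b1"
    by (intro mult_mono)
  then show ?thesis using True by simp
next
  case False
  define X where "X = a1 * b1"
  have X: "X > Y" using False by (simp add: X_def)
  have Y0: "0 \<le> Y" using Y(1) nn by (meson mult_nonneg_nonneg order_trans)
  have Xp: "X > 0" using X Y0 by simp
  have "(X - Y) * (p\<^sup>2 * X - (1 - p)\<^sup>2 * Y) \<le> 0"
    using X Y(3) by (intro mult_nonneg_nonpos) (auto simp: X_def)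
  then have "p\<^sup>2 * X * X + (1 - p)\<^sup>2 * (Y * Y) \<le> (p\<^sup>2 + (1 - p)\<^sup>2) * Y * X"
    by (simp add: algebra_simps)
  moreover have "a0 * b0 * X \<le> Y * Y"
    using mult_mono[OF Y(1,2)] nn Y0 by (simp add: X_def mult_ac)
  then have "(1 - p)\<^sup>2 * (a0 * b0 * X) \<le> (1 - p)\<^sup>2 * (Y * Y)" by (rule mult_left_mono) simp
  ultimately have "(p\<^sup>2 * X + (1 - p)\<^sup>2 * (a0 * b0)) * X \<le> (p\<^sup>2 + (1 - p)\<^sup>2) * Y * X"
    by (simp add: algebra_simps)
  then have 1: "p\<^sup>2 * X + (1 - p)\<^sup>2 * (a0 * b0) \<le> (p\<^sup>2 + (1 - p)\<^sup>2) * Y"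
    using Xp by simp
  have 2: "p * (1 - p) * (a1 * b0 + a0 * b1) \<le> p * (1 - p) * (2 * Y)"
    using Y p by (intro mult_left_mono) auto
  have "(p * a1 + (1 - p) * a0) * (p * b1 + (1 - p) * b0) =
      p\<^sup>2 * X + (1 - p)\<^sup>2 * (a0 * b0) + p * (1 - p) * (a1 * b0 + a0 * b1)"
    by (simp add: X_def power2_eq_square algebra_simps)
  also have "\<dots> \<le> (p\<^sup>2 + (1 - p)\<^sup>2) * Y + p * (1 - p) * (2 * Y)" using 1 2 by simp
  also have "\<dots> = Y" by (simp add: power2_eq_square algebra_simps)
  finally show ?thesis .
qed

text \<open>The bias \<open>p\<close> measure of a \<open>t\<close>-intersecting family is at most \<open>(p / (1 - p)) ^ t\<close>.  The cross
  version for two families goes through by induction on the ground set.\<close>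

lemma cross_intersecting:
  assumes "finite Z" "K \<subseteq> {..<r}" "2 * card K \<le> r" "r > 0"
    and "\<And>S S'. S \<in> \<A> \<Longrightarrow> S' \<in> \<B> \<Longrightarrow> S \<subseteq> Z \<Longrightarrow> S' \<subseteq> Z \<Longrightarrow> t \<le> card (S \<inter> S')"
  shows "colcount r K Z \<A> * colcount r K Z \<B> \<le> (r ^ card Z * (real (card K) / (real r - card K)) ^ t)\<^sup>2"
  using assms(1,5)
proof (induction Z arbitrary: t \<A> \<B> rule: finite_induct)
  case empty
  show ?case
  proof (cases "t = 0")
    case True
    then show ?thesis using colcount_le[of "{}" r K \<A>] colcount_le[of "{}" r K \<B>]
      by (simp add: colcount_nonneg mult_le_one)
  next
    case False
    then have "{} \<notin> \<A> \<or> {} \<notin> \<B>" using empty.prems[of "{}" "{}"] by auto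
    then show ?thesis by (auto simp: colcount_def)
  qed
next
  case (insert z Z)
  show ?case
  proof (cases t)
    case 0
    have "finite (insert z Z)" using insert.hyps by simp
    from mult_mono[OF colcount_le[OF this, of r K \<A>] colcount_le[OF this, of r K \<B>]]
    show ?thesis using 0 by (simp add: power2_eq_square colcount_nonneg)
  next
    case (Suc u)
    \<comment> \<open>The traces on \<open>Z\<close> of all members, with or without
      \<open>z\<close>. Taking the union makes \<open>a0 \<le> a1\<close> automatic, as
      \<open>cross_step\<close> demands.\<close>
    define \<A>1 where "\<A>1 = \<A> \<union> {S. insert z S \<in> \<A>}"
    define \<B>1 where "\<B>1 = \<B> \<union> {S. insert z S \<in> \<B>}"
    define a0 where "a0 = colcount r K Z \<A>"
    define b0 where "b0 = colcount r K Z \<B>"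
    define a1 where "a1 = colcount r K Z \<A>1"
    define b1 where "b1 = colcount r K Z \<B>1"
    define p where "p = real (card K) / r"
    define l where "l = real (card K) / (real r - card K)"
    define R where "R = (real r ^ card Z * l ^ t)\<^sup>2"
    have zS: "S \<subseteq> Z \<Longrightarrow> z \<notin> S \<and> finite S" for S using insert.hyps finite_subset by blast
    have 01: "a0 * b1 \<le> R"
      unfolding a0_def b1_def R_def l_def
    proof (rule insert.IH)
      fix S S' assume S: "S \<in> \<A>" "S' \<in> \<B>1" "S \<subseteq> Z" "S' \<subseteq> Z"
      have "S \<inter> insert z S' = S \<inter> S'" using zS[OF S(3)] by auto
      then show "t \<le> card (S \<inter> S')"
        using S insert.prems[of S S'] insert.prems[of S "insert z S'"] by (auto simp: \<B>1_def)
    qed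
    have 10: "a1 * b0 \<le> R"
      unfolding a1_def b0_def R_def l_def
    proof (rule insert.IH)
      fix S S' assume S: "S \<in> \<A>1" "S' \<in> \<B>" "S \<subseteq> Z" "S' \<subseteq> Z"
      have "insert z S \<inter> S' = S \<inter> S'" using zS[OF S(4)] by auto
      then show "t \<le> card (S \<inter> S')"
        using S insert.prems[of S S'] insert.prems[of "insert z S" "S'"] by (auto simp: \<A>1_def)
    qed
    \<comment> \<open>Here both sets may owe one common element to \<open>z\<close>, so only
      \<open>u = t - 1\<close> common elements remain in \<open>Z\<close>. In the mixed products
      above, \<open>z\<close> lies in at most one of the two sets and nothing is lost.\<close>
    have 11: "a1 * b1 \<le> (real r ^ card Z * l ^ u)\<^sup>2"
      unfolding a1_def b1_def l_def
    proof (rule insert.IH)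
      fix S S' assume S: "S \<in> \<A>1" "S' \<in> \<B>1" "S \<subseteq> Z" "S' \<subseteq> Z"
      have "S \<inter> insert z S' = S \<inter> S'" "insert z S \<inter> S' = S \<inter> S'"
        using zS[OF S(3)] zS[OF S(4)] by auto
      moreover have "card (insert z S \<inter> insert z S') = Suc (card (S \<inter> S'))"
        using zS[OF S(3)] by simp
      moreover have "S \<subseteq> insert z Z" "S' \<subseteq> insert z Z" using S by auto
      ultimately show "u \<le> card (S \<inter> S')"
        using S Suc insert.prems[of S S'] insert.prems[of "insert z S" "S'"]
          insert.prems[of S "insert z S'"] insert.prems[of "insert z S" "insert z S'"]
        by (auto simp: \<A>1_def \<B>1_def)
    qed
    have rK: "real (card K) < real r" "card K \<le> r" using assms(3,4) by auto
    have p: "0 \<le> p" "p \<le> 1" using rK by (auto simp: p_def)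
    have pl: "(1 - p) * l = p" using rK by (simp add: p_def l_def field_simps)
    have "(p * a1 + (1 - p) * a0) * (p * b1 + (1 - p) * b0) \<le> R"
    proof (rule cross_step)
      show "p\<^sup>2 * (a1 * b1) \<le> (1 - p)\<^sup>2 * R"
      proof -
        have "p\<^sup>2 * (a1 * b1) \<le> ((1 - p) * l)\<^sup>2 * (real r ^ card Z * l ^ u)\<^sup>2"
          unfolding pl using 11 by (rule mult_left_mono) simp
        also have "\<dots> = (1 - p)\<^sup>2 * R" by (simp add: R_def Suc power_mult_distrib)
        finally show ?thesis .
      qed
      show "0 \<le> a0" "0 \<le> b0" by (auto simp: a0_def b0_def colcount_nonneg)
      show "a0 \<le> a1" "b0 \<le> b1" using insert.hyps
        by (auto simp: a0_def a1_def b0_def b1_def \<A>1_def \<B>1_def intro!: colcount_mono)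
    qed (use p 01 10 in auto)
    then have "r\<^sup>2 * ((p * a1 + (1 - p) * a0) * (p * b1 + (1 - p) * b0)) \<le> r\<^sup>2 * R"
      by (rule mult_left_mono) simp
    moreover have "r * (p * a1 + (1 - p) * a0) = card K * a1 + (real r - card K) * a0"
      "r * (p * b1 + (1 - p) * b0) = card K * b1 + (real r - card K) * b0"
      using rK by (simp_all add: p_def field_simps)
    moreover have "colcount r K (insert z Z) \<A> \<le> card K * a1 + (real r - card K) * a0"
      unfolding colcount_insert[OF insert.hyps assms(2)] a0_def a1_def \<A>1_def
      using insert.hyps by (intro add_right_mono mult_left_mono colcount_mono) auto
    moreover have "colcount r K (insert z Z) \<B> \<le> card K * b1 + (real r - card K) * b0"
      unfolding colcount_insert[OF insert.hyps assms(2)] b0_def b1_def \<B>1_def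
      using insert.hyps by (intro add_right_mono mult_left_mono colcount_mono) auto
    ultimately have le: "colcount r K (insert z Z) \<A> \<le> r * (p * a1 + (1 - p) * a0)"
      "colcount r K (insert z Z) \<B> \<le> r * (p * b1 + (1 - p) * b0)"
      and sq: "r\<^sup>2 * ((p * a1 + (1 - p) * a0) * (p * b1 + (1 - p) * b0)) \<le> r\<^sup>2 * R"
      by simp_all
    have "colcount r K (insert z Z) \<A> * colcount r K (insert z Z) \<B>
        \<le> (r * (p * a1 + (1 - p) * a0)) * (r * (p * b1 + (1 - p) * b0))"
      by (rule mult_mono[OF le order_trans[OF colcount_nonneg le(1)] colcount_nonneg])
    also have "\<dots> \<le> r\<^sup>2 * R" using sq by (simp add: power2_eq_square mult_ac)
    also have "\<dots> = (real r ^ card (insert z Z) * l ^ t)\<^sup>2"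
      using insert.hyps by (simp add: R_def power_mult_distrib)
    finally show ?thesis by (simp add: l_def)
  qed
qed

lemma intersecting_family:
  assumes "finite Z" "K \<subseteq> {..<r}" "2 * card K \<le> r" "r > 0"
    and "\<And>S S'. S \<in> \<A> \<Longrightarrow> S' \<in> \<A> \<Longrightarrow> S \<subseteq> Z \<Longrightarrow> S' \<subseteq> Z \<Longrightarrow> t \<le> card (S \<inter> S')"
  shows "colcount r K Z \<A> \<le> r ^ card Z * (real (card K) / (real r - card K)) ^ t" (is "_ \<le> ?R")
proof (rule power2_le_imp_le[rotated])
  have "0 \<le> real (card K) / (real r - real (card K))" using assms(3) by simp
  then show "0 \<le> ?R" by simp
  show "(colcount r K Z \<A>)\<^sup>2 \<le> ?R\<^sup>2"
    using cross_intersecting[OF assms(1-4), of \<A> \<A> t] assms(5) by (simp add: power2_eq_square)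
qed

text \<open>Exponential Markov inequality: \<open>n \<le> d * card S\<close> gives
  \<open>2 ^ n \<le> (2 ^ d) ^ card S\<close>, and the sum of the right-hand side over all
  colourings factorises over the coordinates.\<close>

lemma colcount_large:
  assumes "K \<subseteq> {..<r}"
  shows "colcount r K {..<n} {S. n \<le> d * card S} * 2 ^ n \<le> (real r + (2 ^ d - 1) * card K) ^ n"
proof -
  have sum: "(\<Sum>c\<in>Z \<rightarrow>\<^sub>E {..<r}. (2 ^ d) ^ card {i \<in> Z. c i \<in> K}) = (real r + (2 ^ d - 1) * card K) ^ card Z"
    if "finite Z" for Z
    using that
  proof (induction Z rule: finite_induct)
    case (insert z Z)
    have "{i \<in> insert z Z. (c(z := q)) i \<in> K} = (if q \<in> K then insert z {i \<in> Z. c i \<in> K} else {i \<in> Z. c i \<in> K})" for c q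
      using insert.hyps by auto
    then have "card {i \<in> insert z Z. (c(z := q)) i \<in> K} = (if q \<in> K then Suc (card {i \<in> Z. c i \<in> K}) else card {i \<in> Z. c i \<in> K})" for c q
      using insert.hyps by simp
    then have "(\<Sum>c\<in>insert z Z \<rightarrow>\<^sub>E {..<r}. (2 ^ d :: real) ^ card {i \<in> insert z Z. c i \<in> K}) =
      (\<Sum>q<r. if q \<in> K then 2 ^ d * (\<Sum>c\<in>Z \<rightarrow>\<^sub>E {..<r}. (2 ^ d) ^ card {i \<in> Z. c i \<in> K}) 
         else (\<Sum>c\<in>Z \<rightarrow>\<^sub>E {..<r}. (2 ^ d) ^ card {i \<in> Z. c i \<in> K}))"
      unfolding sum_PiE_insert[OF insert.hyps] by (intro sum.cong) (auto simp: sum_distrib_left)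
    then show ?case using insert.hyps
      by (simp add: sum_if_mem[OF assms] insert.IH algebra_simps)
  qed simp
  have "colcount r K {..<n} {S. n \<le> d * card S} * 2 ^ n =
     (\<Sum>c\<in>{..<n} \<rightarrow>\<^sub>E {..<r}. of_bool (n \<le> d * card {i \<in> {..<n}. c i \<in> K}) * 2 ^ n)"
    by (simp add: colcount_sum sum_distrib_right)
  also have "\<dots> \<le> (\<Sum>c\<in>{..<n} \<rightarrow>\<^sub>E {..<r}. (2 ^ d) ^ card {i \<in> {..<n}. c i \<in> K})"
    by (intro sum_mono) (auto simp: power_mult[symmetric] intro: power_increasing)
  also have "\<dots> = (real r + (2 ^ d - 1) * card K) ^ n" using sum[of "{..<n}"] by simp
  finally show ?thesis .
qed

section \<open>Testing with queries\<close>

definition pair_in_class :: "nat \<Rightarrow> nat set \<Rightarrow> ((nat \<Rightarrow> bit) \<times> (nat \<Rightarrow> bit)) pmf" where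
  "pair_in_class n J = pmf_of_set (cube n) \<bind> (\<lambda>x. map_pmf (Pair x) (pmf_of_set (cls n J x)))"

lemma set_pair_in_class:
  assumes "p \<in> set_pmf (pair_in_class n J)"
  shows "fst p \<in> cube n" "snd p \<in> cls n J (fst p)"
proof -
  have "cls n J x \<noteq> {}" if "x \<in> cube n" for x using that self_in_cls by blast
  then show "fst p \<in> cube n" "snd p \<in> cls n J (fst p)"
    using assms by (auto simp: pair_in_class_def set_pmf_of_set)
qed

lemma prob_pair_in_class:
  "measure_pmf.prob (pair_in_class n J) {p. f (fst p) = f (snd p)} = 1 - total_viol n J f / 2 ^ n"
proof -
  have each: "measure_pmf.prob (map_pmf (Pair x) (pmf_of_set (cls n J x))) {p. f (fst p) = f (snd p)} = 1 - viol n J f x"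
    if x: "x \<in> cube n" for x
  proof -
    have ne: "cls n J x \<noteq> {}" using x self_in_cls by blast
    let ?E = "{y \<in> cls n J x. f y = f x}" and ?D = "{y \<in> cls n J x. f y \<noteq> f x}"
    have cED: "card (cls n J x) = card ?E + card ?D"
      by (subst card_Un_disjoint[symmetric]) (auto intro: arg_cong[where f = card])
    have pr: "measure_pmf.prob (map_pmf (Pair x) (pmf_of_set (cls n J x))) {p. f (fst p) = f (snd p)}
        = real (card ?E) / real (card (cls n J x))"
      by (simp add: measure_pmf_of_set[OF ne] vimage_def Int_def eq_commute)
    have gen: "e / c = 1 - d / c" if "c > 0" "c = e + d" for c d e :: real
      using that by (auto simp: field_simps)
    show ?thesis unfolding viol_def pr
    proof (rule gen)
      show "0 < real (card (cls n J x))" using card_cls_pos[OF x, of J] by simp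
    qed (simp add: cED)
  qed
  show ?thesis
    unfolding pair_in_class_def prob_bind_pmf_of_set[OF finite_cube cube_nonempty]
    by (simp only: each cong: sum.cong) (simp add: card_cube sum_subtractf total_viol_def diff_divide_distrib)
qed

lemma prob_Pi_pmf_fiber:
  fixes m :: nat
  assumes "finite Ks" "K \<in> Ks"
  shows "measure_pmf.prob (Pi_pmf (Ks \<times> {..<m}) dflt (\<lambda>i. p (fst i))) {\<omega>. \<forall>j<m. \<omega> (K, j) \<in> E}
    = measure_pmf.prob (p K) E ^ m"
proof -
  let ?B = "\<lambda>i :: 'a \<times> nat. if fst i = K then E else UNIV"
  have "{\<omega>. \<forall>j<m. \<omega> (K, j) \<in> E} = Pi (Ks \<times> {..<m}) ?B"
    using assms(2) by (auto simp: Pi_def)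
  then have "measure_pmf.prob (Pi_pmf (Ks \<times> {..<m}) dflt (\<lambda>i. p (fst i))) {\<omega>. \<forall>j<m. \<omega> (K, j) \<in> E}
     = (\<Prod>i\<in>Ks \<times> {..<m}. measure_pmf.prob (p (fst i)) (?B i))"
    using assms(1) by (simp only: measure_Pi_pmf_Pi finite_cartesian_product finite_lessThan)
  also have "\<dots> = (\<Prod>K'\<in>Ks. \<Prod>j<m. if K' = K then measure_pmf.prob (p K) E else 1)"
    by (subst prod.cartesian_product) (auto intro!: prod.cong)
  also have "\<dots> = (\<Prod>K'\<in>Ks. if K' = K then measure_pmf.prob (p K) E ^ m else 1)"
    by (intro prod.cong) auto
  also have "\<dots> = measure_pmf.prob (p K) E ^ m" using assms by (simp add: prod.delta)
  finally show ?thesis .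
qed

definition bucket :: "nat \<Rightarrow> (nat \<Rightarrow> nat) \<Rightarrow> nat set \<Rightarrow> nat set" where
  "bucket n c K = {i \<in> {..<n}. c i \<in> K}"

definition pair_points :: "('i \<Rightarrow> 'a \<times> 'a) \<Rightarrow> 'i list \<Rightarrow> 'a list" where
  "pair_points \<omega> ix = map (\<lambda>i. fst (\<omega> i)) ix @ map (\<lambda>i. snd (\<omega> i)) ix"

text \<open>The colouring is shared by all \<open>K\<close>, while the pairs are independent given
  the colouring. The list \<open>ix\<close> fixes an order of the pairs, as a tree has to query them
  one after the other.\<close>

definition coloring_tester :: "nat \<Rightarrow> nat \<Rightarrow> nat set set \<Rightarrow> nat \<Rightarrow> (nat set \<times> nat) list \<Rightarrow> (nat \<Rightarrow> bit) dtree pmf" where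
  "coloring_tester n r Ks m ix = pmf_of_set ({..<n} \<rightarrow>\<^sub>E {..<r}) \<bind> (\<lambda>c.
     map_pmf (\<lambda>\<omega>. qtree (pair_points \<omega> ix) (\<lambda>f. \<exists>K\<in>Ks. \<forall>j<m. f (fst (\<omega> (K, j))) = f (snd (\<omega> (K, j)))) (\<lambda>_. 0))
       (Pi_pmf (Ks \<times> {..<m}) (undefined, undefined) (\<lambda>i. pair_in_class n (bucket n c (fst i)))))"

lemma accepts_coloring_tree:
  assumes "set ix = Ks \<times> {..<m}"
  shows "accepts (qtree (pair_points \<omega> ix) (\<lambda>f. \<exists>K\<in>Ks. \<forall>j<m. f (fst (\<omega> (K, j))) = f (snd (\<omega> (K, j)))) (\<lambda>_. 0)) f
    \<longleftrightarrow> (\<exists>K\<in>Ks. \<forall>j<m. f (fst (\<omega> (K, j))) = f (snd (\<omega> (K, j))))"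
proof -
  have "fst (\<omega> (K, j)) \<in> set (pair_points \<omega> ix)" "snd (\<omega> (K, j)) \<in> set (pair_points \<omega> ix)"
    if "K \<in> Ks" "j < m" for K j
    using that assms by (auto simp: pair_points_def)
  then show ?thesis unfolding accepts_qtree by (intro bex_cong all_cong) auto
qed

lemma coloring_tester_support:
  assumes "t \<in> set_pmf (coloring_tester n r Ks m ix)" "finite Ks" "r > 0" "set ix = Ks \<times> {..<m}"
  obtains c \<omega> where "c \<in> {..<n} \<rightarrow>\<^sub>E {..<r}"
    "\<And>K j. K \<in> Ks \<Longrightarrow> j < m \<Longrightarrow> \<omega> (K, j) \<in> set_pmf (pair_in_class n (bucket n c K))"
    "t = qtree (pair_points \<omega> ix) (\<lambda>f. \<exists>K\<in>Ks. \<forall>j<m. f (fst (\<omega> (K, j))) = f (snd (\<omega> (K, j)))) (\<lambda>_. 0)"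
proof -
  have ne: "{..<n} \<rightarrow>\<^sub>E {..<r} \<noteq> {}" using assms(3) by (auto simp: PiE_eq_empty_iff)
  obtain c \<omega> where c: "c \<in> {..<n} \<rightarrow>\<^sub>E {..<r}"
    and \<omega>: "\<omega> \<in> set_pmf (Pi_pmf (Ks \<times> {..<m}) (undefined, undefined) (\<lambda>i. pair_in_class n (bucket n c (fst i))))"
    and t: "t = qtree (pair_points \<omega> ix) (\<lambda>f. \<exists>K\<in>Ks. \<forall>j<m. f (fst (\<omega> (K, j))) = f (snd (\<omega> (K, j)))) (\<lambda>_. 0)"
    using assms(1) ne by (auto simp: coloring_tester_def set_pmf_of_set finite_PiE)
  have "\<omega> (K, j) \<in> set_pmf (pair_in_class n (bucket n c K))" if "K \<in> Ks" "j < m" for K j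
  proof -
    have "(K, j) \<in> Ks \<times> {..<m}" using that by auto
    then show ?thesis using \<omega> assms(2) by (auto simp: set_Pi_pmf PiE_dflt_def)
  qed
  then show ?thesis using that c t by blast
qed

text \<open>The at most \<open>k\<close> colours occurring on the witness set \<open>J\<close> fit
  into some \<open>K\<close>, and the bucket of this \<open>K\<close> contains \<open>J\<close>. For
  this \<open>K\<close> no pair can disagree.\<close>

lemma coloring_tester_complete:
  assumes f: "f \<in> SymF n (n - k)" and "k \<le> n" "k \<le> r" "r > 0" and ix: "set ix = Ks \<times> {..<m}"
    and Ks: "Ks = {K. K \<subseteq> {..<r} \<and> card K = k}"
  shows "measure_pmf.prob (coloring_tester n r Ks m ix) {t. accepts t f} = 1"
proof -
  obtain J where J: "J \<subseteq> {..<n}" "card J = k" "class_const n J f"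
    using f SymF_iff[OF assms(2)] by blast
  have fin: "finite Ks" by (simp add: Ks)
  have ne: "{..<n} \<rightarrow>\<^sub>E {..<r} \<noteq> {}" using assms(4) by (auto simp: PiE_eq_empty_iff)
  have "accepts t f" if tD: "t \<in> set_pmf (coloring_tester n r Ks m ix)" for t
  proof -
    obtain c \<omega> where c: "c \<in> {..<n} \<rightarrow>\<^sub>E {..<r}"
      and \<omega>: "\<And>K j. K \<in> Ks \<Longrightarrow> j < m \<Longrightarrow> \<omega> (K, j) \<in> set_pmf (pair_in_class n (bucket n c K))"
      and t: "t = qtree (pair_points \<omega> ix) (\<lambda>f. \<exists>K\<in>Ks. \<forall>j<m. f (fst (\<omega> (K, j))) = f (snd (\<omega> (K, j)))) (\<lambda>_. 0)"
      using coloring_tester_support[OF tD fin assms(4) ix] by blast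
    have "c ` J \<subseteq> {..<r}" using c J(1) by auto
    moreover have "card (c ` J) \<le> k" using card_image_le[of J c] J finite_subset by fastforce
    ultimately obtain K where K: "c ` J \<subseteq> K" "K \<subseteq> {..<r}" "card K = k"
      using exists_subset_between[of "c ` J" k "{..<r}"] assms(3) by auto
    have "J \<subseteq> bucket n c K" using J(1) K(1) by (auto simp: bucket_def)
    then have cc: "class_const n (bucket n c K) f" using J(3) class_const_mono by blast
    have "f (fst (\<omega> (K, j))) = f (snd (\<omega> (K, j)))" if "j < m" for j
    proof -
      have "\<omega> (K, j) \<in> set_pmf (pair_in_class n (bucket n c K))"
        using \<omega> K that by (auto simp: Ks)
      from set_pair_in_class[OF this] cc show ?thesis by (auto simp: class_const_def)
    qed
    moreover have "K \<in> Ks" using K by (simp add: Ks)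
    ultimately show ?thesis unfolding t accepts_coloring_tree[OF ix] by blast
  qed
  then show ?thesis by (subst measure_pmf.prob_eq_1) (auto simp: AE_measure_pmf_iff)
qed

text \<open>Union bound over \<open>K\<close> for a fixed colouring; independence of the
  \<open>m\<close> pairs gives the power.\<close>

lemma coloring_tester_accept_le:
  assumes "finite Ks" "r > 0" "set ix = Ks \<times> {..<m}"
  shows "measure_pmf.prob (coloring_tester n r Ks m ix) {t. accepts t f}
    \<le> (\<Sum>K\<in>Ks. (\<Sum>c\<in>{..<n} \<rightarrow>\<^sub>E {..<r}. (1 - total_viol n (bucket n c K) f / 2 ^ n) ^ m) / r ^ n)"
proof -
  let ?C = "{..<n} \<rightarrow>\<^sub>E {..<r}"
  let ?p = "\<lambda>c. Pi_pmf (Ks \<times> {..<m}) (undefined, undefined) (\<lambda>i. pair_in_class n (bucket n c (fst i)))"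
  let ?Q = "\<lambda>K \<omega>. \<forall>j<m. f (fst (\<omega> (K, j))) = f (snd (\<omega> (K, j)))"
  have ne: "?C \<noteq> {}" using assms(2) by (auto simp: PiE_eq_empty_iff)
  have fC: "finite ?C" by (simp add: finite_PiE)
  have cC: "card ?C = r ^ n" by (simp add: card_PiE)
  have one: "measure_pmf.prob (?p c) {\<omega>. \<exists>K\<in>Ks. ?Q K \<omega>} \<le> (\<Sum>K\<in>Ks. (1 - total_viol n (bucket n c K) f / 2 ^ n) ^ m)" for c
  proof -
    have "{\<omega>. \<exists>K\<in>Ks. ?Q K \<omega>} = (\<Union>K\<in>Ks. {\<omega>. ?Q K \<omega>})" by auto
    moreover have "measure_pmf.prob (?p c) (\<Union>K\<in>Ks. {\<omega>. ?Q K \<omega>}) \<le> (\<Sum>K\<in>Ks. measure_pmf.prob (?p c) {\<omega>. ?Q K \<omega>})"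
      by (rule measure_pmf.finite_measure_subadditive_finite[OF assms(1)]) simp
    ultimately have "measure_pmf.prob (?p c) {\<omega>. \<exists>K\<in>Ks. ?Q K \<omega>} \<le> (\<Sum>K\<in>Ks. measure_pmf.prob (?p c) {\<omega>. ?Q K \<omega>})"
      by simp
    also have "\<dots> = (\<Sum>K\<in>Ks. (1 - total_viol n (bucket n c K) f / 2 ^ n) ^ m)"
    proof (rule sum.cong)
      fix K assume "K \<in> Ks"
      from prob_Pi_pmf_fiber[OF assms(1) this, of m "(undefined, undefined)" "\<lambda>K. pair_in_class n (bucket n c K)" "{p. f (fst p) = f (snd p)}"]
      show "measure_pmf.prob (?p c) {\<omega>. ?Q K \<omega>} = (1 - total_viol n (bucket n c K) f / 2 ^ n) ^ m"
        by (simp add: prob_pair_in_class)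
    qed simp
    finally show ?thesis .
  qed
  have "measure_pmf.prob (coloring_tester n r Ks m ix) {t. accepts t f} =
     (\<Sum>c\<in>?C. measure_pmf.prob (?p c) {\<omega>. \<exists>K\<in>Ks. ?Q K \<omega>}) / r ^ n"
    unfolding coloring_tester_def
    by (simp add: prob_bind_pmf_of_set[OF fC ne] vimage_def accepts_coloring_tree[OF assms(3)] cC)
  also have "\<dots> \<le> (\<Sum>c\<in>?C. \<Sum>K\<in>Ks. (1 - total_viol n (bucket n c K) f / 2 ^ n) ^ m) / r ^ n"
    by (intro divide_right_mono sum_mono one) simp
  also have "\<dots> = (\<Sum>K\<in>Ks. (\<Sum>c\<in>?C. (1 - total_viol n (bucket n c K) f / 2 ^ n) ^ m) / r ^ n)"
    by (subst sum.swap) (simp add: sum_divide_distrib)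
  finally show ?thesis .
qed

text \<open>If \<open>S\<close> and \<open>S'\<close> met in at most \<open>k\<close> coordinates,
  the function from \<open>intersection_close\<close> would be a member at relative distance at most
  \<open>(10 + 8) \<epsilon> / 36 + \<epsilon> / 4 = 3 \<epsilon> / 4\<close>, so \<open>f\<close>
  would not be far.\<close>

lemma almost_symmetric_intersecting:
  fixes d :: nat
  assumes "far_from n \<epsilon> f (SymF n (n - k))" "0 < \<epsilon>" "k \<le> n" "n > 0" "512 / \<epsilon>\<^sup>2 \<le> d" "4 \<le> d"
    and S: "S \<subseteq> {..<n}" "total_viol n S f < \<epsilon> / 36 * 2 ^ n" "d * card S < n"
    and S': "S' \<subseteq> {..<n}" "total_viol n S' f < \<epsilon> / 36 * 2 ^ n" "d * card S' < n"
  shows "k + 1 \<le> card (S \<inter> S')"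
proof (rule ccontr)
  assume "\<not> k + 1 \<le> card (S \<inter> S')"
  then have c: "card (S \<inter> S') \<le> k" by simp
  define \<tau> where "\<tau> = 2 * sqrt (card (S - S')) / sqrt (real (n - card (S \<union> S')) + 1)"
  obtain h where h: "h \<in> bool_funs n" "class_const n (S \<inter> S') h"
    "real (card (disagree n f h)) \<le> 10 * total_viol n S f + 8 * total_viol n S' f + 2 * 2 ^ n * \<tau>"
    using intersection_close[OF S(1) S'(1), of f] by (auto simp: \<tau>_def)
  have "h \<in> SymF n (n - k)"
    using assms(3) h(1) _ c h(2) by (rule SymFI) (use S(1) in auto)
  then have far: "\<epsilon> * 2 ^ n \<le> card (disagree n f h)" using assms(1) by (auto simp: far_from_def)
  \<comment> \<open>Both sets have fewer than \<open>n / d\<close> elements. Hence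
    \<open>4 \<le> d\<close> leaves at least half of the coordinates outside their union, and
    \<open>2 / d \<le> (\<epsilon> / 16)^2\<close> amounts to
    \<open>d \<ge> 512 / \<epsilon>^2\<close>.\<close>
  have "\<tau> \<le> \<epsilon> / 8"
  proof -
    have fin: "finite S" "finite S'" using S(1) S'(1) finite_subset by blast+
    have "card (S - S') \<le> card S" using fin by (intro card_mono) auto
    then have "d * card (S - S') \<le> n" using S(3) by (meson le_trans less_imp_le mult_le_mono2)
    then have 1: "real d * real (card (S - S')) \<le> n" by (metis of_nat_le_iff of_nat_mult)
    have "card (S \<union> S') \<le> card S + card S'" by (rule card_Un_le)
    moreover have "4 * card S \<le> d * card S" "4 * card S' \<le> d * card S'" using assms(6) by auto
    ultimately have "2 * card (S \<union> S') \<le> n" using S(3) S'(3) by linarith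
    then have 2: "real n / 2 \<le> real (n - card (S \<union> S')) + 1" by linarith
    have d: "d > 0" using assms(6) by simp
    have "\<tau> = 2 * sqrt (real (card (S - S')) / (real (n - card (S \<union> S')) + 1))"
      by (simp add: \<tau>_def real_sqrt_divide)
    also have "real (card (S - S')) / (real (n - card (S \<union> S')) + 1) \<le> (real n / d) / (real n / 2)"
      using 1 2 d assms(4) by (intro frac_le) (auto simp: field_simps)
    also have "\<dots> = 2 / d" using assms(4) d by (simp add: field_simps)
    also have "\<dots> \<le> (\<epsilon> / 16)\<^sup>2" using assms(2,5) d by (simp add: field_simps power2_eq_square)
    finally show ?thesis using assms(2) by simp
  qed
  then have "2 * 2 ^ n * \<tau> \<le> 2 * 2 ^ n * (\<epsilon> / 8)" by (intro mult_left_mono) auto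
  moreover define e where "e = \<epsilon> * 2 ^ n"
  ultimately have "2 * 2 ^ n * \<tau> \<le> e / 4" by simp
  moreover have "total_viol n S f < e / 36" "total_viol n S' f < e / 36" "e \<le> card (disagree n f h)"
    using S(2) S'(2) far by (simp_all add: e_def)
  moreover have "e > 0" using assms(2) by (simp add: e_def)
  ultimately show False using h(3) by linarith
qed

text \<open>A colour set \<open>K\<close> can accept a far function for three reasons: its bucket is
  small and nearly symmetric (intersecting family), its bucket is large, or \<open>m\<close> random
  pairs miss a substantial violation. Each reason contributes at most 1/12 when summed over all
  \<open>K\<close>.\<close>

lemma classical_tester_exists:
  assumes "k \<ge> 1" "0 < \<epsilon>"
  shows "\<exists>q. \<forall>\<^sub>F n in sequentially. \<exists>D. is_tester n \<epsilon> (SymF n (n - k)) q D"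
proof -
  define d where "d = nat \<lceil>512 / \<epsilon>\<^sup>2\<rceil> + 4"
  have d: "512 / \<epsilon>\<^sup>2 \<le> d" "4 \<le> d" unfolding d_def by linarith+
  \<comment> \<open>The first summand gives \<open>2 ^ d * k \<le> r / 4\<close>, so
    \<open>colcount_large\<close> yields \<open>(5 / 8) ^ n\<close>. The second gives \<open>r ^ k *
    (2 k / r) ^ (k + 1) = (2 k) ^ (k + 1) / r \<le> 1 / 12\<close>.\<close>
  define r where "r = 4 * 2 ^ d * k + 12 * (2 * k) ^ (k + 1)"
  define \<eta> where "\<eta> = min 1 (\<epsilon> / 36)"
  have \<eta>: "0 < \<eta>" "\<eta> \<le> 1" "\<eta> \<le> \<epsilon> / 36" using assms by (auto simp: \<eta>_def)
  define Ks where "Ks = {K. K \<subseteq> {..<r} \<and> card K = k}"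
  have fin: "finite Ks" by (simp add: Ks_def)
  have r4: "4 * 2 ^ d * k \<le> r" "2 * k \<le> r" "k \<le> r" "r > 0" 
  proof -
    show a: "4 * 2 ^ d * k \<le> r" by (simp add: r_def)
    have "1 * k \<le> 2 ^ d * k" by (rule mult_le_mono1) simp
    then have "4 * k \<le> r" using a by linarith
    then show "2 * k \<le> r" "k \<le> r" "r > 0" using assms(1) by linarith+
  qed
  have cKs: "real (card Ks) \<le> real r ^ k"
  proof -
    have "card Ks = r choose k" by (simp add: Ks_def n_subsets)
    then have "card Ks \<le> r ^ k" using binomial_le_pow[OF r4(3)] by simp
    then show ?thesis by (metis of_nat_le_iff of_nat_power)
  qed
  have t1: "real (card Ks) * (real k / (real r - k)) ^ (k + 1) \<le> 1 / 12"
  proof -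
    have "real k / (real r - k) \<le> 2 * k / r"
    proof -
      have r2: "2 * real k \<le> r" "real k > 0" using r4(2) assms(1) by linarith+
      then have "real k * (2 * real k) \<le> real k * real r" by (intro mult_left_mono) auto
      then show ?thesis using r2 by (simp add: divide_simps algebra_simps)
    qed
    then have "(real k / (real r - k)) ^ (k + 1) \<le> (2 * k / r) ^ (k + 1)"
      using r4 by (intro power_mono) auto
    then have "real (card Ks) * (real k / (real r - k)) ^ (k + 1) \<le> real r ^ k * (2 * k / r) ^ (k + 1)"
      using cKs r4 by (intro mult_mono) auto
    also have "\<dots> = (2 * k) ^ (k + 1) / r" using r4 by (simp add: power_divide)
    also have "\<dots> \<le> 1 / 12"
    proof -
      define X where "X = (2 * k) ^ (k + 1)"
      have "12 * X \<le> r" by (simp add: r_def X_def)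
      then have "real (12 * X) \<le> real r" by (rule of_nat_mono)
      then have "real X / real r \<le> 1 / 12" using r4(4) by (simp add: field_simps)
      then show ?thesis by (simp only: X_def)
    qed
    finally show ?thesis .
  qed
  \<comment> \<open>Once \<open>r\<close> is fixed, \<open>card Ks\<close> is a constant, so a
    constant number \<open>m\<close> of pairs per colour set is enough.\<close>
  have "(\<lambda>m. real (card Ks) * (1 - \<eta>) ^ m) \<longlonglongrightarrow> real (card Ks) * 0"
    using \<eta> by (intro tendsto_mult tendsto_const LIMSEQ_power_zero) auto
  then have "\<forall>\<^sub>F m in sequentially. real (card Ks) * (1 - \<eta>) ^ m < 1 / 12"
    by (rule order_tendstoD) simp
  then obtain m where t2: "real (card Ks) * (1 - \<eta>) ^ m < 1 / 12"
    by (auto simp: eventually_sequentially)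
  have "(\<lambda>n. real (card Ks) * (5 / 8 :: real) ^ n) \<longlonglongrightarrow> real (card Ks) * 0"
    by (intro tendsto_mult tendsto_const LIMSEQ_power_zero) auto
  then have ev: "\<forall>\<^sub>F n in sequentially. real (card Ks) * (5 / 8) ^ n < 1 / 12"
    by (rule order_tendstoD) simp
  obtain ix where ix: "set ix = Ks \<times> {..<m}" "distinct ix"
    using finite_distinct_list[of "Ks \<times> {..<m}"] fin by auto
  show ?thesis
  proof (intro exI[of _ "2 * length ix"])
    show "\<forall>\<^sub>F n in sequentially. \<exists>D. is_tester n \<epsilon> (SymF n (n - k)) (2 * length ix) D"
      using ev eventually_ge_at_top[of "k + 1"]
    proof eventually_elim
      case (elim n)
      have n: "k \<le> n" "n > 0" using elim by auto
      let ?D = "coloring_tester n r Ks m ix"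
      have "depth t \<le> 2 * length ix \<and> queried t \<subseteq> cube n" if tD: "t \<in> set_pmf ?D" for t
      proof -
        obtain c \<omega> where \<omega>: "\<And>K j. K \<in> Ks \<Longrightarrow> j < m \<Longrightarrow> \<omega> (K, j) \<in> set_pmf (pair_in_class n (bucket n c K))"
          and t: "t = qtree (pair_points \<omega> ix) (\<lambda>f. \<exists>K\<in>Ks. \<forall>j<m. f (fst (\<omega> (K, j))) = f (snd (\<omega> (K, j)))) (\<lambda>_. 0)"
          using coloring_tester_support[OF tD fin r4(4) ix(1)] by blast
        have "fst (\<omega> i) \<in> cube n \<and> snd (\<omega> i) \<in> cube n" if iI: "i \<in> set ix" for i
        proof -
          obtain K j where "i = (K, j)" "K \<in> Ks" "j < m" using iI ix(1) by auto
          then have "\<omega> i \<in> set_pmf (pair_in_class n (bucket n c K))" using \<omega> by simp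
          from set_pair_in_class[OF this] show ?thesis using cl_subset by blast
        qed
        then have "set (pair_points \<omega> ix) \<subseteq> cube n" by (auto simp: pair_points_def)
        then show ?thesis unfolding t by (simp add: pair_points_def)
      qed
      moreover have "measure_pmf.prob ?D {t. accepts t f} \<ge> 2 / 3" if "f \<in> SymF n (n - k)" for f
        using coloring_tester_complete[OF that n(1) r4(3,4) ix(1) Ks_def] by simp
      moreover have "measure_pmf.prob ?D {t. \<not> accepts t f} \<ge> 2 / 3" if far: "far_from n \<epsilon> f (SymF n (n - k))" for f
      proof -
        define Fam where "Fam = {S. total_viol n S f < \<epsilon> / 36 * 2 ^ n \<and> d * card S < n}"
        have "(\<Sum>c\<in>{..<n} \<rightarrow>\<^sub>E {..<r}. (1 - total_viol n (bucket n c K) f / 2 ^ n) ^ m) / r ^ n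
           \<le> (real k / (real r - k)) ^ (k + 1) + (5 / 8) ^ n + (1 - \<eta>) ^ m" if K: "K \<in> Ks" for K
        proof -
          have K': "K \<subseteq> {..<r}" "card K = k" using K by (auto simp: Ks_def)
          have viol: "0 \<le> total_viol n J f" "total_viol n J f \<le> 2 ^ n" for J
          proof -
            show "0 \<le> total_viol n J f" by (simp add: total_viol_def sum_nonneg viol_nonneg)
            have "total_viol n J f \<le> (\<Sum>x\<in>cube n. 1)"
              unfolding total_viol_def by (rule sum_mono) (rule viol_le_1)
            then show "total_viol n J f \<le> 2 ^ n" by (simp add: card_cube)
          qed
          \<comment> \<open>The three reasons pointwise: a violation below the threshold puts the
            bucket into \<open>Fam\<close> or makes it large, any other violation costs at most
            \<open>(1 - \<eta>) ^ m\<close>.\<close>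
          have "(1 - total_viol n (bucket n c K) f / 2 ^ n) ^ m \<le>
             of_bool ({i \<in> {..<n}. c i \<in> K} \<in> Fam) + of_bool ({i \<in> {..<n}. c i \<in> K} \<in> {S. n \<le> d * card S}) + (1 - \<eta>) ^ m" for c
          proof -
            let ?v = "total_viol n (bucket n c K) f"
            have v: "0 \<le> 1 - ?v / 2 ^ n" "1 - ?v / 2 ^ n \<le> 1" using viol[of "bucket n c K"] by simp_all
            have e: "0 \<le> (1 - \<eta>) ^ m" using \<eta> by simp
            show ?thesis
            proof (cases "?v < \<epsilon> / 36 * 2 ^ n")
              case True
              then have "of_bool ({i \<in> {..<n}. c i \<in> K} \<in> Fam) + of_bool ({i \<in> {..<n}. c i \<in> K} \<in> {S. n \<le> d * card S}) = (1::real)"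
                by (auto simp: Fam_def bucket_def of_bool_def)
              moreover have "(1 - ?v / 2 ^ n) ^ m \<le> 1" using v by (simp add: power_le_one)
              ultimately show ?thesis using e by linarith
            next
              case False
              then have "\<epsilon> / 36 \<le> ?v / 2 ^ n" by (simp add: field_simps)
              then have "\<eta> \<le> ?v / 2 ^ n" using \<eta>(3) by linarith
              then have "(1 - ?v / 2 ^ n) ^ m \<le> (1 - \<eta>) ^ m"
                using v by (intro power_mono) auto
              then show ?thesis by (smt (verit) of_bool_def)
            qed
          qed
          then have "(\<Sum>c\<in>{..<n} \<rightarrow>\<^sub>E {..<r}. (1 - total_viol n (bucket n c K) f / 2 ^ n) ^ m) \<le>
             (\<Sum>c\<in>{..<n} \<rightarrow>\<^sub>E {..<r}. of_bool ({i \<in> {..<n}. c i \<in> K} \<in> Fam) + of_bool ({i \<in> {..<n}. c i \<in> K} \<in> {S. n \<le> d * card S}) + (1 - \<eta>) ^ m)"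
            by (rule sum_mono)
          also have "\<dots> = colcount r K {..<n} Fam + colcount r K {..<n} {S. n \<le> d * card S} + r ^ n * (1 - \<eta>) ^ m"
            by (simp add: sum.distrib card_PiE colcount_sum)
          also have "colcount r K {..<n} Fam \<le> real r ^ card {..<n} * (real (card K) / (real r - card K)) ^ (k + 1)"
          proof (rule intersecting_family)
            fix S S' assume "S \<in> Fam" "S' \<in> Fam" "S \<subseteq> {..<n}" "S' \<subseteq> {..<n}"
            then show "k + 1 \<le> card (S \<inter> S')"
              using almost_symmetric_intersecting[OF far assms(2) n d] by (auto simp: Fam_def)
          qed (use K' r4 in auto)
          also have "colcount r K {..<n} {S. n \<le> d * card S} \<le> r ^ n * (5 / 8) ^ n"
          proof -
            have "real (4 * 2 ^ d * k) \<le> real r" using r4(1) by (rule of_nat_mono)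
            then have "real r + (2 ^ d - 1) * card K \<le> real r * (5 / 4)"
              by (simp add: K' algebra_simps)
            then have "(real r + (2 ^ d - 1) * card K) ^ n \<le> (real r * (5 / 4)) ^ n"
              by (intro power_mono) auto
            then have "colcount r K {..<n} {S. n \<le> d * card S} * 2 ^ n \<le> (real r * (5 / 4)) ^ n"
              using colcount_large[OF K'(1), of n d] by linarith
            also have "\<dots> = (r ^ n * (5 / 8) ^ n) * 2 ^ n"
              by (simp add: power_mult_distrib[symmetric] mult.commute)
            finally show ?thesis by simp
          qed
          finally show ?thesis using r4(4) by (simp add: K' field_simps)
        qed
        then have "(\<Sum>K\<in>Ks. (\<Sum>c\<in>{..<n} \<rightarrow>\<^sub>E {..<r}. (1 - total_viol n (bucket n c K) f / 2 ^ n) ^ m) / r ^ n)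
           \<le> card Ks * ((real k / (real r - k)) ^ (k + 1) + (5 / 8) ^ n + (1 - \<eta>) ^ m)"
          by (rule sum_bounded_above)
        also have "\<dots> \<le> 1 / 4" using t1 t2 elim(1) unfolding distrib_left by linarith
        finally have "measure_pmf.prob ?D {t. accepts t f} \<le> 1 / 4"
          using coloring_tester_accept_le[OF fin r4(4) ix(1), of n f] by linarith
        then show ?thesis by (simp add: prob_compl)
      qed
      ultimately show ?case unfolding is_tester_def tests_def by blast
    qed
  qed
qed

section \<open>Random samples\<close>

lemma finite_input_lists [simp, intro]: "finite (input_lists n q)"
  by (simp add: input_lists_def finite_lists_length_eq)

lemma card_input_lists: "card (input_lists n q) = (2 ^ n) ^ q"
  by (simp add: input_lists_def card_lists_length_eq card_cube)

lemma input_lists_0 [simp]: "input_lists n 0 = {[]}"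
  by (auto simp: input_lists_def)

lemma input_lists_nonempty [simp]: "input_lists n q \<noteq> {}"
  using card_input_lists[of n q] by auto

lemma sum_input_lists_Suc:
  "(\<Sum>xs\<in>input_lists n (Suc q). \<phi> xs) = (\<Sum>x\<in>cube n. \<Sum>xs\<in>input_lists n q. \<phi> (x # xs))"
  unfolding sum.cartesian_product
  by (rule sum.reindex_bij_witness[where i = "\<lambda>(x, xs). x # xs" and j = "\<lambda>xs. (hd xs, tl xs)"])
    (auto simp: input_lists_def length_Suc_conv)

lemma sum_input_lists_append:
  "(\<Sum>xs\<in>input_lists n (a + b). \<phi> xs) = (\<Sum>ys\<in>input_lists n a. \<Sum>zs\<in>input_lists n b. \<phi> (ys @ zs))"
  by (induction a arbitrary: \<phi>) (simp_all add: sum_input_lists_Suc)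

lemma sum_input_lists_all:
  fixes \<phi> :: "(nat \<Rightarrow> bit) \<Rightarrow> 'b :: comm_semiring_1"
  shows "(\<Sum>xs\<in>input_lists n q. (\<Prod>x\<leftarrow>xs. \<phi> x)) = (\<Sum>x\<in>cube n. \<phi> x) ^ q"
  by (induction q) (simp_all add: sum_input_lists_Suc sum_distrib_left[symmetric] sum_distrib_right[symmetric])

lemma card_input_lists_all:
  "real (card {xs \<in> input_lists n q. \<forall>x\<in>set xs. P x}) = real (card {x \<in> cube n. P x}) ^ q"
proof -
  have "(\<Prod>x\<leftarrow>xs. of_bool (P x)) = (of_bool (\<forall>x\<in>set xs. P x) :: real)" for xs
    by (induction xs) auto
  then show ?thesis
    using sum_input_lists_all[of "\<lambda>x. of_bool (P x) :: real" n q] by (simp add: real_card_Collect_eq_sum)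
qed

section \<open>Random sets compared with sequences of independent points\<close>

definition orderings :: "'a set \<Rightarrow> 'a list set" where
  "orderings U = {xs. set xs = U \<and> distinct xs}"

lemma orderings_finite: "finite U \<Longrightarrow> finite (orderings U)"
  by (rule finite_subset[of _ "{xs. set xs \<subseteq> U \<and> length xs = card U}"])
    (auto simp: orderings_def distinct_card finite_lists_length_eq)

lemma card_orderings: "finite U \<Longrightarrow> card (orderings U) = fact (card U)"
proof -
  assume U: "finite U"
  have "orderings U = {xs. length xs = card U \<and> distinct xs \<and> set xs \<subseteq> U}"
    using U by (auto simp: orderings_def distinct_card) (metis card_subset_eq distinct_card in_mono)
  then show ?thesis using card_lists_distinct_length_eq[OF U order_refl]
    by (simp add: fact_prod)
qed

lemma orderings_nonempty: "finite U \<Longrightarrow> orderings U \<noteq> {}"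
  using card_orderings by fastforce

lemma finite_samples: "finite (samples n u)"
  by (rule finite_subset[of _ "Pow (cube n)"]) (auto simp: samples_def)

lemma card_samples: "card (samples n u) = 2 ^ n choose u"
  using n_subsets[of "cube n" u] by (simp add: samples_def card_cube)

lemma samples_nonempty: "u \<le> 2 ^ n \<Longrightarrow> samples n u \<noteq> {}"
  using card_samples[of n u] finite_samples[of n u] by (metis card.empty zero_less_binomial less_not_refl)

lemma sum_samples_orderings:
  "(\<Sum>U\<in>samples n u. \<Sum>xs\<in>orderings U. \<psi> xs) = (\<Sum>xs\<in>{xs \<in> input_lists n u. distinct xs}. \<psi> xs)"
proof -
  have "{xs \<in> input_lists n u. distinct xs} = (\<Union>U\<in>samples n u. orderings U)"
    by (auto simp: input_lists_def samples_def orderings_def distinct_card)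
  then show ?thesis
    by (subst sum.UNION_disjoint[symmetric]) (auto simp: finite_samples orderings_def samples_def
      intro!: orderings_finite[unfolded orderings_def] finite_subset[OF _ finite_cube])
qed

text \<open>A random set in random order is a sequence of independent points conditioned on being distinct.\<close>

lemma samples_le_lists:
  fixes \<psi> :: "(nat \<Rightarrow> bit) list \<Rightarrow> real"
  assumes "u \<le> 2 ^ n" "\<And>xs. 0 \<le> \<psi> xs"
  shows "(1 - (real u)\<^sup>2 / 2 ^ n) * ((\<Sum>U\<in>samples n u. (\<Sum>xs\<in>orderings U. \<psi> xs) / fact u) / card (samples n u))
    \<le> (\<Sum>xs\<in>input_lists n u. \<psi> xs) / (2 ^ n) ^ u"
proof -
  let ?N = "2 ^ n :: real"
  define S where "S = (\<Sum>U\<in>samples n u. \<Sum>xs\<in>orderings U. \<psi> xs)"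
  have S0: "0 \<le> S" unfolding S_def by (intro sum_nonneg assms)
  have fpos: "card (samples n u) > 0" using assms(1) by (simp add: card_samples)
  have "(\<Sum>U\<in>samples n u. real (fact u)) = (\<Sum>U\<in>samples n u. \<Sum>xs\<in>orderings U. 1)"
  proof (rule sum.cong)
    fix U assume "U \<in> samples n u"
    then have "finite U" "card U = u" by (auto simp: samples_def intro: finite_subset)
    then show "real (fact u) = (\<Sum>xs\<in>orderings U. 1)" using card_orderings[of U] by simp
  qed simp
  also have "\<dots> = (\<Sum>xs\<in>{xs \<in> input_lists n u. distinct xs}. 1)"
    by (rule sum_samples_orderings)
  also have "\<dots> = real (\<Prod>{2 ^ n - u + 1..2 ^ n})"
  proof -
    have "{xs \<in> input_lists n u. distinct xs} = {xs. length xs = u \<and> distinct xs \<and> set xs \<subseteq> cube n}"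
      by (auto simp: input_lists_def)
    then show ?thesis
      using card_lists_distinct_length_eq[of "cube n" u] assms(1) by (simp add: card_cube del: of_nat_prod)
  qed
  finally have cnt: "real (card (samples n u)) * fact u = real (\<Prod>{2 ^ n - u + 1..2 ^ n})"
    by simp
  \<comment> \<open>Birthday bound: \<open>u\<close> independent points are distinct with
    probability at least \<open>(1 - u / N) ^ u \<ge> 1 - u^2 / N\<close>.\<close>
  have lower: "?N ^ u * (1 - (real u)\<^sup>2 / ?N) \<le> real (card (samples n u)) * fact u"
  proof -
    have uN: "real u \<le> ?N" using of_nat_mono[OF assms(1), where 'a = real] by simp
    then have "- 1 \<le> - (real u / ?N)" by simp
    then have "1 + real u * (- (real u / ?N)) \<le> (1 + (- (real u / ?N))) ^ u"
      by (rule Bernoulli_inequality)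
    then have "?N ^ u * (1 - (real u)\<^sup>2 / ?N) \<le> ?N ^ u * (1 - real u / ?N) ^ u"
      by (simp add: power2_eq_square)
    also have "\<dots> = (?N - real u) ^ u"
      by (simp add: power_mult_distrib[symmetric] right_diff_distrib)
    also have "\<dots> = (\<Prod>i\<in>{2 ^ n - u + 1..2 ^ n :: nat}. ?N - real u)" using assms(1) by simp
    also have "\<dots> \<le> (\<Prod>i\<in>{2 ^ n - u + 1..2 ^ n :: nat}. real i)"
    proof (rule prod_mono)
      fix i assume "i \<in> {2 ^ n - u + 1..2 ^ n :: nat}"
      then have "2 ^ n \<le> i + u" using assms(1) by auto
      then have "real (2 ^ n) \<le> real (i + u)" by (rule of_nat_mono)
      then show "0 \<le> ?N - real u \<and> ?N - real u \<le> real i" using uN by simp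
    qed
    finally show ?thesis by (simp add: cnt)
  qed
  have "(\<Sum>U\<in>samples n u. (\<Sum>xs\<in>orderings U. \<psi> xs) / fact u) / card (samples n u) = S / (real (card (samples n u)) * fact u)"
    by (simp add: S_def sum_divide_distrib[symmetric] mult.commute)
  then have "(1 - (real u)\<^sup>2 / ?N) * ((\<Sum>U\<in>samples n u. (\<Sum>xs\<in>orderings U. \<psi> xs) / fact u) / card (samples n u))
     = (?N ^ u * (1 - (real u)\<^sup>2 / ?N)) * (S / (real (card (samples n u)) * fact u)) / ?N ^ u" by simp
  also have "\<dots> \<le> (real (card (samples n u)) * fact u) * (S / (real (card (samples n u)) * fact u)) / ?N ^ u"
    using S0 by (intro divide_right_mono mult_right_mono lower) auto
  also have "\<dots> = S / ?N ^ u" using fpos by simp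
  also have "\<dots> \<le> (\<Sum>xs\<in>input_lists n u. \<psi> xs) / ?N ^ u"
    unfolding S_def sum_samples_orderings
    by (intro divide_right_mono sum_mono2) (auto intro: assms)
  finally show ?thesis .
qed

text \<open>Reduces testers on random sets to counting lists. The sample is ordered at random,
  \<open>sel\<close> picks the points to query without seeing labels, and the tester accepts iff
  some member fits the labels. Passing from lists to sets costs a factor 10/9, and
  \<open>10 / 9 * 1 / 4 \<le> 1 / 3\<close>.\<close>

lemma sample_testerI:
  assumes u: "u \<le> 2 ^ n" "10 * u\<^sup>2 \<le> 2 ^ n"
    and sel: "\<And>xs. length xs = u \<Longrightarrow> set (sel xs) \<subseteq> set xs \<and> length (sel xs) \<le> q"
    and sound: "\<And>f. f \<in> bool_funs n \<Longrightarrow> far_from n \<epsilon> f P \<Longrightarrow>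
       real (card {xs \<in> input_lists n u. \<exists>g\<in>P. \<forall>x\<in>set (sel xs). g x = f x}) \<le> 1 / 4 * (2 ^ n) ^ u"
  shows "\<exists>A. is_sample_tester n \<epsilon> P u q A"
proof -
  define tree where "tree = (\<lambda>xs. qtree (sel xs) (\<lambda>f. \<exists>g\<in>P. \<forall>x\<in>set (sel xs). g x = f x) (\<lambda>_. 0))"
  define A where "A = (\<lambda>U. map_pmf tree (pmf_of_set (orderings U)))"
  have acc: "accepts (tree xs) f \<longleftrightarrow> (\<exists>g\<in>P. \<forall>x\<in>set (sel xs). g x = f x)" for xs f
    unfolding tree_def accepts_qtree by simp
  have U: "finite U" "card U = u" if "U \<in> samples n u" for U
    using that by (auto simp: samples_def intro: finite_subset)
  have ord: "length xs = u \<and> set xs = U" if "U \<in> samples n u" "xs \<in> orderings U" for U xs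
    using U(2)[OF that(1)] that(2) distinct_card[of xs] by (auto simp: orderings_def)
  have prob: "measure_pmf.prob (pmf_of_set (samples n u) \<bind> A) {t. accepts t f} =
     (\<Sum>U\<in>samples n u. (\<Sum>xs\<in>orderings U. of_bool (accepts (tree xs) f)) / fact u) / card (samples n u)" for f
    unfolding prob_bind_pmf_of_set[OF finite_samples samples_nonempty[OF u(1)]]
  proof (intro arg_cong2[where f = "(/)"] sum.cong refl)
    fix W assume W: "W \<in> samples n u"
    note o = orderings_finite[OF U(1)[OF W]] orderings_nonempty[OF U(1)[OF W]]
    show "measure_pmf.prob (A W) {t. accepts t f} = (\<Sum>xs\<in>orderings W. of_bool (accepts (tree xs) f)) / fact u"
      using card_orderings[OF U(1)[OF W]] U(2)[OF W] o
      by (simp add: A_def measure_pmf_of_set real_card_Collect_eq_sum[symmetric] vimage_def Int_def del: sum_of_bool_eq)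
  qed
  have "is_sample_tester n \<epsilon> P u q A"
    unfolding is_sample_tester_def tests_def
  proof (intro conjI ballI impI)
    show "u \<le> 2 ^ n" by fact
  next
    fix W t assume W: "W \<in> samples n u" and "t \<in> set_pmf (A W)"
    note o = orderings_finite[OF U(1)[OF W]] orderings_nonempty[OF U(1)[OF W]]
    obtain xs where "xs \<in> orderings W" "t = tree xs"
      using \<open>t \<in> set_pmf (A W)\<close> o by (auto simp: A_def set_pmf_of_set)
    then show "depth t \<le> q" "queried t \<subseteq> W"
      using sel[of xs] ord[OF W, of xs] by (auto simp: tree_def)
  next
    fix f assume f: "f \<in> P"
    have "accepts (tree xs) f" for xs using f by (auto simp: acc)
    then have "(\<Sum>xs\<in>orderings W. of_bool (accepts (tree xs) f)) = real (fact u)" if "W \<in> samples n u" for W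
      using card_orderings[OF U(1)[OF that]] U(2)[OF that] by simp
    then have "measure_pmf.prob (pmf_of_set (samples n u) \<bind> A) {t. accepts t f} = 1"
      using u(1) unfolding prob by (simp add: card_samples)
    then show "2 / 3 \<le> measure_pmf.prob (pmf_of_set (samples n u) \<bind> A) {t. accepts t f}" by simp
  next
    fix f assume f: "f \<in> bool_funs n" "far_from n \<epsilon> f P"
    let ?p = "measure_pmf.prob (pmf_of_set (samples n u) \<bind> A) {t. accepts t f}"
    have "(1 - (real u)\<^sup>2 / 2 ^ n) * ?p \<le> (\<Sum>xs\<in>input_lists n u. of_bool (accepts (tree xs) f)) / (2 ^ n) ^ u"
      unfolding prob by (rule samples_le_lists[OF u(1)]) simp
    also have "\<dots> \<le> 1 / 4"
      using sound[OF f] by (simp add: acc real_card_Collect_eq_sum[symmetric] field_simps del: sum_of_bool_eq)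
    finally have 1: "(1 - (real u)\<^sup>2 / 2 ^ n) * ?p \<le> 1 / 4" .
    have "real (10 * u\<^sup>2) \<le> real (2 ^ n)" using u(2) by (rule of_nat_mono)
    then have "9 / 10 \<le> 1 - (real u)\<^sup>2 / 2 ^ n" by (simp add: field_simps)
    then have "9 / 10 * ?p \<le> (1 - (real u)\<^sup>2 / 2 ^ n) * ?p" by (rule mult_right_mono) simp
    then have "?p \<le> 1 / 3" using 1 by linarith
    then show "2 / 3 \<le> measure_pmf.prob (pmf_of_set (samples n u) \<bind> A) {t. \<not> accepts t f}"
      by (simp add: prob_compl)
  qed
  then show ?thesis by blast
qed

section \<open>Union bound over the sets of asymmetric coordinates\<close>

lemma card_SymF_witness_sets: "card {J. J \<subseteq> {..<n} \<and> card J = k} \<le> n ^ k"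
  by (cases "k \<le> n") (auto simp: n_subsets binomial_eq_0 intro: binomial_le_pow)

text \<open>A consistent member is constant on the classes of some \<open>J\<close>, so the queried
  points show no violation for this \<open>J\<close>. Bounding that event for each single
  \<open>J\<close> is enough, at the price \<open>n ^ k\<close>.\<close>

lemma consistent_count_le:
  assumes "k \<le> n" "0 \<le> b"
    and "\<And>J. J \<subseteq> {..<n} \<Longrightarrow> card J = k \<Longrightarrow>
      real (card {xs \<in> input_lists n u. \<forall>x\<in>set (sel xs). \<forall>y\<in>set (sel xs). y \<in> cls n J x \<longrightarrow> f y = f x}) \<le> b"
    and "\<And>xs. xs \<in> input_lists n u \<Longrightarrow> set (sel xs) \<subseteq> cube n"
  shows "real (card {xs \<in> input_lists n u. \<exists>g\<in>SymF n (n - k). \<forall>x\<in>set (sel xs). g x = f x}) \<le> real (n ^ k) * b"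
proof -
  let ?B = "\<lambda>J. {xs \<in> input_lists n u. \<forall>x\<in>set (sel xs). \<forall>y\<in>set (sel xs). y \<in> cls n J x \<longrightarrow> f y = f x}"
  let ?J = "{J. J \<subseteq> {..<n} \<and> card J = k}"
  have fJ: "finite ?J" by (rule finite_subset[of _ "Pow {..<n}"]) auto
  have "{xs \<in> input_lists n u. \<exists>g\<in>SymF n (n - k). \<forall>x\<in>set (sel xs). g x = f x} \<subseteq> (\<Union>J\<in>?J. ?B J)"
  proof safe
    fix xs g assume xs: "xs \<in> input_lists n u" and g: "g \<in> SymF n (n - k)" "\<forall>x\<in>set (sel xs). g x = f x"
    obtain J where J: "J \<subseteq> {..<n}" "card J = k" "class_const n J g"
      using g(1) SymF_iff[OF assms(1)] by blast
    have "f y = f x" if "x \<in> set (sel xs)" "y \<in> set (sel xs)" "y \<in> cls n J x" for x y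
      using that J(3) g(2) assms(4)[OF xs] unfolding class_const_def by (metis in_mono)
    then show "xs \<in> (\<Union>J\<in>?J. ?B J)" using J xs by blast
  qed
  then have "card {xs \<in> input_lists n u. \<exists>g\<in>SymF n (n - k). \<forall>x\<in>set (sel xs). g x = f x} \<le> card (\<Union>J\<in>?J. ?B J)"
    using fJ by (intro card_mono) auto
  also have "\<dots> \<le> (\<Sum>J\<in>?J. card (?B J))" by (rule card_UN_le[OF fJ])
  finally have "real (card {xs \<in> input_lists n u. \<exists>g\<in>SymF n (n - k). \<forall>x\<in>set (sel xs). g x = f x}) \<le> real (\<Sum>J\<in>?J. card (?B J))"
    by (rule of_nat_mono)
  also have "\<dots> = (\<Sum>J\<in>?J. real (card (?B J)))" by simp
  also have "\<dots> \<le> real (card ?J) * b" by (rule sum_bounded_above) (use assms(3) in auto)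
  also have "\<dots> \<le> real (n ^ k) * b"
    using card_SymF_witness_sets[of n k] assms(2) by (intro mult_right_mono of_nat_mono) auto
  finally show ?thesis .
qed

text \<open>The \<open>k\<close> in the exponent pays for the union bound over \<open>J\<close>, and
  the extra 2 leaves an error of \<open>1 / n^2\<close>.\<close>

lemma power_times_exp_neg_ln:
  assumes "n > 0"
  shows "real (n ^ k) * exp (- ((real k + 2) * ln (real n))) = 1 / (real n)\<^sup>2"
proof -
  have "exp ((real k + 2) * ln (real n)) = exp (ln (real n)) ^ (k + 2)"
    by (subst exp_of_nat_mult[symmetric]) (simp add: add.commute)
  then have e: "exp ((real k + 2) * ln (real n)) = real n ^ (k + 2)" using assms by simp
  show ?thesis unfolding exp_minus e using assms by (simp add: power_add power2_eq_square field_simps)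
qed

lemma passive_rate_sq:
  assumes "n \<ge> 1"
  shows "(real n powr (1 / 4) * sqrt (ln (real n)))\<^sup>2 = sqrt (real n) * ln (real n)"
proof -
  have "0 \<le> ln (real n)" using assms by simp
  moreover have "(real n powr (1 / 4))\<^sup>2 = sqrt (real n)"
    using assms by (simp add: powr_half_sqrt[symmetric] powr_power)
  ultimately show ?thesis by (simp add: power_mult_distrib)
qed

section \<open>Active testing\<close>

text \<open>Only the weight is matched because \<open>J\<close> is unknown to the tester. If no
  point matches, the default \<open>x\<close> shows no violation and stays inside the
  sample.\<close>

definition partner :: "nat \<Rightarrow> (nat \<Rightarrow> bit) \<Rightarrow> (nat \<Rightarrow> bit) list \<Rightarrow> (nat \<Rightarrow> bit)" where
  "partner n x ys = (case find (\<lambda>y. wt {..<n} y = wt {..<n} x) ys of None \<Rightarrow> x | Some y \<Rightarrow> y)"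

text \<open>One pair from each of \<open>m\<close> disjoint blocks of length \<open>l + 1\<close>:
  the head and its partner among the other \<open>l\<close> points. Disjointness makes the pairs
  independent.\<close>

primrec block_pairs :: "nat \<Rightarrow> nat \<Rightarrow> nat \<Rightarrow> (nat \<Rightarrow> bit) list \<Rightarrow> ((nat \<Rightarrow> bit) \<times> (nat \<Rightarrow> bit)) list" where
  "block_pairs n l 0 xs = []"
| "block_pairs n l (Suc m) xs = (hd xs, partner n (hd xs) (take l (tl xs))) # block_pairs n l m (drop (Suc l) xs)"

lemma partner_in: "partner n x ys \<in> insert x (set ys)"
  by (auto simp: partner_def find_Some_iff split: option.splits)

lemma length_block_pairs [simp]: "length (block_pairs n l m xs) = m"
  by (induction m arbitrary: xs) auto

lemma block_pairs_subset:
  assumes "m * Suc l \<le> length xs" "p \<in> set (block_pairs n l m xs)"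
  shows "fst p \<in> set xs \<and> snd p \<in> set xs"
  using assms
proof (induction m arbitrary: xs)
  case (Suc m)
  then have ne: "xs \<noteq> []" by auto
  show ?case
  proof (cases "p \<in> set (block_pairs n l m (drop (Suc l) xs))")
    case True
    have "fst p \<in> set (drop (Suc l) xs) \<and> snd p \<in> set (drop (Suc l) xs)"
      using Suc.prems(1) True by (intro Suc.IH) auto
    then show ?thesis using in_set_dropD by fast
  next
    case False
    then have p: "p = (hd xs, partner n (hd xs) (take l (tl xs)))" using Suc.prems by auto
    have "hd xs \<in> set xs" using ne by simp
    moreover have "set (take l (tl xs)) \<subseteq> set xs" using ne by (meson in_set_takeD list.set_sel(2) subsetI)
    ultimately show ?thesis using partner_in[of n "hd xs" "take l (tl xs)"] unfolding p by auto
  qed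
qed simp

text \<open>The bound for one block is raised to the \<open>m\<close>-th power by independence;
  \<open>e\<close> counts the points behind the last block.\<close>

lemma count_block_pairs:
  assumes "0 \<le> b"
    and blk: "(\<Sum>x\<in>cube n. \<Sum>ys\<in>input_lists n l. of_bool (Ok x (partner n x ys))) \<le> b * (2 ^ n) ^ Suc l"
  shows "real (card {xs \<in> input_lists n (m * Suc l + e). \<forall>(x, y)\<in>set (block_pairs n l m xs). Ok x y})
    \<le> b ^ m * (2 ^ n) ^ (m * Suc l + e)"
proof (induction m)
  case 0
  then show ?case by (simp add: card_input_lists)
next
  case (Suc m)
  let ?u = "m * Suc l + e"
  let ?S = "\<Sum>zs\<in>input_lists n ?u. of_bool (\<forall>(x, y)\<in>set (block_pairs n l m zs). Ok x y) :: real"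
  have IH: "?S \<le> b ^ m * (2 ^ n) ^ ?u" using Suc.IH by (simp add: real_card_Collect_eq_sum del: sum_of_bool_eq)
  have e: "Suc m * Suc l + e = Suc (l + ?u)" by simp
  have "real (card {xs \<in> input_lists n (Suc m * Suc l + e). \<forall>(x, y)\<in>set (block_pairs n l (Suc m) xs). Ok x y}) =
     (\<Sum>x\<in>cube n. \<Sum>ys\<in>input_lists n l. \<Sum>zs\<in>input_lists n ?u.
        of_bool (\<forall>(x, y)\<in>set (block_pairs n l (Suc m) (x # ys @ zs)). Ok x y))"
    unfolding e by (simp only: real_card_Collect_eq_sum[OF finite_input_lists] sum_input_lists_Suc sum_input_lists_append)
  also have "\<dots> = (\<Sum>x\<in>cube n. \<Sum>ys\<in>input_lists n l. of_bool (Ok x (partner n x ys)) * ?S)"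
  proof (intro sum.cong refl)
    fix x ys assume "ys \<in> input_lists n l"
    then have l: "length ys = l" by (simp add: input_lists_def)
    have "of_bool (\<forall>(x, y)\<in>set (block_pairs n l (Suc m) (x # ys @ zs)). Ok x y) =
        of_bool (Ok x (partner n x ys)) * (of_bool (\<forall>(x, y)\<in>set (block_pairs n l m zs). Ok x y) :: real)" for zs
      using l by (simp flip: of_bool_conj)
    then show "(\<Sum>zs\<in>input_lists n ?u. of_bool (\<forall>(x, y)\<in>set (block_pairs n l (Suc m) (x # ys @ zs)). Ok x y)) =
        of_bool (Ok x (partner n x ys)) * ?S" by (simp only: sum_distrib_left)
  qed
  also have "\<dots> = (\<Sum>x\<in>cube n. \<Sum>ys\<in>input_lists n l. of_bool (Ok x (partner n x ys))) * ?S"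
    by (simp only: sum_distrib_right)
  also have "\<dots> \<le> (b * (2 ^ n) ^ Suc l) * (b ^ m * (2 ^ n) ^ ?u)"
    using blk IH assms(1) by (intro mult_mono) (auto intro: sum_nonneg)
  also have "\<dots> = b ^ Suc m * (2 ^ n) ^ (Suc m * Suc l + e)"
    by (simp add: power_add mult_ac)
  finally show ?case .
qed

text \<open>The first point to land in \<open>L\<close> is uniform on \<open>L\<close>, so it lies
  in \<open>D\<close> with conditional probability \<open>card D / card L\<close>. Multiplying by
  \<open>card L\<close> avoids the division.\<close>

lemma first_hit_count:
  assumes "D \<subseteq> L" "L \<subseteq> cube n"
  shows "real (card L) * (\<Sum>ys\<in>input_lists n l. of_bool (\<exists>y\<in>D. find (\<lambda>y. y \<in> L) ys = Some y))
    = real (card D) * ((2 ^ n) ^ l - (2 ^ n - real (card L)) ^ l)"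
proof (induction l)
  case 0
  then show ?case by simp
next
  case (Suc l)
  let ?h = "\<lambda>l. \<Sum>ys\<in>input_lists n l. of_bool (\<exists>y\<in>D. find (\<lambda>y. y \<in> L) ys = Some y) :: real"
  have fin: "finite L" "finite D" using assms finite_subset finite_cube by (metis, metis)
  have cL: "card (cube n - L) = 2 ^ n - card L" "card L \<le> 2 ^ n"
    using assms(2) fin card_mono[OF finite_cube assms(2)] by (auto simp: card_Diff_subset card_cube)
  have "(\<Sum>ys\<in>input_lists n l. of_bool (\<exists>y\<in>D. find (\<lambda>y. y \<in> L) (x # ys) = Some y)) =
     (if x \<in> L then of_bool (x \<in> D) * (2 ^ n) ^ l else ?h l)" for x
    by (auto simp: card_input_lists)
  then have "?h (Suc l) = (\<Sum>x\<in>cube n. if x \<in> L then of_bool (x \<in> D) * (2 ^ n) ^ l else ?h l)"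
    by (simp only: sum_input_lists_Suc)
  also have "\<dots> = (\<Sum>x\<in>L. of_bool (x \<in> D) * (2 ^ n) ^ l) + (\<Sum>x\<in>cube n - L. ?h l)"
    using assms(2) by (subst sum.If_cases) (auto simp: Int_absorb1 Diff_eq)
  also have "(\<Sum>x\<in>L. of_bool (x \<in> D) * (2 ^ n) ^ l) = real (card D) * (2 ^ n) ^ l"
    using assms(1) fin by (simp add: sum_distrib_right[symmetric] Int_absorb1)
  also have "(\<Sum>x\<in>cube n - L. ?h l) = (2 ^ n - real (card L)) * ?h l"
    using cL by (simp add: of_nat_diff)
  finally have rec: "?h (Suc l) = real (card D) * (2 ^ n) ^ l + (2 ^ n - real (card L)) * ?h l" .
  have alg: "a * (d * p + m * h) = a * d * p + m * (a * h)" for a d p m h :: real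
    by (simp add: algebra_simps)
  have "real (card L) * ?h (Suc l) = real (card L) * real (card D) * (2 ^ n) ^ l + (2 ^ n - real (card L)) * (real (card L) * ?h l)"
    unfolding rec by (rule alg)
  also have "\<dots> = real (card D) * ((2 ^ n) ^ Suc l - (2 ^ n - real (card L)) ^ Suc l)"
    unfolding Suc.IH by (simp add: algebra_simps)
  finally show ?case .
qed

text \<open>A layer has at most \<open>2 ^ n / sqrt n\<close> points, so a heavy class fills at
  least a fraction \<open>\<delta>\<close> of its layer. A partner exists with probability at least
  1/2, and is then a violation with probability at least \<open>\<delta> * viol\<close>. Light
  classes carry at most \<open>\<epsilon> / 4\<close> of the total violation
  \<open>\<epsilon> / 2\<close>, which leaves
  \<open>\<delta> / 2 * \<epsilon> / 4 = \<delta> * \<epsilon> / 8\<close>.\<close>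

lemma block_violation:
  assumes J: "J \<subseteq> {..<n}" and V: "\<epsilon> / 2 * 2 ^ n \<le> total_viol n J f"
    and n: "n > 0" and \<delta>: "0 < \<delta>" "\<delta> \<le> sqrt n"
    and light: "real (card {x \<in> cube n. real (card (cls n J x)) < \<delta> * 2 ^ n / sqrt n}) \<le> \<epsilon> / 4 * 2 ^ n"
    and l: "(1 - \<delta> / sqrt n) ^ l \<le> 1 / 2"
  shows "(\<Sum>x\<in>cube n. \<Sum>ys\<in>input_lists n l. of_bool (\<not> (partner n x ys \<in> cls n J x \<and> f (partner n x ys) \<noteq> f x)))
    \<le> (1 - \<delta> * \<epsilon> / 8) * (2 ^ n) ^ Suc l"
proof -
  let ?N = "2 ^ n :: real"
  let ?heavy = "\<lambda>x. \<delta> * ?N / sqrt n \<le> real (card (cls n J x))"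
  let ?bad = "\<lambda>x ys. partner n x ys \<in> cls n J x \<and> f (partner n x ys) \<noteq> f x"
  have x: "(if ?heavy x then \<delta> / 2 * viol n J f x * ?N ^ l else 0) \<le> (\<Sum>ys\<in>input_lists n l. of_bool (?bad x ys))"
    if xc: "x \<in> cube n" for x
  proof (cases "?heavy x")
    case True
    let ?L = "{y \<in> cube n. wt {..<n} y = wt {..<n} x}" and ?D = "{y \<in> cls n J x. f y \<noteq> f x}"
    have DL: "?D \<subseteq> ?L" "cls n J x \<subseteq> ?L" by (auto simp: cl_def)
    have bad: "?bad x ys" if "ys \<in> input_lists n l" "\<exists>y\<in>?D. find (\<lambda>y. y \<in> ?L) ys = Some y" for ys
    proof -
      have "set ys \<subseteq> cube n" using that(1) by (simp add: input_lists_def)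
      then have "find (\<lambda>y. y \<in> ?L) ys = find (\<lambda>y. wt {..<n} y = wt {..<n} x) ys"
        by (intro find_cong) auto
      then show ?thesis using that(2) by (auto simp: partner_def)
    qed
    have "card (cls n J x) \<le> card ?L" using DL(2) by (intro card_mono) auto
    then have cl: "real (card (cls n J x)) \<le> real (card ?L)" by simp
    have Lpos: "real (card ?L) > 0" using card_cls_pos[OF xc, of J] cl by linarith
    have Lle: "real (card ?L) \<le> ?N / sqrt n"
      by (rule card_layer_le[OF n])
    have LN: "real (card ?L) \<le> ?N" by (rule card_le_cube) auto
    have "?N - real (card ?L) \<le> ?N * (1 - \<delta> / sqrt n)"
      using cl True by (simp add: right_diff_distrib mult.commute)
    then have "(?N - real (card ?L)) ^ l \<le> (?N * (1 - \<delta> / sqrt n)) ^ l"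
      using LN by (intro power_mono) auto
    also have "\<dots> = ?N ^ l * (1 - \<delta> / sqrt n) ^ l" by (rule power_mult_distrib)
    also have "\<dots> \<le> ?N ^ l * (1 / 2)" using l by (intro mult_left_mono) auto
    finally have half: "?N ^ l / 2 \<le> ?N ^ l - (?N - real (card ?L)) ^ l" by simp
    have "\<delta> * real (card ?L) \<le> \<delta> * (?N / sqrt n)" using Lle \<delta> by (intro mult_left_mono) auto
    also have "\<dots> \<le> real (card (cls n J x))" using True by simp
    finally have "viol n J f x * (\<delta> * real (card ?L)) \<le> viol n J f x * real (card (cls n J x))"
      by (intro mult_left_mono viol_nonneg)
    also have "\<dots> = real (card ?D)" using card_cls_pos[OF xc, of J] by (simp add: viol_def)
    finally have D: "viol n J f x * (\<delta> * real (card ?L)) \<le> real (card ?D)" .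
    have "real (card ?L) * (\<delta> / 2 * viol n J f x * ?N ^ l) = viol n J f x * (\<delta> * real (card ?L)) * (?N ^ l / 2)" by simp
    also have "\<dots> \<le> real (card ?D) * (?N ^ l - (?N - real (card ?L)) ^ l)"
      using D half by (intro mult_mono) auto
    also have "\<dots> = real (card ?L) * (\<Sum>ys\<in>input_lists n l. of_bool (\<exists>y\<in>?D. find (\<lambda>y. y \<in> ?L) ys = Some y))"
      by (rule first_hit_count[symmetric]) (use DL in auto)
    also have "\<dots> \<le> real (card ?L) * (\<Sum>ys\<in>input_lists n l. of_bool (?bad x ys))"
      using bad by (intro mult_left_mono sum_mono) (auto simp: of_bool_def)
    finally show ?thesis using Lpos True by simp
  qed (simp add: sum_nonneg)
  have "\<epsilon> / 4 * ?N \<le> (\<Sum>x\<in>cube n. if ?heavy x then viol n J f x else 0)"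
  proof -
    have "total_viol n J f \<le> (\<Sum>x\<in>cube n. (if ?heavy x then viol n J f x else 0) + of_bool (real (card (cls n J x)) < \<delta> * ?N / sqrt n))"
      unfolding total_viol_def by (rule sum_mono) (auto simp: viol_le_1)
    also have "\<dots> = (\<Sum>x\<in>cube n. if ?heavy x then viol n J f x else 0) + real (card {x \<in> cube n. real (card (cls n J x)) < \<delta> * ?N / sqrt n})"
      by (simp only: sum.distrib real_card_Collect_eq_sum[OF finite_cube])
    finally show ?thesis using V light by simp
  qed
  then have "\<delta> / 2 * ?N ^ l * (\<epsilon> / 4 * ?N) \<le> \<delta> / 2 * ?N ^ l * (\<Sum>x\<in>cube n. if ?heavy x then viol n J f x else 0)"
    using \<delta> by (intro mult_left_mono) auto
  also have "\<dots> = (\<Sum>x\<in>cube n. if ?heavy x then \<delta> / 2 * viol n J f x * ?N ^ l else 0)"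
    unfolding sum_distrib_left by (intro sum.cong) auto
  also have "\<dots> \<le> (\<Sum>x\<in>cube n. \<Sum>ys\<in>input_lists n l. of_bool (?bad x ys))"
    by (rule sum_mono) (rule x)
  finally have main: "\<delta> * \<epsilon> / 8 * ?N ^ Suc l \<le> (\<Sum>x\<in>cube n. \<Sum>ys\<in>input_lists n l. of_bool (?bad x ys))"
    by (simp add: mult_ac)
  have "(\<Sum>x\<in>cube n. \<Sum>ys\<in>input_lists n l. of_bool (\<not> ?bad x ys)) + (\<Sum>x\<in>cube n. \<Sum>ys\<in>input_lists n l. of_bool (?bad x ys))
     = (\<Sum>x\<in>cube n. \<Sum>ys\<in>input_lists n l. (1::real))"
    unfolding sum.distrib[symmetric] by (intro sum.cong refl) (auto simp: of_bool_def)
  also have "\<dots> = ?N ^ Suc l" by (simp add: card_cube card_input_lists)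
  finally show ?thesis using main by (simp add: algebra_simps)
qed

text \<open>A layer of a heavy class has density at least \<open>\<delta> / sqrt n\<close>, so
  \<open>n\<close> further points contain a partner with probability close to 1. Each block succeeds
  with probability \<open>\<gamma>\<close>, and \<open>C\<close> is chosen so that
  \<open>(1 - \<gamma>) ^ m \<le> n ^ (- k - 2)\<close>. The \<open>m * (n + 1)\<close> sample
  points fit into \<open>n ^ 3\<close>.\<close>

lemma active_tester_exists:
  assumes \<epsilon>: "0 < \<epsilon>" "\<epsilon> \<le> 1"
  shows "\<exists>C>0. \<forall>\<^sub>F n in sequentially. \<forall>u. n ^ 3 \<le> u \<longrightarrow> u \<le> 2 ^ n \<longrightarrow> 10 * u\<^sup>2 \<le> 2 ^ n \<longrightarrow>
    (\<exists>q A. is_sample_tester n \<epsilon> (SymF n (n - k)) u q A \<and> real q \<le> C * ln (real n))"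
proof -
  obtain \<delta> where \<delta>: "0 < \<delta>" "\<delta> \<le> 1" and light: "\<And>n J. n > 0 \<Longrightarrow> J \<subseteq> {..<n} \<Longrightarrow> card J \<le> k \<Longrightarrow>
      real (card {x \<in> cube n. real (card (cls n J x)) < \<delta> * 2 ^ n / sqrt n}) \<le> \<epsilon> / 4 * 2 ^ n"
    using light_classes[of "\<epsilon> / 4" k] \<epsilon> by auto
  define \<gamma> where "\<gamma> = \<delta> * \<epsilon> / 8"
  have \<gamma>: "0 < \<gamma>" "\<gamma> \<le> 1" using \<delta> \<epsilon> mult_mono[of \<delta> 1 \<epsilon> 1] by (auto simp: \<gamma>_def)
  define C where "C = (real k + 2) / \<gamma>"
  have C: "C > 0" using \<gamma> by (simp add: C_def)
  show ?thesis
  proof (intro exI[of _ "2 * C + 2"] conjI)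
    show "2 * C + 2 > 0" using C by simp
    have e1: "\<forall>\<^sub>F n in sequentially. exp (- \<delta> * sqrt (real n)) \<le> 1 / 2" using \<delta>(1) by real_asymp
    have e2: "\<forall>\<^sub>F n in sequentially. (C * ln (real n) + 1) * (real n + 1) \<le> real n ^ 3" by real_asymp
    have e3: "\<forall>\<^sub>F n in sequentially. 1 \<le> ln (real n)" by real_asymp
    show "\<forall>\<^sub>F n in sequentially. \<forall>u. n ^ 3 \<le> u \<longrightarrow> u \<le> 2 ^ n \<longrightarrow> 10 * u\<^sup>2 \<le> 2 ^ n \<longrightarrow>
      (\<exists>q A. is_sample_tester n \<epsilon> (SymF n (n - k)) u q A \<and> real q \<le> (2 * C + 2) * ln (real n))"
      using e1 e2 e3 eventually_ge_at_top[of "k + 2"]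
    proof eventually_elim
      case (elim n)
      show ?case
      proof (intro allI impI)
      fix u assume u: "n ^ 3 \<le> u" "u \<le> 2 ^ n" "10 * u\<^sup>2 \<le> 2 ^ n"
      define m where "m = nat \<lceil>C * ln (real n)\<rceil>"
      have lnpos: "1 \<le> ln (real n)" by fact
      have n: "k \<le> n" "n \<ge> 2" "n > 0" using elim by auto
      have m: "C * ln (real n) \<le> m" "real m \<le> C * ln (real n) + 1"
      proof -
        have "0 \<le> C * ln (real n)" using C lnpos by simp
        then show "C * ln (real n) \<le> m" "real m \<le> C * ln (real n) + 1" unfolding m_def by linarith+
      qed
      have mu: "m * Suc n \<le> u"
      proof -
        have "real (m * Suc n) \<le> (C * ln (real n) + 1) * (real n + 1)"
          using mult_right_mono[OF m(2), of "real n + 1"] by (simp add: algebra_simps)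
        also have "\<dots> \<le> real (n ^ 3)" using elim(2) by simp
        finally have "m * Suc n \<le> n ^ 3" by (simp only: of_nat_le_iff)
        then show ?thesis using u(1) by simp
      qed
      \<comment> \<open>The matching reads only the unlabelled sample; labels are requested for the
        two points of each pair. This is why \<open>2 m\<close> queries suffice on a much larger
        sample.\<close>
      define sel where "sel = (\<lambda>xs. concat (map (\<lambda>(x, y). [x, y]) (block_pairs n n m xs)))"
      have sel_in: "x \<in> set (sel xs) \<and> y \<in> set (sel xs)" if "(x, y) \<in> set (block_pairs n n m xs)" for x y xs
        using that by (force simp: sel_def)
      have "\<exists>A. is_sample_tester n \<epsilon> (SymF n (n - k)) u (2 * m) A"
      proof (rule sample_testerI[where sel = sel, OF u(2,3)])
        fix xs :: "(nat \<Rightarrow> bit) list" assume "length xs = u"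
        moreover have "length (concat (map (\<lambda>(x, y). [x, y]) ps)) = 2 * length ps" for ps :: "((nat \<Rightarrow> bit) \<times> (nat \<Rightarrow> bit)) list"
          by (induction ps) auto
        ultimately show "set (sel xs) \<subseteq> set xs \<and> length (sel xs) \<le> 2 * m"
          using mu block_pairs_subset[of m n xs _ n] by (force simp: sel_def)
      next
        fix f assume f: "f \<in> bool_funs n" "far_from n \<epsilon> f (SymF n (n - k))"
        let ?b = "(1 - \<gamma>) ^ m * (2 ^ n) ^ u"
        have "real (card {xs \<in> input_lists n u. \<exists>g\<in>SymF n (n - k). \<forall>x\<in>set (sel xs). g x = f x}) \<le> real (n ^ k) * ?b"
        proof (rule consistent_count_le[OF n(1)])
          show "0 \<le> ?b" using \<gamma> by simp
        next
          fix xs assume "xs \<in> input_lists n u"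
          then show "set (sel xs) \<subseteq> cube n"
            using mu block_pairs_subset[of m n xs _ n] by (force simp: sel_def input_lists_def)
        next
          fix J assume J: "J \<subseteq> {..<n}" "card J = k"
          let ?Ok = "\<lambda>x y. \<not> (y \<in> cls n J x \<and> f y \<noteq> f x)"
          have blk: "(\<Sum>x\<in>cube n. \<Sum>ys\<in>input_lists n n. of_bool (?Ok x (partner n x ys))) \<le> (1 - \<gamma>) * (2 ^ n) ^ Suc n"
            unfolding \<gamma>_def
          proof (rule block_violation[OF J(1)])
            show "\<epsilon> / 2 * 2 ^ n \<le> total_viol n J f"
              using far_imp_total_viol[OF n(1) f(2) J(1)] J(2) by simp
            show "0 < n" "0 < \<delta>" by fact+
            have "1 \<le> sqrt n" using n by simp
            then show "\<delta> \<le> sqrt n" using \<delta> by linarith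
            show "real (card {x \<in> cube n. real (card (cls n J x)) < \<delta> * 2 ^ n / sqrt n}) \<le> \<epsilon> / 4 * 2 ^ n"
              using light[OF n(3) J(1)] J(2) by simp
            have "(1 - \<delta> / sqrt n) ^ n \<le> exp (- (\<delta> / sqrt n * n))"
              using \<open>\<delta> \<le> sqrt n\<close> n by (intro one_minus_power_le_exp) auto
            also have "\<dots> = exp (- \<delta> * sqrt n)"
              using n by (simp add: real_div_sqrt field_simps)
            finally show "(1 - \<delta> / sqrt n) ^ n \<le> 1 / 2" using elim(1) by linarith
          qed
          have "{xs \<in> input_lists n u. \<forall>x\<in>set (sel xs). \<forall>y\<in>set (sel xs). y \<in> cls n J x \<longrightarrow> f y = f x}
            \<subseteq> {xs \<in> input_lists n u. \<forall>(x, y)\<in>set (block_pairs n n m xs). ?Ok x y}"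
            using sel_in by blast
          then have "real (card {xs \<in> input_lists n u. \<forall>x\<in>set (sel xs). \<forall>y\<in>set (sel xs). y \<in> cls n J x \<longrightarrow> f y = f x})
            \<le> real (card {xs \<in> input_lists n u. \<forall>(x, y)\<in>set (block_pairs n n m xs). ?Ok x y})"
            by (intro of_nat_mono card_mono) auto
          also have "\<dots> \<le> ?b"
            using count_block_pairs[OF _ blk, of m "u - m * Suc n"] mu \<gamma> by simp
          finally show "real (card {xs \<in> input_lists n u. \<forall>x\<in>set (sel xs). \<forall>y\<in>set (sel xs). y \<in> cls n J x \<longrightarrow> f y = f x}) \<le> ?b" .
        qed
        also have "real (n ^ k) * ?b \<le> 1 / 4 * (2 ^ n) ^ u"
        proof -
          have "(1 - \<gamma>) ^ m \<le> exp (- (\<gamma> * m))" by (rule one_minus_power_le_exp[OF \<gamma>(2)])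
          also have "\<dots> \<le> exp (- ((real k + 2) * ln n))"
          proof -
            have "(real k + 2) * ln n = \<gamma> * (C * ln n)" using \<gamma> by (simp add: C_def)
            also have "\<dots> \<le> \<gamma> * m" using m \<gamma> by (intro mult_left_mono) auto
            finally show ?thesis by simp
          qed
          finally have "real (n ^ k) * (1 - \<gamma>) ^ m \<le> real (n ^ k) * exp (- ((real k + 2) * ln n))"
            by (intro mult_left_mono) auto
          also have "\<dots> = 1 / (real n)\<^sup>2" using n(3) by (rule power_times_exp_neg_ln)
          also have "\<dots> \<le> 1 / 4"
            using power_mono[of 2 "real n" 2] n by (simp add: field_simps)
          finally have "real (n ^ k) * (1 - \<gamma>) ^ m \<le> 1 / 4" .
          from mult_right_mono[OF this, of "(2 ^ n) ^ u"] show ?thesis by (simp add: mult_ac)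
        qed
        finally show "real (card {xs \<in> input_lists n u. \<exists>g\<in>SymF n (n - k). \<forall>x\<in>set (sel xs). g x = f x}) \<le> 1 / 4 * (2 ^ n) ^ u" .
      qed
      moreover have "real (2 * m) \<le> (2 * C + 2) * ln n"
        using m lnpos by (simp add: algebra_simps)
      ultimately show "\<exists>q A. is_sample_tester n \<epsilon> (SymF n (n - k)) u q A \<and> real q \<le> (2 * C + 2) * ln n" by blast
      qed
    qed
  qed
qed

section \<open>Passive testing\<close>

text \<open>Each new point hits a fresh class with probability at least \<open>p\<close> as long as fewer than \<open>r\<close>
  classes were hit, so \<open>2 ^ (- number of classes hit)\<close> shrinks in expectation by the factor \<open>1 - p / 2\<close>.\<close>

lemma few_hits:
  fixes h p :: real and key :: "(nat \<Rightarrow> bit) \<Rightarrow> 'k"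
  assumes G: "G \<subseteq> cube n" and fib: "\<And>c. real (card {x \<in> G. key x = c}) \<le> h"
    and p: "0 \<le> p" "p \<le> 1" "p * 2 ^ n \<le> real (card G) - real r * h"
    and "finite S"
  shows "(\<Sum>xs\<in>input_lists n m. of_bool (card (S \<union> key ` (set xs \<inter> G)) < r)) * 2 ^ card S
    \<le> 2 ^ r * (1 - p / 2) ^ m * (2 ^ n) ^ m"
  using \<open>finite S\<close>
proof (induction m arbitrary: S)
  case 0
  then show ?case by (auto intro: power_increasing less_imp_le)
next
  case (Suc m)
  let ?f = "\<lambda>m S. (\<Sum>xs\<in>input_lists n m. of_bool (card (S \<union> key ` (set xs \<inter> G)) < r)) :: real"
  let ?B = "2 ^ r * (1 - p / 2) ^ m * (2 ^ n) ^ m :: real"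
  have B0: "0 \<le> ?B" using p by simp
  show ?case
  proof (cases "r \<le> card S")
    case True
    have "card S \<le> card (S \<union> key ` (set xs \<inter> G))" for xs using Suc.prems by (intro card_mono) auto
    then have "\<not> card (S \<union> key ` (set xs \<inter> G)) < r" for xs using True by (meson leD le_trans)
    then have "?f (Suc m) S = 0" by simp
    then show ?thesis using p by simp
  next
    case False
    let ?new = "{x \<in> G. key x \<notin> S}"
    have fG: "finite G" using G finite_subset by blast
    have h0: "0 \<le> h" using fib[of undefined] by (meson of_nat_0_le_iff order_trans)
    have cnt: "p * 2 ^ n \<le> real (card ?new)"
    proof -
      have "G - ?new = (\<Union>c\<in>S. {x \<in> G. key x = c})" by auto
      then have "card (G - ?new) \<le> (\<Sum>c\<in>S. card {x \<in> G. key x = c})"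
        using card_UN_le[OF Suc.prems] by simp
      then have "real (card (G - ?new)) \<le> real (\<Sum>c\<in>S. card {x \<in> G. key x = c})" by (rule of_nat_mono)
      also have "\<dots> \<le> real (card S) * h" unfolding of_nat_sum by (rule sum_bounded_above) (rule fib)
      also have "\<dots> \<le> real r * h" using False h0 by (intro mult_right_mono) auto
      finally have "real (card (G - ?new)) \<le> real r * h" .
      moreover have "card ?new + card (G - ?new) = card G"
        using fG by (metis (no_types, lifting) card_Diff_subset card_mono finite_subset le_add_diff_inverse mem_Collect_eq subsetI)
      ultimately show ?thesis using p(3) by linarith
    qed
    have "?f (Suc m) S * 2 ^ card S = (\<Sum>x\<in>cube n. (\<Sum>xs\<in>input_lists n m. of_bool (card (S \<union> key ` (set (x # xs) \<inter> G)) < r)) * 2 ^ card S)"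
      by (simp only: sum_input_lists_Suc sum_distrib_right)
    also have "\<dots> \<le> (\<Sum>x\<in>cube n. ?B - of_bool (x \<in> ?new) * (?B / 2))"
    proof (rule sum_mono)
      fix x
      show "(\<Sum>xs\<in>input_lists n m. of_bool (card (S \<union> key ` (set (x # xs) \<inter> G)) < r)) * 2 ^ card S \<le> ?B - of_bool (x \<in> ?new) * (?B / 2)"
      proof (cases "x \<in> ?new")
        case True
        then have "S \<union> key ` (set (x # xs) \<inter> G) = insert (key x) S \<union> key ` (set xs \<inter> G)" for xs by auto
        then have "(\<Sum>xs\<in>input_lists n m. of_bool (card (S \<union> key ` (set (x # xs) \<inter> G)) < r)) = ?f m (insert (key x) S)"
          by simp
        \<comment> \<open>A fresh class increases \<open>card S\<close> by one, so the induction
          hypothesis bounds this branch by half of \<open>?B\<close>.\<close>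
        moreover have "?f m (insert (key x) S) * 2 ^ card (insert (key x) S) \<le> ?B"
          using Suc.prems by (intro Suc.IH) simp
        moreover have "card (insert (key x) S) = Suc (card S)" using True Suc.prems by simp
        ultimately show ?thesis using True by (simp add: mult_ac)
      next
        case False
        then have e: "S \<union> key ` (set (x # xs) \<inter> G) = S \<union> key ` (set xs \<inter> G)" for xs by auto
        have z: "of_bool (x \<in> ?new) * (?B / 2) = 0" using False by simp
        show ?thesis unfolding e z diff_zero by (rule Suc.IH[OF Suc.prems])
      qed
    qed
    also have "\<dots> = 2 ^ n * ?B - real (card ?new) * (?B / 2)"
    proof -
      have "(\<Sum>x\<in>cube n. of_bool (x \<in> ?new)) = real (card ?new)"
      proof -
        have "?new \<subseteq> cube n" using G by auto
        then show ?thesis by (simp add: Int_absorb1)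
      qed
      then show ?thesis by (simp only: sum_subtractf sum_distrib_right[symmetric]) (simp add: card_cube)
    qed
    also have "\<dots> \<le> 2 ^ n * ?B - p * 2 ^ n * (?B / 2)"
      using cnt B0 by (intro diff_left_mono mult_right_mono) auto
    also have "\<dots> = 2 ^ r * (1 - p / 2) ^ Suc m * (2 ^ n) ^ Suc m"
      by (simp add: algebra_simps)
    finally show ?thesis .
  qed
qed

text \<open>The sample is split in halves. The first half hits \<open>r\<close> distinct heavy
  classes with substantial violation, up to a small failure probability. In each hit class the
  points disagreeing with the sampled representative have density at least
  \<open>e = \<epsilon> * \<delta> / (8 * sqrt n)\<close>, and these sets are disjoint. The
  independent second half misses them all with probability at most
  \<open>exp (- m * r * e)\<close>.\<close>

lemma passive_soundness:
  assumes J: "J \<subseteq> {..<n}" and V: "\<epsilon> / 2 * 2 ^ n \<le> total_viol n J f"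
    and n: "n > 0" and \<epsilon>: "0 < \<epsilon>" "\<epsilon> \<le> 1" and \<delta>: "0 < \<delta>" "\<delta> \<le> 1"
    and light: "real (card {x \<in> cube n. real (card (cls n J x)) < \<delta> * 2 ^ n / sqrt n}) \<le> \<epsilon> / 4 * 2 ^ n"
    and r: "real r \<le> \<epsilon> / 16 * sqrt n"
  shows "real (card {xs \<in> input_lists n (m + m). \<forall>x\<in>set xs. \<forall>y\<in>set xs. y \<in> cls n J x \<longrightarrow> f y = f x})
    \<le> (2 ^ r * (1 - \<epsilon> / 32) ^ m + exp (- (real m * real r * \<epsilon> * \<delta> / (8 * sqrt n)))) * (2 ^ n) ^ (m + m)"
proof -
  let ?N = "2 ^ n :: real"
  \<comment> \<open>Of the total violation \<open>\<epsilon> / 2\<close>, points with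
    \<open>viol\<close> below \<open>\<epsilon> / 8\<close> account for at most
    \<open>\<epsilon> / 8\<close> and light classes for at most \<open>\<epsilon> / 4\<close>, so
    \<open>G\<close> has density at least \<open>\<epsilon> / 8\<close>. Removing fewer than
    \<open>r\<close> classes still leaves \<open>\<epsilon> / 16\<close>.\<close>
  define G where "G = {x \<in> cube n. \<delta> * ?N / sqrt n \<le> real (card (cls n J x)) \<and> \<epsilon> / 8 \<le> viol n J f x}"
  define hits where "hits = (\<lambda>xs. cls n J ` (set xs \<inter> G))"
  have sn: "1 \<le> sqrt n" using n by simp
  have cG: "\<epsilon> / 8 * ?N \<le> real (card G)"
  proof -
    have "total_viol n J f \<le> (\<Sum>x\<in>cube n. of_bool (x \<in> G) + \<epsilon> / 8 + of_bool (real (card (cls n J x)) < \<delta> * ?N / sqrt n))"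
      unfolding total_viol_def
    proof (rule sum_mono)
      fix x assume "x \<in> cube n"
      then show "viol n J f x \<le> of_bool (x \<in> G) + \<epsilon> / 8 + of_bool (real (card (cls n J x)) < \<delta> * ?N / sqrt n)"
        using viol_le_1[of n J f x] \<epsilon> by (auto simp: G_def of_bool_def)
    qed
    also have "\<dots> = real (card {x \<in> cube n. x \<in> G}) + \<epsilon> / 8 * ?N + real (card {x \<in> cube n. real (card (cls n J x)) < \<delta> * ?N / sqrt n})"
      by (simp only: sum.distrib real_card_Collect_eq_sum[OF finite_cube]) (simp add: card_cube)
    also have "{x \<in> cube n. x \<in> G} = G" by (auto simp: G_def)
    finally show ?thesis using V light by simp
  qed
  have fib: "real (card {x \<in> G. cls n J x = c}) \<le> ?N / sqrt n" for c
  proof (cases "\<exists>x\<in>G. cls n J x = c")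
    case True
    then obtain x where x: "x \<in> G" "cls n J x = c" by blast
    have "y \<in> cube n \<and> wt {..<n} y = wt {..<n} x" if "y \<in> G" "cls n J y = c" for y
    proof -
      have "y \<in> cls n J x" using that x self_in_cls[of y n J] by (auto simp: G_def)
      then show ?thesis by (simp add: cl_def)
    qed
    then have "card {y \<in> G. cls n J y = c} \<le> card {y \<in> cube n. wt {..<n} y = wt {..<n} x}"
      by (intro card_mono) auto
    then show ?thesis using card_layer_le[OF n, of "wt {..<n} x"] by linarith
  next
    case False
    then have "{x \<in> G. cls n J x = c} = {}" by auto
    then show ?thesis by (simp only: card.empty) simp
  qed
  let ?few = "\<lambda>xs. card (hits xs) < r"
  have few: "(\<Sum>xs\<in>input_lists n m. of_bool (?few xs)) \<le> 2 ^ r * (1 - \<epsilon> / 32) ^ m * ?N ^ m"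
  proof -
    have "real r * (?N / sqrt n) \<le> \<epsilon> / 16 * sqrt n * (?N / sqrt n)"
      using r by (intro mult_right_mono) auto
    also have "\<dots> = \<epsilon> / 16 * ?N" using sn by simp
    finally have "\<epsilon> / 16 * ?N \<le> real (card G) - real r * (?N / sqrt n)" using cG by linarith
    then have "(\<Sum>xs\<in>input_lists n m. of_bool (card ({} \<union> cls n J ` (set xs \<inter> G)) < r)) * 2 ^ card ({} :: (nat \<Rightarrow> bit) set set)
       \<le> 2 ^ r * (1 - \<epsilon> / 16 / 2) ^ m * ?N ^ m"
      using \<epsilon> by (intro few_hits[OF _ fib]) (auto simp: G_def)
    then show ?thesis by (simp add: hits_def del: sum_of_bool_eq)
  qed
  have second: "(\<Sum>ys\<in>input_lists n m. of_bool (\<forall>x\<in>set xs. \<forall>y\<in>set ys. y \<in> cls n J x \<longrightarrow> f y = f x))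
      \<le> exp (- (real m * real r * \<epsilon> * \<delta> / (8 * sqrt n))) * ?N ^ m" if many: "\<not> ?few xs" for xs
  proof -
    define W where "W = {y \<in> cube n. \<exists>x\<in>set xs. y \<in> cls n J x \<and> f y \<noteq> f x}"
    define e where "e = \<epsilon> * \<delta> / (8 * sqrt n)"
    have "real (card (hits xs)) * (e * ?N) \<le> real (card W)"
    proof -
      \<comment> \<open>One sampled representative per class suffices, and distinct classes are
        disjoint, so the sizes of the disagreement sets add up.\<close>
      have "\<forall>c\<in>hits xs. \<exists>x. x \<in> set xs \<inter> G \<and> cls n J x = c" by (auto simp: hits_def)
      then obtain pick where pick: "\<And>c. c \<in> hits xs \<Longrightarrow> pick c \<in> set xs \<inter> G \<and> cls n J (pick c) = c"
        by metis
      let ?D = "\<lambda>c. {y \<in> c. f y \<noteq> f (pick c)}"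
      have fin: "finite (hits xs)" by (simp add: hits_def)
      have D: "e * ?N \<le> real (card (?D c))" if c: "c \<in> hits xs" for c
      proof -
        let ?x = "pick c"
        have x: "?x \<in> cube n" "\<delta> * ?N / sqrt n \<le> real (card (cls n J ?x))" "\<epsilon> / 8 \<le> viol n J f ?x"
          and cx: "cls n J ?x = c" using pick[OF c] by (auto simp: G_def)
        have "e * ?N = \<epsilon> / 8 * (\<delta> * ?N / sqrt n)" by (simp add: e_def)
        also have "\<dots> \<le> viol n J f ?x * real (card (cls n J ?x))"
          using x \<epsilon> \<delta> by (intro mult_mono viol_nonneg) auto
        also have "\<dots> = real (card {y \<in> cls n J ?x. f y \<noteq> f ?x})"
          using card_cls_pos[OF x(1), of J] by (simp add: viol_def)
        finally show ?thesis unfolding cx .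
      qed
      have disj: "?D c \<inter> ?D c' = {}" if "c \<in> hits xs" "c' \<in> hits xs" "c \<noteq> c'" for c c'
      proof (rule ccontr)
        assume "?D c \<inter> ?D c' \<noteq> {}"
        then obtain y where "y \<in> c" "y \<in> c'" by auto
        then have "y \<in> cls n J (pick c)" "y \<in> cls n J (pick c')"
          using pick[OF that(1)] pick[OF that(2)] by auto
        then have "cls n J (pick c) = cls n J (pick c')" using cls_eq by blast
        then show False using pick[OF that(1)] pick[OF that(2)] that(3) by simp
      qed
      have fD: "finite (?D c)" if "c \<in> hits xs" for c
        using that by (auto simp: hits_def)
      have "real (card (hits xs)) * (e * ?N) \<le> (\<Sum>c\<in>hits xs. real (card (?D c)))"
        by (rule sum_bounded_below) (rule D)
      also have "\<dots> = real (card (\<Union>c\<in>hits xs. ?D c))"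
        using fin fD disj by (subst card_UN_disjoint) auto
      also have "\<dots> \<le> real (card W)"
      proof (intro of_nat_mono card_mono)
        show "finite W" by (simp add: W_def)
        show "(\<Union>c\<in>hits xs. ?D c) \<subseteq> W"
        proof
          fix y assume "y \<in> (\<Union>c\<in>hits xs. ?D c)"
          then obtain c where c: "c \<in> hits xs" "y \<in> c" "f y \<noteq> f (pick c)" by auto
          then have "y \<in> cls n J (pick c)" "pick c \<in> set xs" using pick[OF c(1)] by auto
          then show "y \<in> W" using c(3) cl_subset unfolding W_def by blast
        qed
      qed
      finally show ?thesis .
    qed
    moreover have e0: "0 \<le> e" using \<epsilon> \<delta> by (simp add: e_def)
    moreover have "real r * (e * ?N) \<le> real (card (hits xs)) * (e * ?N)"
      using many e0 by (intro mult_right_mono) auto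
    ultimately have W: "real r * (e * ?N) \<le> real (card W)" by linarith
    have WN: "W \<subseteq> cube n" by (auto simp: W_def)
    have "(\<Sum>ys\<in>input_lists n m. of_bool (\<forall>x\<in>set xs. \<forall>y\<in>set ys. y \<in> cls n J x \<longrightarrow> f y = f x))
       \<le> (\<Sum>ys\<in>input_lists n m. of_bool (\<forall>y\<in>set ys. y \<notin> W) :: real)"
      by (intro sum_mono) (auto simp: W_def of_bool_def)
    also have "\<dots> = real (card {y \<in> cube n. y \<notin> W}) ^ m"
      by (simp only: real_card_Collect_eq_sum[OF finite_input_lists, symmetric] card_input_lists_all)
    also have "{y \<in> cube n. y \<notin> W} = cube n - W" by auto
    also have "real (card (cube n - W)) = ?N - real (card W)" by (rule card_cube_diff[OF WN])
    also have "(?N - real (card W)) ^ m \<le> (?N * exp (- (real r * e))) ^ m"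
    proof (rule power_mono)
      have "?N - real (card W) \<le> ?N * (1 - real r * e)" using W by (simp add: algebra_simps)
      also have "\<dots> \<le> ?N * exp (- (real r * e))"
        using exp_ge_add_one_self[of "- (real r * e)"] by (intro mult_left_mono) auto
      finally show "?N - real (card W) \<le> ?N * exp (- (real r * e))" .
      show "0 \<le> ?N - real (card W)" using card_le_cube[OF WN] by simp
    qed
    also have "\<dots> = exp (- (real m * real r * \<epsilon> * \<delta> / (8 * sqrt n))) * ?N ^ m"
      by (simp add: power_mult_distrib exp_of_nat_mult[symmetric] e_def mult_ac)
    finally show ?thesis .
  qed
  have "real (card {xs \<in> input_lists n (m + m). \<forall>x\<in>set xs. \<forall>y\<in>set xs. y \<in> cls n J x \<longrightarrow> f y = f x}) =
    (\<Sum>xs\<in>input_lists n m. \<Sum>ys\<in>input_lists n m. of_bool (\<forall>x\<in>set (xs @ ys). \<forall>y\<in>set (xs @ ys). y \<in> cls n J x \<longrightarrow> f y = f x))"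
    by (simp only: real_card_Collect_eq_sum[OF finite_input_lists] sum_input_lists_append)
  also have "\<dots> \<le> (\<Sum>xs\<in>input_lists n m. of_bool (?few xs) * ?N ^ m + exp (- (real m * real r * \<epsilon> * \<delta> / (8 * sqrt n))) * ?N ^ m)"
  proof (rule sum_mono)
    fix xs
    have "(\<Sum>ys\<in>input_lists n m. of_bool (\<forall>x\<in>set (xs @ ys). \<forall>y\<in>set (xs @ ys). y \<in> cls n J x \<longrightarrow> f y = f x) :: real)
      \<le> (\<Sum>ys\<in>input_lists n m. of_bool (\<forall>x\<in>set xs. \<forall>y\<in>set ys. y \<in> cls n J x \<longrightarrow> f y = f x))"
      by (intro sum_mono) (auto simp: of_bool_def)
    moreover have "(\<Sum>ys\<in>input_lists n m. of_bool (\<forall>x\<in>set xs. \<forall>y\<in>set ys. y \<in> cls n J x \<longrightarrow> f y = f x) :: real)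
      \<le> (\<Sum>ys\<in>input_lists n m. 1)" by (intro sum_mono) auto
    then have "(\<Sum>ys\<in>input_lists n m. of_bool (\<forall>x\<in>set xs. \<forall>y\<in>set ys. y \<in> cls n J x \<longrightarrow> f y = f x) :: real) \<le> ?N ^ m"
      by (simp add: card_input_lists del: sum_of_bool_eq)
    ultimately show "(\<Sum>ys\<in>input_lists n m. of_bool (\<forall>x\<in>set (xs @ ys). \<forall>y\<in>set (xs @ ys). y \<in> cls n J x \<longrightarrow> f y = f x))
       \<le> of_bool (?few xs) * ?N ^ m + exp (- (real m * real r * \<epsilon> * \<delta> / (8 * sqrt n))) * ?N ^ m"
    proof (cases "?few xs")
      case True
      then show ?thesis
        using \<open>(\<Sum>ys\<in>input_lists n m. of_bool (\<forall>x\<in>set (xs @ ys). \<forall>y\<in>set (xs @ ys). y \<in> cls n J x \<longrightarrow> f y = f x) :: real) \<le> _\<close>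
          \<open>_ \<le> ?N ^ m\<close> by (simp del: sum_of_bool_eq) (smt (verit) exp_gt_zero mult_nonneg_nonneg zero_le_power)
    next
      case False
      from second[OF this] show ?thesis
        using False \<open>(\<Sum>ys\<in>input_lists n m. of_bool (\<forall>x\<in>set (xs @ ys). \<forall>y\<in>set (xs @ ys). y \<in> cls n J x \<longrightarrow> f y = f x) :: real) \<le> _\<close>
        by (simp del: sum_of_bool_eq)
    qed
  qed
  also have "\<dots> = (\<Sum>xs\<in>input_lists n m. of_bool (?few xs)) * ?N ^ m + ?N ^ m * (exp (- (real m * real r * \<epsilon> * \<delta> / (8 * sqrt n))) * ?N ^ m)"
    by (simp only: sum.distrib sum_distrib_right[symmetric]) (simp add: card_input_lists del: sum_of_bool_eq)
  also have "\<dots> \<le> (2 ^ r * (1 - \<epsilon> / 32) ^ m * ?N ^ m) * ?N ^ m + ?N ^ m * (exp (- (real m * real r * \<epsilon> * \<delta> / (8 * sqrt n))) * ?N ^ m)"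
    using few by (intro add_right_mono mult_right_mono) auto
  also have "\<dots> = (2 ^ r * (1 - \<epsilon> / 32) ^ m + exp (- (real m * real r * \<epsilon> * \<delta> / (8 * sqrt n)))) * ?N ^ (m + m)"
    by (simp add: power_add algebra_simps)
  finally show ?thesis .
qed

lemma passive_tester_exists:
  assumes \<epsilon>: "0 < \<epsilon>" "\<epsilon> \<le> 1"
  shows "\<exists>C>0. \<forall>\<^sub>F n in sequentially.
    \<exists>q A. is_sample_tester n \<epsilon> (SymF n (n - k)) q q A \<and> real q \<le> C * (real n powr (1 / 4) * sqrt (ln (real n)))"
proof -
  obtain \<delta> where \<delta>: "0 < \<delta>" "\<delta> \<le> 1" and light: "\<And>n J. n > 0 \<Longrightarrow> J \<subseteq> {..<n} \<Longrightarrow> card J \<le> k \<Longrightarrow>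
      real (card {x \<in> cube n. real (card (cls n J x)) < \<delta> * 2 ^ n / sqrt n}) \<le> \<epsilon> / 4 * 2 ^ n"
    using light_classes[of "\<epsilon> / 4" k] \<epsilon> by auto
  \<comment> \<open>With \<open>r \<ge> \<epsilon> * m / 128\<close> the exponent in
    \<open>passive_soundness\<close> is at least
    \<open>m^2 * \<epsilon>^2 * \<delta> / (1024 * sqrt n)\<close>. For
    \<open>m \<ge> C * n powr (1 / 4) * sqrt (ln n)\<close> this reaches
    \<open>(k + 2) * ln n\<close> exactly by the choice \<open>C^2 = D\<close>.\<close>
  define D where "D = 1024 * (real k + 2) / (\<epsilon>\<^sup>2 * \<delta>)"
  define C where "C = sqrt D"
  have C: "C > 0" "C\<^sup>2 = D" using \<epsilon> \<delta> by (auto simp: C_def D_def)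
  let ?g = "\<lambda>n. real n powr (1 / 4) * sqrt (ln (real n))"
  show ?thesis
  proof (intro exI[of _ "2 * C + 2"] conjI)
    show "2 * C + 2 > 0" using C by simp
    have e1: "\<forall>\<^sub>F n in sequentially. 1 \<le> ?g n" by real_asymp
    have e2: "\<forall>\<^sub>F n in sequentially. 10 * ((2 * C + 2) * ?g n)\<^sup>2 \<le> 2 powr real n" using C(1) by real_asymp
    have e3: "\<forall>\<^sub>F n in sequentially. C * ?g n + 1 \<le> sqrt (real n)" by real_asymp
    have e4: "\<forall>\<^sub>F n in sequentially. 1 \<le> \<epsilon> / 128 * (C * ?g n)" using C(1) \<epsilon>(1) by real_asymp
    have e5: "\<forall>\<^sub>F n in sequentially. (real k + 2) * ln (real n) \<le> \<epsilon> / 64 * (C * ?g n)" using C(1) \<epsilon>(1) by real_asymp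
    show "\<forall>\<^sub>F n in sequentially. \<exists>q A. is_sample_tester n \<epsilon> (SymF n (n - k)) q q A \<and> real q \<le> (2 * C + 2) * ?g n"
      using e1 e2 e3 e4 e5 eventually_ge_at_top[of "k + 3"]
    proof eventually_elim
      case (elim n)
      have n: "k \<le> n" "n \<ge> 3" "n > 0" using elim by auto
      define m where "m = nat \<lceil>C * ?g n\<rceil>"
      have m: "C * ?g n \<le> m" "real m \<le> C * ?g n + 1"
      proof -
        have "0 \<le> C * ?g n" using C(1) elim(1) by simp
        then show "C * ?g n \<le> m" "real m \<le> C * ?g n + 1" unfolding m_def by linarith+
      qed
      \<comment> \<open>The ratio 1/64 is small enough for
        \<open>2 ^ r \<le> exp (\<epsilon> * m / 64)\<close> to be beaten by
        \<open>(1 - \<epsilon> / 32) ^ m\<close>, while \<open>r\<close> remains proportional to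
        \<open>m\<close>.\<close>
      define r where "r = nat \<lfloor>\<epsilon> / 64 * real m\<rfloor>"
      have r: "real r \<le> \<epsilon> / 64 * real m" "\<epsilon> / 128 * real m \<le> real r"
      proof -
        have "0 \<le> \<epsilon> / 64 * real m" using \<epsilon> by simp
        then show "real r \<le> \<epsilon> / 64 * real m" unfolding r_def by linarith
        have "1 \<le> \<epsilon> / 128 * real m"
          using elim(4) mult_left_mono[OF m(1), of "\<epsilon> / 128"] \<epsilon> by linarith
        then show "\<epsilon> / 128 * real m \<le> real r" unfolding r_def by linarith
      qed
      have q: "real (m + m) \<le> (2 * C + 2) * ?g n"
        using m(2) elim(1) by (simp add: algebra_simps)
      have "10 * (real (m + m))\<^sup>2 \<le> 10 * ((2 * C + 2) * ?g n)\<^sup>2"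
        using q by (intro mult_left_mono power_mono) auto
      also have "\<dots> \<le> 2 ^ n" using elim(2) by (simp add: powr_realpow)
      finally have "real (10 * (m + m)\<^sup>2) \<le> real (2 ^ n)" by simp
      then have u2: "10 * (m + m)\<^sup>2 \<le> 2 ^ n" by (simp only: of_nat_le_iff)
      have "m + m \<le> 10 * (m + m)\<^sup>2" by (simp add: power2_eq_square)
      then have u1: "m + m \<le> 2 ^ n" using u2 by linarith
      have "\<exists>A. is_sample_tester n \<epsilon> (SymF n (n - k)) (m + m) (m + m) A"
      proof (rule sample_testerI[where sel = "\<lambda>xs. xs", OF u1 u2])
        fix f assume f: "f \<in> bool_funs n" "far_from n \<epsilon> f (SymF n (n - k))"
        let ?b = "(2 ^ r * (1 - \<epsilon> / 32) ^ m + exp (- (real m * real r * \<epsilon> * \<delta> / (8 * sqrt n)))) * (2 ^ n) ^ (m + m)"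
        have "real (card {xs \<in> input_lists n (m + m). \<exists>g\<in>SymF n (n - k). \<forall>x\<in>set xs. g x = f x}) \<le> real (n ^ k) * ?b"
        proof (rule consistent_count_le[OF n(1)])
          show "0 \<le> ?b" using \<epsilon> by (intro mult_nonneg_nonneg add_nonneg_nonneg) auto
        next
          fix J assume J: "J \<subseteq> {..<n}" "card J = k"
          show "real (card {xs \<in> input_lists n (m + m). \<forall>x\<in>set xs. \<forall>y\<in>set xs. y \<in> cls n J x \<longrightarrow> f y = f x}) \<le> ?b"
          proof (rule passive_soundness[OF J(1) _ n(3) \<epsilon> \<delta>(1,2)])
            show "\<epsilon> / 2 * 2 ^ n \<le> total_viol n J f"
              using far_imp_total_viol[OF n(1) f(2) J(1)] J(2) by simp
            show "real (card {x \<in> cube n. real (card (cls n J x)) < \<delta> * 2 ^ n / sqrt n}) \<le> \<epsilon> / 4 * 2 ^ n"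
              using light[OF n(3) J(1)] J(2) by simp
            have "real m \<le> sqrt n" using m(2) elim(3) by linarith
            then have "\<epsilon> / 64 * real m \<le> \<epsilon> / 64 * sqrt n" using \<epsilon> by (intro mult_left_mono) auto
            moreover have "0 \<le> \<epsilon> * sqrt n" using \<epsilon> by simp
            ultimately show "real r \<le> \<epsilon> / 16 * sqrt n" using r(1) by simp
          qed
        qed (auto simp: input_lists_def)
        also have "real (n ^ k) * ?b \<le> 1 / 4 * (2 ^ n) ^ (m + m)"
        proof -
          let ?E = "exp (- ((real k + 2) * ln n))"
          have "2 ^ r * (1 - \<epsilon> / 32) ^ m \<le> exp (real r) * exp (- (\<epsilon> / 32 * real m))"
          proof (rule mult_mono)
            show "2 ^ r \<le> exp (real r)" by (rule two_power_le_exp)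
            show "(1 - \<epsilon> / 32) ^ m \<le> exp (- (\<epsilon> / 32 * real m))"
              using \<epsilon> by (intro one_minus_power_le_exp) auto
          qed (use \<epsilon> in auto)
          also have "\<dots> = exp (real r - \<epsilon> / 32 * real m)" by (simp add: exp_add[symmetric])
          also have "\<dots> \<le> ?E"
          proof -
            have "\<epsilon> / 64 * (C * ?g n) \<le> \<epsilon> / 64 * real m" using m(1) \<epsilon> by (intro mult_left_mono) auto
            then have "real r - \<epsilon> / 32 * real m \<le> - ((real k + 2) * ln n)" using r(1) elim(5) by linarith
            then show ?thesis by simp
          qed
          finally have 1: "2 ^ r * (1 - \<epsilon> / 32) ^ m \<le> ?E" .
          have 2: "exp (- (real m * real r * \<epsilon> * \<delta> / (8 * sqrt n))) \<le> ?E"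
          proof -
            have gg: "(?g n)\<^sup>2 = sqrt n * ln n" using n by (intro passive_rate_sq) simp
            have sn: "sqrt n > 0" using n by simp
            have "(real k + 2) * ln n = C\<^sup>2 * (\<epsilon>\<^sup>2 * \<delta> / 1024) * ln n"
              using \<epsilon> \<delta> by (simp add: C(2) D_def)
            also have "\<dots> = (C * ?g n)\<^sup>2 * (\<epsilon>\<^sup>2 * \<delta> / (1024 * sqrt n))"
            proof -
              have Cg: "(C * ?g n)\<^sup>2 = C\<^sup>2 * (sqrt n * ln n)" by (simp only: power_mult_distrib[of C] gg)
              show ?thesis unfolding Cg using sn by simp
            qed
            also have "\<dots> \<le> (real m)\<^sup>2 * (\<epsilon>\<^sup>2 * \<delta> / (1024 * sqrt n))"
              using m(1) C(1) elim(1) \<delta> by (intro mult_right_mono power_mono) auto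
            also have "\<dots> = real m * (\<epsilon> / 128 * real m) * (\<epsilon> * \<delta> / (8 * sqrt n))"
              by (simp add: power2_eq_square)
            also have "\<dots> \<le> real m * real r * (\<epsilon> * \<delta> / (8 * sqrt n))"
              using r(2) \<epsilon> \<delta> by (intro mult_right_mono mult_left_mono) auto
            finally show ?thesis by (simp add: mult_ac)
          qed
          have "real (n ^ k) * (2 ^ r * (1 - \<epsilon> / 32) ^ m + exp (- (real m * real r * \<epsilon> * \<delta> / (8 * sqrt n)))) \<le> real (n ^ k) * (?E + ?E)"
            using 1 2 by (intro mult_left_mono add_mono) auto
          also have "\<dots> = 2 / (real n)\<^sup>2"
            using power_times_exp_neg_ln[OF n(3), of k] by (simp only: distrib_left)
          also have "\<dots> \<le> 1 / 4"
            using power_mono[of 3 "real n" 2] n by (simp add: field_simps)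
          finally have "real (n ^ k) * (2 ^ r * (1 - \<epsilon> / 32) ^ m + exp (- (real m * real r * \<epsilon> * \<delta> / (8 * sqrt n)))) \<le> 1 / 4" .
          then have "real (n ^ k) * (2 ^ r * (1 - \<epsilon> / 32) ^ m + exp (- (real m * real r * \<epsilon> * \<delta> / (8 * sqrt n)))) * (2 ^ n) ^ (m + m)
              \<le> 1 / 4 * (2 ^ n) ^ (m + m)" by (rule mult_right_mono) simp
          then show ?thesis by (simp only: mult.assoc)
        qed
        finally show "real (card {xs \<in> input_lists n (m + m). \<exists>g\<in>SymF n (n - k). \<forall>x\<in>set xs. g x = f x}) \<le> 1 / 4 * (2 ^ n) ^ (m + m)" .
      qed auto
      then show ?case using q by blast
    qed
  qed
qed

section \<open>Lower bounds from random functions\<close>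

text \<open>On \<open>M\<close> the set of ones is recovered from the set of its keys. Used with the
  whole cube to count members, and with the middle layers only to count hypotheses of the
  learner.\<close>

lemma card_class_const_supports:
  assumes "M \<subseteq> cube n"
  shows "finite ((\<lambda>f. {x \<in> M. f x = 1}) ` {f. class_const n J f})"
    and "card ((\<lambda>f. {x \<in> M. f x = 1}) ` {f. class_const n J f}) \<le> 2 ^ card (key n J ` M)"
proof -
  have fM: "finite M" using assms finite_subset by blast
  have sub: "(\<lambda>f. {x \<in> M. f x = 1}) ` {f. class_const n J f} \<subseteq> (\<lambda>T. {x \<in> M. key n J x \<in> T}) ` Pow (key n J ` M)"
  proof
    fix A assume "A \<in> (\<lambda>f. {x \<in> M. f x = 1}) ` {f. class_const n J f}"
    then obtain f where f: "class_const n J f" "A = {x \<in> M. f x = 1}" by auto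
    have "{x \<in> M. key n J x \<in> key n J ` A} = A"
    proof
      show "{x \<in> M. key n J x \<in> key n J ` A} \<subseteq> A"
      proof
        fix x assume "x \<in> {x \<in> M. key n J x \<in> key n J ` A}"
        then obtain y where x: "x \<in> M" and y: "y \<in> M" "f y = 1" "key n J x = key n J y" by (auto simp: f(2))
        then have "x \<in> cls n J y" using assms key_eq_iff by blast
        then have "f x = f y" using f(1) y(1) assms unfolding class_const_def by blast
        then show "x \<in> A" using x y by (simp add: f(2))
      qed
    qed (auto simp: f(2))
    moreover have "key n J ` A \<in> Pow (key n J ` M)" by (auto simp: f(2))
    ultimately show "A \<in> (\<lambda>T. {x \<in> M. key n J x \<in> T}) ` Pow (key n J ` M)" by blast
  qed
  have fP: "finite (Pow (key n J ` M))" using fM by simp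
  show "finite ((\<lambda>f. {x \<in> M. f x = 1}) ` {f. class_const n J f})"
    by (rule finite_surj[OF fP sub])
  have "card ((\<lambda>f. {x \<in> M. f x = 1}) ` {f. class_const n J f}) \<le> card (Pow (key n J ` M))"
    using surj_card_le[OF fP sub] .
  then show "card ((\<lambda>f. {x \<in> M. f x = 1}) ` {f. class_const n J f}) \<le> 2 ^ card (key n J ` M)"
    using fM by (simp add: card_Pow)
qed

lemma finite_witness_sets: "finite {J. J \<subseteq> {..<n :: nat} \<and> card J = k}"
  by (rule finite_subset[of _ "Pow {..<n}"]) auto

lemma bool_funs_eqI:
  assumes "f \<in> bool_funs n" "g \<in> bool_funs n" "{x \<in> cube n. f x = 1} = {x \<in> cube n. g x = 1}"
  shows "f = g"
proof (rule PiE_ext[OF assms(1,2)[unfolded bool_funs_def]])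
  fix x assume "x \<in> cube n"
  then have "f x = 1 \<longleftrightarrow> g x = 1" using assms(3) by blast
  then show "f x = g x" by (metis bit_not_one_iff)
qed

lemma card_SymF_le:
  assumes "k \<le> n"
  shows "card (SymF n (n - k)) \<le> n ^ k * 2 ^ (2 ^ k * (n + 1))"
proof -
  let ?J = "{J. J \<subseteq> {..<n} \<and> card J = k}"
  let ?F = "\<lambda>J. {f \<in> bool_funs n. class_const n J f}"
  have "SymF n (n - k) = (\<Union>J\<in>?J. ?F J)" using SymF_iff[OF assms] by blast
  then have "card (SymF n (n - k)) \<le> (\<Sum>J\<in>?J. card (?F J))"
    by (simp add: card_UN_le[OF finite_witness_sets])
  also have "\<dots> \<le> card ?J * 2 ^ (2 ^ k * (n + 1))"
  proof (rule sum_bounded_above[of ?J _ "2 ^ (2 ^ k * (n + 1)) :: nat", unfolded of_nat_id])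
    fix J assume J: "J \<in> ?J"
    then have fJ: "finite J" using finite_subset by blast
    let ?s = "\<lambda>f. {x \<in> cube n. f x = 1}"
    have "inj_on ?s (?F J)" by (intro inj_onI) (auto intro: bool_funs_eqI)
    then have "card (?F J) = card (?s ` ?F J)" by (simp add: card_image)
    also have "\<dots> \<le> card (?s ` {f. class_const n J f})"
      by (intro card_mono card_class_const_supports(1)) auto
    also have "\<dots> \<le> 2 ^ card (key n J ` cube n)"
      by (rule card_class_const_supports(2)) simp
    also have "\<dots> \<le> 2 ^ (2 ^ k * (n + 1))"
    proof (rule power_increasing)
      have "wt {..<n} ` cube n \<subseteq> {..n}" using wt_le_n by auto
      then show "card (key n J ` cube n) \<le> 2 ^ k * (n + 1)"
        using card_keys[OF fJ, of "{..n}" n "cube n"] J by simp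
    qed simp
    finally show "card (?F J) \<le> 2 ^ (2 ^ k * (n + 1))" .
  qed
  also have "\<dots> \<le> n ^ k * 2 ^ (2 ^ k * (n + 1))"
    by (rule mult_le_mono1) (rule card_SymF_witness_sets)
  finally show ?thesis .
qed

text \<open>Weight each function by \<open>(1 / 2) ^ distance\<close>; the total weight is
  \<open>(3 / 2) ^ (2 ^ n)\<close>. For a close function \<open>2 ^ distance\<close> is at most
  \<open>(16 / 15) ^ (2 ^ n)\<close>, because \<open>(16 / 15) ^ 1000 \<ge> 2\<close>. The product
  \<open>3 / 2 * 16 / 15 = 8 / 5\<close> stays below 2.\<close>

lemma card_close_functions:
  assumes "\<epsilon> \<le> 1 / 1000"
  shows "real (card {f \<in> bool_funs n. real (card (disagree n f g)) < \<epsilon> * 2 ^ n}) \<le> (8 / 5) ^ 2 ^ n"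
proof -
  let ?C = "{f \<in> bool_funs n. real (card (disagree n f g)) < \<epsilon> * 2 ^ n}"
  have mgf: "(\<Sum>f\<in>bool_funs n. (1 / 2 :: real) ^ card (disagree n f g)) = (3 / 2) ^ 2 ^ n"
  proof -
    have "(1 / 2 :: real) ^ card (disagree n f g) = (\<Prod>x\<in>cube n. if f x \<noteq> g x then 1 / 2 else 1)" for f
      by (simp add: disagree_def prod.If_cases Int_def)
    then have "(\<Sum>f\<in>bool_funs n. (1 / 2 :: real) ^ card (disagree n f g)) = (\<Prod>x\<in>cube n. \<Sum>b\<in>UNIV. if b \<noteq> g x then 1 / 2 else 1)"
      unfolding bool_funs_def by (subst prod_sum_PiE) auto
    moreover have "(\<Sum>b\<in>UNIV. if b \<noteq> g x then 1 / 2 else 1 :: real) = 3 / 2" for x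
      by (cases "g x") (simp_all add: sum_UNIV_bit)
    ultimately show ?thesis by (simp add: card_cube)
  qed
  have "real (card ?C) = (\<Sum>f\<in>?C. 1)" by simp
  also have "\<dots> \<le> (\<Sum>f\<in>?C. (1 / 2) ^ card (disagree n f g) * (16 / 15) ^ 2 ^ n)"
  proof (rule sum_mono)
    fix f assume "f \<in> ?C"
    let ?d = "card (disagree n f g)"
    have "real ?d < \<epsilon> * 2 ^ n" using \<open>f \<in> ?C\<close> by simp
    also have "\<dots> \<le> 1 / 1000 * 2 ^ n" using assms by (intro mult_right_mono) auto
    finally have "real (1000 * ?d) \<le> real (2 ^ n)" by simp
    then have d: "1000 * ?d \<le> 2 ^ n" by (simp only: of_nat_le_iff)
    have "1 + real 1000 * (1 / 15) \<le> (1 + 1 / 15 :: real) ^ 1000" by (rule Bernoulli_inequality) simp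
    then have "2 \<le> (16 / 15 :: real) ^ 1000" by simp
    then have "2 ^ ?d \<le> ((16 / 15 :: real) ^ 1000) ^ ?d" by (intro power_mono) auto
    also have "\<dots> = (16 / 15) ^ (1000 * ?d)" by (simp only: power_mult)
    also have "\<dots> \<le> (16 / 15) ^ 2 ^ n" using d by (intro power_increasing) auto
    finally have "(1 / 2) ^ ?d * 2 ^ ?d \<le> (1 / 2) ^ ?d * (16 / 15 :: real) ^ 2 ^ n" by (rule mult_left_mono) simp
    then show "1 \<le> (1 / 2) ^ ?d * (16 / 15 :: real) ^ 2 ^ n" by (simp add: power_mult_distrib[symmetric])
  qed
  also have "\<dots> \<le> (\<Sum>f\<in>bool_funs n. (1 / 2) ^ card (disagree n f g) * (16 / 15) ^ 2 ^ n)"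
    by (rule sum_mono2) auto
  also have "\<dots> = (3 / 2) ^ 2 ^ n * (16 / 15) ^ 2 ^ n" by (simp only: sum_distrib_right[symmetric] mgf)
  also have "\<dots> = (8 / 5) ^ 2 ^ n" by (simp add: power_mult_distrib[symmetric])
  finally show ?thesis .
qed

text \<open>The property has only \<open>2 ^ O(n)\<close> members, and each ball has at most
  \<open>(8 / 5) ^ (2 ^ n)\<close> elements out of \<open>2 ^ (2 ^ n)\<close>.\<close>

lemma most_functions_far:
  assumes "\<epsilon> \<le> 1 / 1000"
  shows "\<forall>\<^sub>F n in sequentially.
    real (card {f \<in> bool_funs n. \<not> far_from n \<epsilon> f (SymF n (n - k))}) \<le> 1 / 100 * real (card (bool_funs n))"
proof -
  define c where "c = (2::real) ^ k"
  have "c > 0" by (simp add: c_def)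
  then have "\<forall>\<^sub>F n in sequentially. real k * real n + c * (real n + 1) - 2 powr real n / 5 \<le> - 10"
    by real_asymp
  then show ?thesis using eventually_ge_at_top[of k]
  proof eventually_elim
    case (elim n)
    let ?P = "SymF n (n - k)"
    let ?C = "\<lambda>g. {f \<in> bool_funs n. real (card (disagree n f g)) < \<epsilon> * 2 ^ n}"
    have fP: "finite ?P" by (rule finite_subset[OF _ finite_bool_funs[of n]]) (auto simp: SymF_def)
    have "{f \<in> bool_funs n. \<not> far_from n \<epsilon> f ?P} \<subseteq> (\<Union>g\<in>?P. ?C g)"
      by (auto simp: far_from_def not_le)
    then have "card {f \<in> bool_funs n. \<not> far_from n \<epsilon> f ?P} \<le> card (\<Union>g\<in>?P. ?C g)"
      using fP by (intro card_mono) auto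
    also have "\<dots> \<le> (\<Sum>g\<in>?P. card (?C g))" by (rule card_UN_le[OF fP])
    finally have "real (card {f \<in> bool_funs n. \<not> far_from n \<epsilon> f ?P}) \<le> real (\<Sum>g\<in>?P. card (?C g))" by (rule of_nat_mono)
    also have "\<dots> = (\<Sum>g\<in>?P. real (card (?C g)))" by simp
    also have "\<dots> \<le> real (card ?P) * (8 / 5) ^ 2 ^ n"
      by (rule sum_bounded_above) (rule card_close_functions[OF assms])
    also have "\<dots> \<le> real (n ^ k * 2 ^ (2 ^ k * (n + 1))) * (8 / 5) ^ 2 ^ n"
      using card_SymF_le[OF elim(2)] by (intro mult_right_mono of_nat_mono) auto
    also have "\<dots> = (real n ^ k * 2 ^ (2 ^ k * (n + 1)) * (4 / 5) ^ 2 ^ n) * 2 ^ 2 ^ n"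
    proof -
      have "(4 / 5 :: real) ^ 2 ^ n * 2 ^ 2 ^ n = (8 / 5) ^ 2 ^ n" by (simp add: power_mult_distrib[symmetric])
      then show ?thesis by simp
    qed
    also have "\<dots> \<le> 1 / 100 * 2 ^ 2 ^ n"
    proof (rule mult_right_mono)
      have p1: "real n ^ k \<le> exp (real k * real n)"
      proof -
        have "real n \<le> exp (real n)" using exp_ge_add_one_self[of "real n"] by linarith
        then have "real n ^ k \<le> exp (real n) ^ k" by (rule power_mono) simp
        then show ?thesis by (simp add: exp_of_nat_mult)
      qed
      have p2: "2 ^ (2 ^ k * (n + 1)) \<le> exp (c * (real n + 1))"
        using two_power_le_exp[of "2 ^ k * (n + 1)"] by (simp add: c_def algebra_simps)
      have p3: "(4 / 5 :: real) ^ 2 ^ n \<le> exp (- (2 ^ n / 5))"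
      proof -
        have "(1 - 1 / 5 :: real) ^ 2 ^ n \<le> exp (- (1 / 5 * real (2 ^ n)))"
          by (rule one_minus_power_le_exp) simp
        then show ?thesis by simp
      qed
      have "real n ^ k * 2 ^ (2 ^ k * (n + 1)) * (4 / 5) ^ 2 ^ n
          \<le> exp (real k * real n) * exp (c * (real n + 1)) * exp (- (2 ^ n / 5))"
        using p1 p2 p3 by (intro mult_mono) auto
      also have "\<dots> = exp (real k * real n + c * (real n + 1) - 2 ^ n / 5)"
        by (simp add: exp_add[symmetric])
      also have "\<dots> \<le> exp (- 10)" using elim(1) by (simp add: powr_realpow)
      also have "\<dots> \<le> 1 / 100"
        using two_power_le_exp[of 10] by (simp add: exp_minus field_simps)
      finally show "real n ^ k * 2 ^ (2 ^ k * (n + 1)) * (4 / 5) ^ 2 ^ n \<le> 1 / 100" .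
    qed simp
    finally show ?case by (simp add: card_bool_funs)
  qed
qed

text \<open>The distributional quantity in Yao's principle: the rejection probability of a fixed
  tree on a random instance. The index set allows a family with repetitions.\<close>

definition rej_avg :: "'b set \<Rightarrow> ('b \<Rightarrow> 'a \<Rightarrow> bit) \<Rightarrow> 'a dtree \<Rightarrow> real" where
  "rej_avg I F t = (\<Sum>i\<in>I. of_bool (\<not> accepts t (F i))) / card I"

lemma rej_avg_bounds: "0 \<le> rej_avg I F t" "rej_avg I F t \<le> 1"
proof -
  show "0 \<le> rej_avg I F t" unfolding rej_avg_def by (intro divide_nonneg_nonneg sum_nonneg) auto
  have "(\<Sum>i\<in>I. of_bool (\<not> accepts t (F i))) \<le> (\<Sum>i\<in>I. 1 :: real)" by (rule sum_mono) auto
  then show "rej_avg I F t \<le> 1" unfolding rej_avg_def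
    by (cases "card I = 0") (simp_all add: divide_le_eq_1 del: sum_of_bool_eq)
qed

lemma integrable_rej_avg: "integrable (measure_pmf M) (rej_avg I F)"
  by (rule measure_pmf.integrable_const_bound[where B = 1])
    (auto simp: rej_avg_bounds abs_le_iff intro: order_trans[OF _ rej_avg_bounds(1)])

lemma expectation_rej_avg:
  assumes "finite I"
  shows "measure_pmf.expectation D (rej_avg I F) = (\<Sum>i\<in>I. measure_pmf.prob D {t. \<not> accepts t (F i)}) / card I"
proof -
  have "measure_pmf.prob D {t. \<not> accepts t (F i)} = measure_pmf.expectation D (\<lambda>t. of_bool (\<not> accepts t (F i)))" for i
  proof -
    have "(\<lambda>t. of_bool (\<not> accepts t (F i)) :: real) = indicator {t. \<not> accepts t (F i)}"
      by (auto simp: indicator_def fun_eq_iff)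
    then show ?thesis by simp
  qed
  moreover have "integrable (measure_pmf D) (\<lambda>t. of_bool (\<not> accepts t (F i)) :: real)" for i
    by (intro measure_pmf.integrable_const_bound[where B = 1]) auto
  ultimately show ?thesis
    by (simp add: rej_avg_def[abs_def] Bochner_Integration.integral_sum del: sum_of_bool_eq)
qed

lemma expectation_bind_rej_avg:
  assumes "u \<le> 2 ^ n" "finite I"
  shows "measure_pmf.expectation (pmf_of_set (samples n u) \<bind> A) (rej_avg I F) =
    (\<Sum>U\<in>samples n u. measure_pmf.expectation (A U) (rej_avg I F)) / card (samples n u)"
proof -
  have "(\<Sum>i\<in>I. (\<Sum>U\<in>S. p U i) / a) / b = (\<Sum>U\<in>S. (\<Sum>i\<in>I. p U i) / b) / a"
    for p :: "(nat \<Rightarrow> bit) set \<Rightarrow> 'a \<Rightarrow> real" and S a b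
    unfolding sum_divide_distrib[symmetric] sum.swap[of _ I S] by simp
  then show ?thesis
    unfolding expectation_rej_avg[OF assms(2)] prob_bind_pmf_of_set[OF finite_samples samples_nonempty[OF assms(1)]] .
qed

text \<open>Yao's principle in the form used here: \<open>F\<close> ranges over instances in the property, the
  uniformly random function is almost surely far from it.\<close>

lemma sample_tester_lower_bound:
  assumes T: "is_sample_tester n \<epsilon> P u q A"
    and I: "finite I" "I \<noteq> {}" "\<And>i. i \<in> I \<Longrightarrow> F i \<in> P"
    and far: "real (card {f \<in> bool_funs n. \<not> far_from n \<epsilon> f P}) \<le> 1 / 100 * real (card (bool_funs n))"
    and a: "0 \<le> a"
    and ind: "\<And>U t. U \<in> samples n u \<Longrightarrow> depth t \<le> q \<Longrightarrow> queried t \<subseteq> U \<Longrightarrow>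
       a * rej_avg (bool_funs n) (\<lambda>f. f) t - b U \<le> rej_avg I F t"
  shows "a * (66 / 100) \<le> 1 / 3 + (\<Sum>U\<in>samples n u. b U) / card (samples n u)"
proof -
  define D where "D = pmf_of_set (samples n u) \<bind> A"
  let ?no = "rej_avg (bool_funs n) (\<lambda>f. f)" and ?yes = "rej_avg I F"
  have u: "u \<le> 2 ^ n" and dq: "\<And>U t. U \<in> samples n u \<Longrightarrow> t \<in> set_pmf (A U) \<Longrightarrow> depth t \<le> q \<and> queried t \<subseteq> U"
    and tests: "tests n \<epsilon> P D"
    using T by (auto simp: is_sample_tester_def D_def)
  have yes: "measure_pmf.expectation D ?yes \<le> 1 / 3"
  proof -
    have "(\<Sum>i\<in>I. measure_pmf.prob D {t. \<not> accepts t (F i)}) \<le> real (card I) * (1 / 3)"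
    proof (rule sum_bounded_above)
      fix i assume "i \<in> I"
      then have "2 / 3 \<le> measure_pmf.prob D {t. accepts t (F i)}" using tests I(3) by (auto simp: tests_def)
      then show "measure_pmf.prob D {t. \<not> accepts t (F i)} \<le> 1 / 3" by (simp add: prob_compl)
    qed
    moreover have "card I > 0" using I by (simp add: card_gt_0_iff)
    ultimately show ?thesis unfolding expectation_rej_avg[OF I(1)] by (simp add: divide_le_eq mult.commute)
  qed
  \<comment> \<open>66/100 is 2/3 of the 99/100 of all functions that are far.\<close>
  have no: "66 / 100 \<le> measure_pmf.expectation D ?no"
  proof -
    let ?B = "bool_funs n" and ?far = "\<lambda>f. far_from n \<epsilon> f P"
    have "2 / 3 * (real (card ?B) - real (card {f \<in> ?B. \<not> ?far f})) = (\<Sum>f\<in>?B. 2 / 3 * (1 - of_bool (\<not> ?far f)))"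
      by (simp only: real_card_Collect_eq_sum[OF finite_bool_funs] sum_distrib_left[symmetric] sum_subtractf) simp
    also have "\<dots> \<le> (\<Sum>f\<in>?B. measure_pmf.prob D {t. \<not> accepts t f})"
      by (intro sum_mono) (use tests in \<open>auto simp: tests_def of_bool_def\<close>)
    finally have "66 / 100 * real (card ?B) \<le> (\<Sum>f\<in>?B. measure_pmf.prob D {t. \<not> accepts t f})"
      using far by simp
    moreover have "real (card ?B) > 0" by (simp add: card_gt_0_iff)
    ultimately show ?thesis unfolding expectation_rej_avg[OF finite_bool_funs] by (simp add: le_divide_eq)
  qed
  have "a * measure_pmf.expectation (A U) ?no - b U \<le> measure_pmf.expectation (A U) ?yes" if U: "U \<in> samples n u" for U
  proof -
    have "measure_pmf.expectation (A U) (\<lambda>t. a * ?no t - b U) \<le> measure_pmf.expectation (A U) ?yes"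
      using dq[OF U] ind[OF U] by (intro integral_mono_AE) (auto simp: AE_measure_pmf_iff integrable_rej_avg)
    then show ?thesis by (simp add: integrable_rej_avg)
  qed
  then have "(\<Sum>U\<in>samples n u. a * measure_pmf.expectation (A U) ?no - b U) / card (samples n u)
      \<le> (\<Sum>U\<in>samples n u. measure_pmf.expectation (A U) ?yes) / card (samples n u)"
    by (intro divide_right_mono sum_mono) auto
  then have "a * measure_pmf.expectation D ?no - (\<Sum>U\<in>samples n u. b U) / card (samples n u) \<le> measure_pmf.expectation D ?yes"
    unfolding D_def expectation_bind_rej_avg[OF u I(1)] expectation_bind_rej_avg[OF u finite_bool_funs]
    by (simp add: sum_subtractf sum_distrib_left[symmetric] diff_divide_distrib)
  moreover have "a * (66 / 100) \<le> a * measure_pmf.expectation D ?no" using a no by (rule mult_left_mono[rotated])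
  ultimately show ?thesis using yes by linarith
qed

section \<open>Active testing: lower bound\<close>

lemma card_agreeing_functions:
  assumes "X \<subseteq> cube n"
  shows "card {f \<in> bool_funs n. \<forall>x\<in>X. f x = \<beta> x} = 2 ^ (2 ^ n - card X)"
proof -
  have fX: "finite X" using assms finite_subset by blast
  have "{f \<in> bool_funs n. \<forall>x\<in>X. f x = \<beta> x} = PiE (cube n) (\<lambda>x. if x \<in> X then {\<beta> x} else UNIV)"
    using assms by (auto simp: bool_funs_def PiE_def Pi_def extensional_def subset_iff)
  then have "card {f \<in> bool_funs n. \<forall>x\<in>X. f x = \<beta> x} = (\<Prod>x\<in>cube n. if x \<in> X then 1 else 2)"
    by (simp add: card_PiE if_distrib[of card] cong: if_cong)
  also have "\<dots> = 2 ^ card (cube n - X)" by (simp add: prod.If_cases Diff_eq)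
  finally show ?thesis using assms fX by (simp add: card_Diff_subset card_cube)
qed

definition dictator :: "nat \<Rightarrow> nat \<Rightarrow> (nat \<Rightarrow> bit) \<Rightarrow> bit" where
  "dictator n i = restrict (\<lambda>x. x i) (cube n)"

lemma dictator_SymF:
  assumes "1 \<le> k" "k \<le> n" "i < n"
  shows "dictator n i \<in> SymF n (n - k)"
proof (rule SymFI[OF assms(2), where J = "{i}"])
  show "class_const n {i} (dictator n i)" by (auto simp: class_const_def dictator_def cl_def)
qed (use assms in \<open>auto simp: dictator_def bool_funs_def\<close>)

text \<open>Read the points of \<open>X\<close> as rows of a matrix: its \<open>n\<close> columns
  are the answer patterns of the coordinate functions, and a given pattern is expected in
  \<open>n / 2 ^ card X\<close> columns. The condition concerns all small \<open>X\<close> at once,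
  since the tester picks its queries adaptively.\<close>

definition balanced :: "nat \<Rightarrow> nat \<Rightarrow> (nat \<Rightarrow> bit) set \<Rightarrow> bool" where
  "balanced n q U \<longleftrightarrow> (\<forall>X\<subseteq>U. \<forall>\<beta>. card X \<le> q \<longrightarrow>
     6 / 10 * real n / 2 ^ card X \<le> real (card {i \<in> {..<n}. \<forall>x\<in>X. x i = \<beta> x}))"

text \<open>Compares, leaf by leaf, a random coordinate function with a random function: by balance
  every leaf is reached with at least 6/10 of the uniform probability, and the rejecting leaves are
  summed. \<open>X\<close> and \<open>\<beta>\<close> record the queries and answers so far.\<close>

lemma balanced_paths:
  assumes bal: "balanced n q U" and U: "U \<subseteq> cube n" and n: "n > 0"
  shows "depth t + card X \<le> q \<Longrightarrow> queried t \<subseteq> U \<Longrightarrow> X \<subseteq> U \<Longrightarrow>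
    6 / 10 * real (card {f \<in> bool_funs n. (\<forall>x\<in>X. f x = \<beta> x) \<and> \<not> accepts t f}) / 2 ^ 2 ^ n
    \<le> real (card {i \<in> {..<n}. (\<forall>x\<in>X. x i = \<beta> x) \<and> \<not> accepts t (dictator n i)}) / n"
proof (induction t arbitrary: X \<beta>)
  case (Answer b)
  show ?case
  proof (cases b)
    case False
    have X: "X \<subseteq> cube n" using Answer U by blast
    have cX: "card X \<le> 2 ^ n" using card_mono[OF finite_cube X] by (simp add: card_cube)
    have "(2::real) ^ (2 ^ n - card X) * 2 ^ card X = 2 ^ 2 ^ n"
      unfolding power_add[symmetric] using cX by simp
    then have "(2::real) ^ (2 ^ n - card X) / 2 ^ 2 ^ n = 1 / 2 ^ card X" by (simp add: field_simps)
    then have "6 / 10 * real (card {f \<in> bool_funs n. \<forall>x\<in>X. f x = \<beta> x}) / 2 ^ 2 ^ n = 6 / 10 / 2 ^ card X"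
      unfolding card_agreeing_functions[OF X] by simp
    also have "\<dots> = 6 / 10 * real n / 2 ^ card X / n" using n by simp
    also have "\<dots> \<le> real (card {i \<in> {..<n}. \<forall>x\<in>X. x i = \<beta> x}) / n"
      using bal Answer unfolding balanced_def by (intro divide_right_mono) auto
    finally show ?thesis using False by simp
  qed simp
next
  case (Query x l r)
  have x: "x \<in> U" "x \<in> cube n" using Query.prems U by auto
  have dx: "dictator n i x = x i" for i using x by (simp add: dictator_def)
  have fX: "finite X" using Query.prems(3) U finite_subset finite_cube by metis
  have d: "depth l + Suc (card X) \<le> q" "depth r + Suc (card X) \<le> q" using Query.prems(1) by auto
  have ql: "queried l \<subseteq> U" "queried r \<subseteq> U" using Query.prems(2) by auto
  show ?case
  proof (cases "x \<in> X")
    case True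
    \<comment> \<open>The answer to a repeated query is already forced by \<open>\<beta>\<close>, so
      only one branch is alive and \<open>X\<close> does not grow.\<close>
    let ?t = "if \<beta> x = 0 then l else r"
    have "{f \<in> bool_funs n. (\<forall>y\<in>X. f y = \<beta> y) \<and> \<not> accepts (Query x l r) f} = {f \<in> bool_funs n. (\<forall>y\<in>X. f y = \<beta> y) \<and> \<not> accepts ?t f}"
      "{i \<in> {..<n}. (\<forall>y\<in>X. y i = \<beta> y) \<and> \<not> accepts (Query x l r) (dictator n i)} = {i \<in> {..<n}. (\<forall>y\<in>X. y i = \<beta> y) \<and> \<not> accepts ?t (dictator n i)}"
      using True by (auto simp: dx)
    then show ?thesis using Query.IH(1)[of X \<beta>] Query.IH(2)[of X \<beta>] d ql Query.prems(3) by auto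
  next
    case False
    let ?N = "\<lambda>t b. {f \<in> bool_funs n. (\<forall>y\<in>insert x X. f y = (\<beta>(x := b)) y) \<and> \<not> accepts t f}"
    let ?Y = "\<lambda>t b. {i \<in> {..<n}. (\<forall>y\<in>insert x X. y i = (\<beta>(x := b)) y) \<and> \<not> accepts t (dictator n i)}"
    have "{f \<in> bool_funs n. (\<forall>y\<in>X. f y = \<beta> y) \<and> \<not> accepts (Query x l r) f} = ?N l 0 \<union> ?N r 1"
      using False by auto
    moreover have "?N l 0 \<inter> ?N r 1 = {}" by auto
    ultimately have N: "card {f \<in> bool_funs n. (\<forall>y\<in>X. f y = \<beta> y) \<and> \<not> accepts (Query x l r) f} = card (?N l 0) + card (?N r 1)"
      by (simp add: card_Un_disjoint)
    have "{i \<in> {..<n}. (\<forall>y\<in>X. y i = \<beta> y) \<and> \<not> accepts (Query x l r) (dictator n i)} = ?Y l 0 \<union> ?Y r 1"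
      using False by (auto simp: dx)
    moreover have "?Y l 0 \<inter> ?Y r 1 = {}" by auto
    ultimately have Y: "card {i \<in> {..<n}. (\<forall>y\<in>X. y i = \<beta> y) \<and> \<not> accepts (Query x l r) (dictator n i)} = card (?Y l 0) + card (?Y r 1)"
      by (simp add: card_Un_disjoint)
    have "card (insert x X) = Suc (card X)" "insert x X \<subseteq> U" using False fX x Query.prems(3) by auto
    then have "6 / 10 * real (card (?N l 0)) / 2 ^ 2 ^ n \<le> real (card (?Y l 0)) / n"
      "6 / 10 * real (card (?N r 1)) / 2 ^ 2 ^ n \<le> real (card (?Y r 1)) / n"
    proof -
      assume c: "card (insert x X) = Suc (card X)" "insert x X \<subseteq> U"
      show "6 / 10 * real (card (?N l 0)) / 2 ^ 2 ^ n \<le> real (card (?Y l 0)) / n"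
        by (rule Query.IH(1)) (use c d ql in auto)
      show "6 / 10 * real (card (?N r 1)) / 2 ^ 2 ^ n \<le> real (card (?Y r 1)) / n"
        by (rule Query.IH(2)) (use c d ql in auto)
    qed
    then show ?thesis unfolding N Y by (simp add: add_divide_distrib distrib_left)
  qed
qed

section \<open>Random samples are balanced\<close>

lemma sum_count_pow:
  fixes c :: real
  assumes "Z \<subseteq> {..<n}"
  shows "(\<Sum>x\<in>cube n. c ^ card {i \<in> Z. x i = b}) = 2 ^ n * ((1 + c) / 2) ^ card Z"
proof -
  have fZ: "finite Z" using assms finite_subset by blast
  have cZ: "card Z \<le> n" using card_mono[OF _ assms] by simp
  have pw: "(2::real) ^ (n - card Z) * (1 + c) ^ card Z = 2 ^ n * ((1 + c) / 2) ^ card Z"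
  proof -
    have "(2::real) ^ n = 2 ^ (n - card Z) * 2 ^ card Z" using cZ by (simp flip: power_add)
    then show ?thesis by (simp add: power_divide)
  qed
  show ?thesis
  proof (cases "b = 1")
    case True
    have "(\<Sum>x\<in>cube n. c ^ wt Z x) = 2 ^ (n - card Z) * (\<Sum>j\<le>card Z. (card Z choose j) * c ^ j)"
      by (rule sum_wt[OF assms])
    also have "(\<Sum>j\<le>card Z. (card Z choose j) * c ^ j) = (1 + c) ^ card Z"
      using binomial_ring[of c 1 "card Z"] by (simp add: add.commute)
    finally show ?thesis using pw True by (simp add: wt_def)
  next
    case False
    then have b: "b = 0" by (metis bit_not_one_iff)
    have "card {i \<in> Z. x i = b} = card Z - wt Z x" for x
    proof -
      have "{i \<in> Z. x i = b} = Z - {i \<in> Z. x i = 1}" using b by auto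
      then show ?thesis using fZ by (simp add: wt_def card_Diff_subset)
    qed
    then have "(\<Sum>x\<in>cube n. c ^ card {i \<in> Z. x i = b}) = (\<Sum>x\<in>cube n. c ^ (card Z - wt Z x))" by simp
    also have "\<dots> = 2 ^ (n - card Z) * (\<Sum>j\<le>card Z. (card Z choose j) * c ^ (card Z - j))"
      by (rule sum_wt[OF assms])
    also have "(\<Sum>j\<le>card Z. (card Z choose j) * c ^ (card Z - j)) = (1 + c) ^ card Z"
      using binomial_ring[of 1 c "card Z"] by simp
    finally show ?thesis using pw by simp
  qed
qed

text \<open>Each further point keeps a random half of the columns still matching and turns the base
  \<open>c\<close> into \<open>(1 + c) / 2\<close>. Iterating from 1/2 gives
  \<open>1 - (1 / 2) ^ m / 2\<close>.\<close>

lemma column_mgf: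
  assumes "Z \<subseteq> {..<n}"
  shows "(\<Sum>xs\<in>input_lists n (length bs). (1 / 2 :: real) ^ card {i \<in> Z. list_all2 (\<lambda>x b. x i = b) xs bs})
    = (2 ^ n) ^ length bs * (1 - (1 / 2) ^ length bs / 2) ^ card Z"
  using assms
proof (induction bs arbitrary: Z)
  case Nil
  then show ?case by simp
next
  case (Cons b bs)
  let ?c = "1 - (1 / 2) ^ length bs / 2 :: real"
  have "(\<Sum>xs\<in>input_lists n (length (b # bs)). (1 / 2 :: real) ^ card {i \<in> Z. list_all2 (\<lambda>x b. x i = b) xs (b # bs)}) =
    (\<Sum>x\<in>cube n. \<Sum>xs\<in>input_lists n (length bs). (1 / 2) ^ card {i \<in> {i \<in> Z. x i = b}. list_all2 (\<lambda>x b. x i = b) xs bs})"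
    by (simp add: sum_input_lists_Suc conj_assoc)
  also have "\<dots> = (\<Sum>x\<in>cube n. (2 ^ n) ^ length bs * ?c ^ card {i \<in> Z. x i = b})"
    using Cons.prems by (intro sum.cong refl Cons.IH) auto
  also have "\<dots> = (2 ^ n) ^ length bs * (2 ^ n * ((1 + ?c) / 2) ^ card Z)"
    by (simp only: sum_distrib_left[symmetric] sum_count_pow[OF Cons.prems])
  also have "(1 + ?c) / 2 = 1 - (1 / 2) ^ length (b # bs) / 2" by simp
  finally show ?case by simp
qed

text \<open>Chernoff bound for the lower tail with base 1/2. From \<open>ln 2 \<le> 7 / 10\<close>
  the deviation costs \<open>6 / 10 * 7 / 10 = 42 / 100\<close> of the mean, against a gain of 1/2,
  which leaves 8/100.\<close>

lemma unbalanced_columns: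
  shows "real (card {xs \<in> input_lists n (length bs).
      real (card {i \<in> {..<n}. list_all2 (\<lambda>x b. x i = b) xs bs}) < 6 / 10 * real n / 2 ^ length bs})
    \<le> (2 ^ n) ^ length bs * exp (- (8 / 100 * real n / 2 ^ length bs))"
proof -
  define m where "m = length bs"
  define \<mu> where "\<mu> = real n / 2 ^ m"
  let ?c = "\<lambda>xs. card {i \<in> {..<n}. list_all2 (\<lambda>x b. x i = b) xs bs}"
  let ?B = "{xs \<in> input_lists n m. real (?c xs) < 6 / 10 * real n / 2 ^ m}"
  have "real (card ?B) = (\<Sum>xs\<in>?B. 1)" by simp
  also have "\<dots> \<le> (\<Sum>xs\<in>?B. (1 / 2) ^ ?c xs * exp (42 / 100 * \<mu>))"
  proof (rule sum_mono)
    fix xs assume "xs \<in> ?B"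
    then have c: "real (?c xs) \<le> 6 / 10 * \<mu>" by (simp add: \<mu>_def)
    have "exp (7 / 10 :: real) \<ge> 2"
    proof -
      have "ln (2::real) \<le> 7 / 10" using ln2_le_25_over_36 by simp
      then have "exp (ln 2) \<le> exp (7 / 10 :: real)" by (simp only: exp_le_cancel_iff)
      moreover have "exp (ln 2) = (2 :: real)" by simp
      ultimately show ?thesis by (simp only:)
    qed
    then have "2 ^ ?c xs \<le> exp (7 / 10 :: real) ^ ?c xs" by (intro power_mono) auto
    also have "\<dots> = exp (real (?c xs) * (7 / 10))" by (rule exp_of_nat_mult[symmetric])
    also have "\<dots> \<le> exp (42 / 100 * \<mu>)" using c by simp
    finally have "(1 / 2) ^ ?c xs * 2 ^ ?c xs \<le> (1 / 2) ^ ?c xs * exp (42 / 100 * \<mu>)" by (rule mult_left_mono) simp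
    then show "1 \<le> (1 / 2) ^ ?c xs * exp (42 / 100 * \<mu>)" by (simp add: power_mult_distrib[symmetric])
  qed
  also have "\<dots> \<le> (\<Sum>xs\<in>input_lists n m. (1 / 2) ^ ?c xs * exp (42 / 100 * \<mu>))"
    by (rule sum_mono2) auto
  also have "\<dots> = (2 ^ n) ^ m * (1 - (1 / 2) ^ m / 2) ^ n * exp (42 / 100 * \<mu>)"
    using column_mgf[of "{..<n}" n bs] by (simp add: sum_distrib_right[symmetric] m_def)
  also have "\<dots> \<le> (2 ^ n) ^ m * exp (- (\<mu> / 2)) * exp (42 / 100 * \<mu>)"
  proof (intro mult_right_mono mult_left_mono)
    have "(1 / 2 :: real) ^ m \<le> 1" by (simp add: power_le_one)
    then have "(1 - (1 / 2 :: real) ^ m / 2) ^ n \<le> exp (- ((1 / 2) ^ m / 2 * n))"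
      by (intro one_minus_power_le_exp) simp
    also have "\<dots> = exp (- (\<mu> / 2))"
      by (simp add: \<mu>_def power_divide)
    finally show "(1 - (1 / 2 :: real) ^ m / 2) ^ n \<le> exp (- (\<mu> / 2))" .
  qed auto
  also have "\<dots> = (2 ^ n) ^ m * exp (- (\<mu> / 2) + 42 / 100 * \<mu>)" by (simp only: exp_add mult.assoc)
  also have "- (\<mu> / 2) + 42 / 100 * \<mu> = - (8 / 100 * real n / 2 ^ m)" by (simp add: \<mu>_def)
  finally show ?thesis by (simp add: m_def)
qed

text \<open>Sampling without replacement: \<open>m\<close> given points are all chosen with
  probability the product of the factors \<open>(u - i) / (N - i)\<close>, each at most
  \<open>u / N\<close>.\<close>

lemma binomial_ratio:
  assumes "m \<le> u" "u \<le> N"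
  shows "N ^ m * (N - m choose (u - m)) \<le> u ^ m * (N choose u)"
  using assms(1)
proof (induction m)
  case (Suc m)
  let ?C = "N - m choose (u - m)" and ?D = "N - Suc m choose (u - Suc m)"
  have mN: "m < N" using Suc.prems assms(2) by simp
  have "(u - m) * ?C = (N - m) * (N - m - 1 choose (u - m - 1))"
    using Suc.prems by (intro times_binomial_minus1_eq) simp
  then have e: "(u - m) * ?C = (N - m) * ?D" by simp
  have "(N - m) * (N * ?D) = N * (u - m) * ?C" using e by simp
  also have "\<dots> \<le> u * (N - m) * ?C"
  proof (rule mult_le_mono1)
    have "u * m \<le> N * m" using assms(2) by simp
    then have "N * u - N * m \<le> u * N - u * m" by (simp only: mult.commute[of N u] diff_le_mono2)
    then show "N * (u - m) \<le> u * (N - m)" by (simp only: diff_mult_distrib2)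
  qed
  also have "\<dots> = (N - m) * (u * ?C)" by simp
  finally have "N * ?D \<le> u * ?C" using mN by simp
  then have "N ^ m * (N * ?D) \<le> N ^ m * (u * ?C)" by simp
  also have "\<dots> \<le> u * (u ^ m * (N choose u))" using Suc by simp
  finally show ?case by (simp add: mult_ac)
qed simp

lemma card_samples_superset:
  assumes "X \<subseteq> cube n" "u \<le> 2 ^ n"
  shows "real (card {U \<in> samples n u. X \<subseteq> U}) \<le> real (card (samples n u)) * (real u / 2 ^ n) ^ card X"
proof (cases "card X \<le> u")
  case True
  have fX: "finite X" using assms finite_subset by blast
  have "inj_on (\<lambda>U. U - X) {U \<in> samples n u. X \<subseteq> U}" by (rule inj_onI) blast
  then have "card {U \<in> samples n u. X \<subseteq> U} = card ((\<lambda>U. U - X) ` {U \<in> samples n u. X \<subseteq> U})" by (simp add: card_image)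
  also have "\<dots> \<le> card {W. W \<subseteq> cube n - X \<and> card W = u - card X}"
  proof (rule card_mono)
    show "finite {W. W \<subseteq> cube n - X \<and> card W = u - card X}"
      by (rule finite_subset[of _ "Pow (cube n)"]) auto
    show "(\<lambda>U. U - X) ` {U \<in> samples n u. X \<subseteq> U} \<subseteq> {W. W \<subseteq> cube n - X \<and> card W = u - card X}"
      using fX by (auto simp: samples_def card_Diff_subset)
  qed
  also have "\<dots> = (2 ^ n - card X choose (u - card X))"
    using assms fX by (simp add: n_subsets card_Diff_subset card_cube)
  finally have "(2 ^ n) ^ card X * card {U \<in> samples n u. X \<subseteq> U} \<le> u ^ card X * card (samples n u)"
    using binomial_ratio[OF True assms(2)] unfolding card_samples by (meson le_trans mult_le_mono2)
  then have "real ((2 ^ n) ^ card X * card {U \<in> samples n u. X \<subseteq> U}) \<le> real (u ^ card X * card (samples n u))"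
    by (rule of_nat_mono)
  then show ?thesis by (simp add: power_divide field_simps)
next
  case False
  have "\<not> X \<subseteq> U" if "U \<in> samples n u" for U
  proof
    assume "X \<subseteq> U"
    moreover have "finite U" "card U = u" using that by (auto simp: samples_def intro: finite_subset)
    ultimately show False using card_mono False by blast
  qed
  then have "{U \<in> samples n u. X \<subseteq> U} = {}" by blast
  then show ?thesis by (simp only: card.empty) simp
qed

text \<open>Union bound over patterns and point sets \<open>X\<close> of size \<open>m\<close>:
  \<open>2 ^ m\<close> patterns, \<open>(2 ^ n) ^ m\<close> lists enumerating \<open>X\<close>, and
  probability at most \<open>(u / 2 ^ n) ^ m\<close> that the sample contains \<open>X\<close>. The
  powers of \<open>2 ^ n\<close> cancel to \<open>(2 u) ^ m\<close>.\<close>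

lemma unbalanced_samples:
  assumes "u \<le> 2 ^ n"
  shows "real (card {U \<in> samples n u. \<not> balanced n q U}) \<le>
    real (card (samples n u)) * (\<Sum>m\<le>q. (2 * real u) ^ m * exp (- (8 / 100 * real n / 2 ^ m)))"
proof -
  let ?bad = "\<lambda>X. \<exists>\<beta>. real (card {i \<in> {..<n}. \<forall>x\<in>X. x i = \<beta> x}) < 6 / 10 * real n / 2 ^ card X"
  let ?X = "\<lambda>m. {X. X \<subseteq> cube n \<and> card X = m \<and> ?bad X}"
  have fX: "finite (?X m)" for m by (rule finite_subset[of _ "Pow (cube n)"]) auto
  have cX: "real (card (?X m)) \<le> 2 ^ m * ((2 ^ n) ^ m * exp (- (8 / 100 * real n / 2 ^ m)))" for m
  proof -
    let ?bs = "{bs :: bit list. set bs \<subseteq> UNIV \<and> length bs = m}"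
    let ?L = "\<lambda>bs. {xs \<in> input_lists n (length bs). real (card {i \<in> {..<n}. list_all2 (\<lambda>x b. x i = b) xs bs}) < 6 / 10 * real n / 2 ^ length bs}"
    have fb: "finite ?bs" by (rule finite_lists_length_eq) simp
    have "?X m \<subseteq> set ` (\<Union>bs\<in>?bs. ?L bs)"
    proof
      fix X assume "X \<in> ?X m"
      then obtain \<beta> where X: "X \<subseteq> cube n" "card X = m"
        and \<beta>: "real (card {i \<in> {..<n}. \<forall>x\<in>X. x i = \<beta> x}) < 6 / 10 * real n / 2 ^ card X" by auto
      have "finite X" using X(1) finite_subset by blast
      then obtain xs where xs: "set xs = X" "distinct xs" using finite_distinct_list by blast
      then have len: "length xs = m" using X(2) distinct_card by fastforce
      have "list_all2 (\<lambda>x b. x i = b) xs (map \<beta> xs) \<longleftrightarrow> (\<forall>x\<in>X. x i = \<beta> x)" for i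
        unfolding xs(1)[symmetric] by (induction xs) auto
      then have "xs \<in> ?L (map \<beta> xs)" using \<beta> xs len X by (simp add: input_lists_def)
      moreover have "map \<beta> xs \<in> ?bs" using len by simp
      ultimately show "X \<in> set ` (\<Union>bs\<in>?bs. ?L bs)"
        by (intro image_eqI[of _ _ xs]) (use xs(1) in simp, blast)
    qed
    then have "card (?X m) \<le> card (\<Union>bs\<in>?bs. ?L bs)"
      using fb by (intro surj_card_le) auto
    also have "\<dots> \<le> (\<Sum>bs\<in>?bs. card (?L bs))" by (rule card_UN_le[OF fb])
    finally have "real (card (?X m)) \<le> real (\<Sum>bs\<in>?bs. card (?L bs))" by (rule of_nat_mono)
    also have "\<dots> = (\<Sum>bs\<in>?bs. real (card (?L bs)))" by simp
    also have "\<dots> \<le> real (card ?bs) * ((2 ^ n) ^ m * exp (- (8 / 100 * real n / 2 ^ m)))"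
    proof (rule sum_bounded_above)
      fix bs :: "bit list" assume "bs \<in> ?bs"
      then show "real (card (?L bs)) \<le> (2 ^ n) ^ m * exp (- (8 / 100 * real n / 2 ^ m))"
        using unbalanced_columns[of n bs] by simp
    qed
    also have "card ?bs = 2 ^ m" using card_lists_length_eq[of "UNIV :: bit set" m] by simp
    finally show ?thesis by simp
  qed
  let ?S = "\<lambda>X. {U \<in> samples n u. X \<subseteq> U}"
  have "{U \<in> samples n u. \<not> balanced n q U} \<subseteq> (\<Union>m\<in>{..q}. \<Union>X\<in>?X m. ?S X)"
  proof
    fix U assume U: "U \<in> {U \<in> samples n u. \<not> balanced n q U}"
    then obtain X \<beta> where X: "X \<subseteq> U" "card X \<le> q" "\<not> 6 / 10 * real n / 2 ^ card X \<le> real (card {i \<in> {..<n}. \<forall>x\<in>X. x i = \<beta> x})"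
      unfolding balanced_def by auto
    then have "X \<in> ?X (card X)" using U by (auto simp: samples_def not_le)
    then show "U \<in> (\<Union>m\<in>{..q}. \<Union>X\<in>?X m. ?S X)" using X U by blast
  qed
  then have "card {U \<in> samples n u. \<not> balanced n q U} \<le> card (\<Union>m\<in>{..q}. \<Union>X\<in>?X m. ?S X)"
    using fX by (intro card_mono) (auto simp: finite_samples)
  also have "\<dots> \<le> (\<Sum>m\<le>q. card (\<Union>X\<in>?X m. ?S X))" by (rule card_UN_le) simp
  also have "\<dots> \<le> (\<Sum>m\<le>q. \<Sum>X\<in>?X m. card (?S X))" by (intro sum_mono card_UN_le fX)
  finally have "real (card {U \<in> samples n u. \<not> balanced n q U}) \<le> real (\<Sum>m\<le>q. \<Sum>X\<in>?X m. card (?S X))"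
    by (rule of_nat_mono)
  also have "\<dots> = (\<Sum>m\<le>q. \<Sum>X\<in>?X m. real (card (?S X)))" by simp
  also have "\<dots> \<le> (\<Sum>m\<le>q. real (card (samples n u)) * ((2 * real u) ^ m * exp (- (8 / 100 * real n / 2 ^ m))))"
  proof (rule sum_mono)
    fix m
    have "(\<Sum>X\<in>?X m. real (card (?S X))) \<le> real (card (?X m)) * (real (card (samples n u)) * (real u / 2 ^ n) ^ m)"
      using card_samples_superset[OF _ assms] by (intro sum_bounded_above) auto
    also have "\<dots> \<le> 2 ^ m * ((2 ^ n) ^ m * exp (- (8 / 100 * real n / 2 ^ m))) * (real (card (samples n u)) * (real u / 2 ^ n) ^ m)"
      by (rule mult_right_mono[OF cX]) simp
    also have "\<dots> = real (card (samples n u)) * ((2 * real u) ^ m * exp (- (8 / 100 * real n / 2 ^ m)))"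
      by (simp add: power_divide power_mult_distrib)
    finally show "(\<Sum>X\<in>?X m. real (card (?S X))) \<le> real (card (samples n u)) * ((2 * real u) ^ m * exp (- (8 / 100 * real n / 2 ^ m)))" .
  qed
  finally show ?thesis by (simp only: sum_distrib_left)
qed

text \<open>For \<open>m \<le> ln n / 2\<close> one has \<open>2 ^ m \<le> sqrt n\<close>, so the
  Chernoff term is at most \<open>exp (- 8 / 100 * sqrt n)\<close>. This beats
  \<open>(2 u) ^ m\<close>, which for polynomial \<open>u\<close> is only
  \<open>exp (O((ln n)^2))\<close>.\<close>

lemma active_lower:
  assumes k: "1 \<le> k" and \<epsilon>: "\<epsilon> \<le> 1 / 1000" and u: "poly_bounded u"
  shows "\<forall>\<^sub>F n in sequentially. \<forall>q. (\<exists>A. is_sample_tester n \<epsilon> (SymF n (n - k)) (u n) q A) \<longrightarrow> 1 / 2 * ln (real n) \<le> real q"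
proof -
  obtain d where d: "\<forall>\<^sub>F n in sequentially. u n \<le> n ^ d" using u by (auto simp: poly_bounded_def)
  define d' where "d' = real d + 1"
  have d': "d' > 0" by (simp add: d'_def)
  have ev: "\<forall>\<^sub>F n in sequentially. (ln (real n) + 1) * exp (ln (real n) * (1 + d' * ln (real n)) - 8 / 100 * sqrt (real n)) \<le> 1 / 100"
    using d' by real_asymp
  show ?thesis using ev d most_functions_far[OF \<epsilon>, of k] eventually_ge_at_top[of "k + 2"]
  proof eventually_elim
    case (elim n)
    note ev = elim(1) and un = elim(2) and far = elim(3) and nk = elim(4)
    show ?case
    proof (intro allI impI, rule ccontr)
    fix q
    assume "\<exists>A. is_sample_tester n \<epsilon> (SymF n (n - k)) (u n) q A"
      and "\<not> 1 / 2 * ln (real n) \<le> real q"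
    then obtain A where A: "is_sample_tester n \<epsilon> (SymF n (n - k)) (u n) q A" and q: "real q \<le> 1 / 2 * ln (real n)" by auto
    have n: "n \<ge> 2" "k \<le> n" "n > 0" using nk by auto
    have uN: "u n \<le> 2 ^ n" using A by (simp add: is_sample_tester_def)
    let ?S = "samples n (u n)" and ?I = "{..<n}"
    have cS: "real (card ?S) > 0" using uN by (simp add: card_samples)
    have ln0: "0 \<le> ln (real n)" using n by simp
    let ?E = "exp (ln (real n) * (1 + d' * ln (real n)) - 8 / 100 * sqrt (real n))"
    have sq: "exp (1 / 2 * ln (real n)) = sqrt (real n)"
      using n by (simp add: powr_half_sqrt[symmetric] powr_def)
    have "(\<Sum>m\<le>q. (2 * real (u n)) ^ m * exp (- (8 / 100 * real n / 2 ^ m))) \<le> (\<Sum>m\<le>q. ?E)"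
    proof (rule sum_mono)
      fix m assume "m \<in> {..q}"
      then have m: "real m \<le> 1 / 2 * ln (real n)" using q by simp
      have "2 * real (u n) \<le> exp (1 + d' * ln (real n))"
      proof -
        have "real (u n) \<le> real (n ^ d)" using un by (rule of_nat_mono)
        also have "\<dots> = exp (real d * ln (real n))" using n by (simp add: exp_of_nat_mult)
        finally have "2 * real (u n) \<le> exp 1 * exp (real d * ln (real n))"
          using exp_ge_add_one_self[of 1] by (intro mult_mono) auto
        also have "\<dots> \<le> exp (1 + d' * ln (real n))"
          using ln0 by (simp add: exp_add[symmetric] d'_def algebra_simps)
        finally show ?thesis .
      qed
      then have "(2 * real (u n)) ^ m \<le> exp (1 + d' * ln (real n)) ^ m" by (intro power_mono) auto
      also have "\<dots> = exp (real m * (1 + d' * ln (real n)))" by (rule exp_of_nat_mult[symmetric])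
      also have "\<dots> \<le> exp (ln (real n) * (1 + d' * ln (real n)))"
      proof -
        have "real m * (1 + d' * ln (real n)) \<le> ln (real n) * (1 + d' * ln (real n))"
          using m ln0 d' by (intro mult_right_mono) auto
        then show ?thesis by simp
      qed
      finally have 1: "(2 * real (u n)) ^ m \<le> exp (ln (real n) * (1 + d' * ln (real n)))" .
      have "2 ^ m \<le> sqrt (real n)" using two_power_le_exp[of m] m sq by (smt (verit) exp_le_cancel_iff)
      then have "sqrt (real n) * 2 ^ m \<le> sqrt (real n) * sqrt (real n)" by (intro mult_left_mono) auto
      then have "sqrt (real n) \<le> real n / 2 ^ m" by (simp add: field_simps)
      then have 2: "exp (- (8 / 100 * real n / 2 ^ m)) \<le> exp (- (8 / 100 * sqrt (real n)))" by simp
      have "(2 * real (u n)) ^ m * exp (- (8 / 100 * real n / 2 ^ m)) \<le>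
         exp (ln (real n) * (1 + d' * ln (real n))) * exp (- (8 / 100 * sqrt (real n)))"
        using 1 2 by (intro mult_mono) auto
      then show "(2 * real (u n)) ^ m * exp (- (8 / 100 * real n / 2 ^ m)) \<le> ?E"
        by (simp add: exp_add[symmetric])
    qed
    also have "\<dots> = (real q + 1) * ?E" by simp
    also have "\<dots> \<le> (ln (real n) + 1) * ?E" using q ln0 by (intro mult_right_mono) auto
    also have "\<dots> \<le> 1 / 100" by (rule ev)
    finally have small: "(\<Sum>m\<le>q. (2 * real (u n)) ^ m * exp (- (8 / 100 * real n / 2 ^ m))) \<le> 1 / 100" .
    \<comment> \<open>The left side is 0.396, the right side at most
      \<open>1 / 3 + 6 / 1000\<close>.\<close>
    have "6 / 10 * (66 / 100) \<le> 1 / 3 + (\<Sum>U\<in>?S. 6 / 10 * of_bool (\<not> balanced n q U)) / card ?S"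
    proof (rule sample_tester_lower_bound[OF A, where F = "dictator n" and I = ?I])
      show "dictator n i \<in> SymF n (n - k)" if "i \<in> ?I" for i using dictator_SymF[OF k n(2)] that by simp
      show "?I \<noteq> {}" using n by (simp add: lessThan_empty_iff)
      fix U t assume U: "U \<in> ?S" and t: "depth t \<le> q" "queried t \<subseteq> U"
      show "6 / 10 * rej_avg (bool_funs n) (\<lambda>f. f) t - 6 / 10 * of_bool (\<not> balanced n q U) \<le> rej_avg ?I (dictator n) t"
      proof (cases "balanced n q U")
        case True
        have "U \<subseteq> cube n" using U by (simp add: samples_def)
        from balanced_paths[OF True this n(3), of t "{}"] t
        have "6 / 10 * real (card {f \<in> bool_funs n. \<not> accepts t f}) / 2 ^ 2 ^ n \<le> real (card {i \<in> {..<n}. \<not> accepts t (dictator n i)}) / n"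
          by simp
        then show ?thesis using True
          by (simp add: rej_avg_def real_card_Collect_eq_sum[symmetric] card_bool_funs del: sum_of_bool_eq)
      next
        case False
        then show ?thesis using rej_avg_bounds(2)[of "bool_funs n" "\<lambda>f. f" t] rej_avg_bounds(1)[of ?I "dictator n" t] by simp
      qed
    qed (use far in auto)
    also have "(\<Sum>U\<in>?S. 6 / 10 * of_bool (\<not> balanced n q U)) = 6 / 10 * real (card {U \<in> ?S. \<not> balanced n q U})"
      by (simp only: sum_distrib_left[symmetric] real_card_Collect_eq_sum[OF finite_samples])
    also have "6 / 10 * real (card {U \<in> ?S. \<not> balanced n q U}) / card ?S \<le> 6 / 10 * (1 / 100)"
    proof -
      have "real (card {U \<in> ?S. \<not> balanced n q U}) \<le> real (card ?S) * (1 / 100)"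
        using unbalanced_samples[OF uN, of q] mult_left_mono[OF small, of "real (card ?S)"] by linarith
      then show ?thesis using cS by (simp add: field_simps)
    qed
    finally show False by simp
    qed
  qed
qed

section \<open>Passive testing: lower bound\<close>

text \<open>The character \<open>(-1) ^ b\<close>: it turns addition of bits into multiplication and
  makes the indicator of agreement a polynomial.\<close>

definition sg :: "bit \<Rightarrow> real" where
  "sg b = (if b = 0 then 1 else -1)"

lemma sg_add: "sg (a + b) = sg a * sg b"
  by (cases a; cases b) (auto simp: sg_def)

lemma sg_sq [simp]: "sg a * sg a = 1"
  by (simp add: sg_def)

lemma of_bool_eq_sg: "of_bool (a = b) = (1 + sg a * sg b) / 2"
  by (cases a; cases b) (auto simp: sg_def)

lemma sum_sg:
  assumes "finite Z"
  shows "(\<Sum>i\<in>Z. sg (x i)) = real (card Z) - 2 * real (wt Z x)"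
proof -
  have "sg (x i) = 1 - 2 * of_bool (x i = 1)" for i by (cases "x i") (auto simp: sg_def)
  then have "(\<Sum>i\<in>Z. sg (x i)) = real (card Z) - 2 * (\<Sum>i\<in>Z. of_bool (x i = 1))"
    by (simp only: sum_subtractf sum_distrib_left[symmetric]) simp
  also have "(\<Sum>i\<in>Z. of_bool (x i = 1)) = real (wt Z x)"
    by (simp only: wt_def real_card_Collect_eq_sum[OF assms])
  finally show ?thesis .
qed

text \<open>Up to the factor \<open>2 ^ n\<close>, the correlation of the layer function
  \<open>h\<close> with the parity \<open>x i + x j\<close>.\<close>

definition corr :: "nat \<Rightarrow> (nat \<Rightarrow> bit) \<Rightarrow> nat \<Rightarrow> nat \<Rightarrow> real" where
  "corr n h i j = (\<Sum>x\<in>cube n. sg (h (wt {..<n} x)) * (sg (x i) * sg (x j)))"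

lemma corr_commute: "corr n h i j = corr n h j i"
  by (simp add: corr_def mult.commute)

text \<open>Transposing \<open>j\<close> and \<open>b\<close> maps the cube to itself and preserves
  the weight. Repeated use shows that all pairs of distinct coordinates have the same correlation
  (\<open>corr_const\<close>).\<close>

lemma corr_swap:
  assumes "j < n" "b < n" "i \<noteq> j" "i \<noteq> b"
  shows "corr n h i j = corr n h i b"
proof -
  define \<pi> where "\<pi> = Transposition.transpose j b"
  have p: "\<pi> permutes {..<n}" unfolding \<pi>_def using assms by (intro permutes_swap_id) auto
  have pp: "\<pi> (\<pi> a) = a" for a by (simp add: \<pi>_def)
  have c: "x \<circ> \<pi> \<in> cube n" if "x \<in> cube n" for x
    using that p by (auto simp: cube_def PiE_def extensional_def permutes_in_image permutes_not_in)
  have w: "wt {..<n} (x \<circ> \<pi>) = wt {..<n} x" for x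
  proof -
    have "bij_betw \<pi> {i \<in> {..<n}. (x \<circ> \<pi>) i = 1} {i \<in> {..<n}. x i = 1}"
    proof -
      have pn: "\<pi> a < n \<longleftrightarrow> a < n" for a using permutes_in_image[OF p, of a] by simp
      show ?thesis
      proof (rule bij_betw_byWitness[where f' = \<pi>])
        show "\<pi> ` {i \<in> {..<n}. (x \<circ> \<pi>) i = 1} \<subseteq> {i \<in> {..<n}. x i = 1}"
          by (simp add: image_subset_iff pn)
        show "\<pi> ` {i \<in> {..<n}. x i = 1} \<subseteq> {i \<in> {..<n}. (x \<circ> \<pi>) i = 1}"
          by (simp add: image_subset_iff pn pp)
      qed (simp_all only: pp Ball_def simp_thms)
    qed
    then show ?thesis unfolding wt_def by (rule bij_betw_same_card)
  qed
  have ij: "\<pi> i = i" "\<pi> j = b" "\<pi> b = j" using assms by (auto simp: \<pi>_def)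
  have cc: "x \<circ> \<pi> \<circ> \<pi> = x" for x :: "nat \<Rightarrow> bit" by (auto simp: fun_eq_iff pp)
  show ?thesis unfolding corr_def
    by (rule sum.reindex_bij_witness[where i = "\<lambda>x. x \<circ> \<pi>" and j = "\<lambda>x. x \<circ> \<pi>"]) (auto simp: c cc w ij)
qed

lemma corr_const:
  assumes "i < n" "j < n" "i \<noteq> j" "a < n" "b < n" "a \<noteq> b"
  shows "corr n h a b = corr n h i j"
proof (cases "b = i")
  case False
  have "corr n h i j = corr n h i b" using assms False by (intro corr_swap) auto
  also have "\<dots> = corr n h b i" by (rule corr_commute)
  also have "\<dots> = corr n h b a" using assms False by (intro corr_swap) auto
  finally show ?thesis by (simp add: corr_commute)
next
  case True
  have "corr n h i j = corr n h i a" using assms True by (intro corr_swap) auto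
  then show ?thesis using True by (simp add: corr_commute)
qed

text \<open>Conditioned on the weight, the parity of two coordinates is almost unbiased: summing over all
  pairs of coordinates turns the correlation into the variance of the weight.\<close>

lemma corr_le:
  assumes ij: "i < n" "j < n" "i \<noteq> j"
  shows "corr n h i j \<le> 2 * 2 ^ n / (real n - 1)"
proof -
  have n: "n \<ge> 2" using ij by linarith
  let ?D = "\<lambda>x. real n - 2 * real (wt {..<n} x)"
  have "real n * (real n - 1) * corr n h i j = (\<Sum>a<n. \<Sum>b\<in>{..<n} - {a}. corr n h i j)"
    using n by (simp add: of_nat_diff)
  also have "\<dots> = (\<Sum>a<n. \<Sum>b\<in>{..<n} - {a}. corr n h a b)"
    using corr_const[OF ij] by (intro sum.cong) auto
  also have "\<dots> = (\<Sum>a<n. (\<Sum>b<n. corr n h a b) - corr n h a a)"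
    by (intro sum.cong) (auto simp: sum_diff1)
  also have "\<dots> = (\<Sum>a<n. \<Sum>b<n. corr n h a b) - (\<Sum>a<n. corr n h a a)"
    by (rule sum_subtractf)
  also have "(\<Sum>a<n. corr n h a a) = (\<Sum>x\<in>cube n. real n * sg (h (wt {..<n} x)))"
    by (simp add: corr_def sum_distrib_left)
  also have "(\<Sum>a<n. \<Sum>b<n. corr n h a b) = (\<Sum>x\<in>cube n. sg (h (wt {..<n} x)) * (?D x)\<^sup>2)"
  proof -
    have "(\<Sum>a<n. \<Sum>b<n. corr n h a b) = (\<Sum>x\<in>cube n. \<Sum>a<n. \<Sum>b<n. sg (h (wt {..<n} x)) * (sg (x a) * sg (x b)))"
      unfolding corr_def by (subst sum.swap[of _ "cube n"]) (simp add: sum.swap[of _ _ "cube n"])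
    also have "\<dots> = (\<Sum>x\<in>cube n. sg (h (wt {..<n} x)) * (\<Sum>a<n. sg (x a))\<^sup>2)"
      by (intro sum.cong refl, subst power2_eq_square, subst sum_product) (simp only: sum_distrib_left)
    finally show ?thesis by (simp add: sum_sg)
  qed
  also have "(\<Sum>x\<in>cube n. sg (h (wt {..<n} x)) * (?D x)\<^sup>2) - (\<Sum>x\<in>cube n. real n * sg (h (wt {..<n} x)))
     \<le> (\<Sum>x\<in>cube n. (?D x)\<^sup>2 + real n)"
  proof -
    have "sg c * d - real n * sg c \<le> d + real n" if "0 \<le> d" for c d
      using that by (auto simp: sg_def)
    then show ?thesis unfolding sum_subtractf[symmetric] by (intro sum_mono) auto
  qed
  also have "\<dots> = real n * (2 * 2 ^ n)"
    using sum_signs_sq[of "{..<n}" n] by (simp add: sum.distrib card_cube)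
  finally have "real n * ((real n - 1) * corr n h i j) \<le> real n * (2 * 2 ^ n)" by (simp add: mult.assoc)
  then have "(real n - 1) * corr n h i j \<le> 2 * 2 ^ n" using n by simp
  then show ?thesis using n by (simp add: field_simps)
qed

text \<open>Knowing the layer hardly helps to predict the parity of two coordinates. Over
  \<open>q\<close> independent points the advantage multiplies to
  \<open>(1 + 2 / (n - 1)) ^ q\<close>, which is near 1 for \<open>q\<close> much smaller than
  \<open>n\<close>.\<close>

lemma agree_count:
  assumes ij: "i < n" "j < n" "i \<noteq> j"
  shows "2 * real (card {x \<in> cube n. h (wt {..<n} x) = x i + x j}) \<le> 2 ^ n * (1 + 2 / (real n - 1))"
proof -
  have "2 * real (card {x \<in> cube n. h (wt {..<n} x) = x i + x j}) = (\<Sum>x\<in>cube n. 1 + sg (h (wt {..<n} x)) * (sg (x i) * sg (x j)))"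
    unfolding real_card_Collect_eq_sum[OF finite_cube] sum_distrib_left
    by (intro sum.cong refl) (simp only: of_bool_eq_sg sg_add, simp)
  also have "\<dots> = 2 ^ n + corr n h i j" by (simp add: sum.distrib card_cube corr_def)
  also have "\<dots> \<le> 2 ^ n * (1 + 2 / (real n - 1))" using corr_le[OF ij, of h] by (simp add: distrib_left mult.commute)
  finally show ?thesis .
qed

section \<open>Planted functions \<open>g |x| + x i\<close> and their likelihood ratio\<close>

definition shifted :: "nat \<Rightarrow> (nat \<Rightarrow> bit) \<times> nat \<Rightarrow> (nat \<Rightarrow> bit) \<Rightarrow> bit" where
  "shifted n p = restrict (\<lambda>x. fst p (wt {..<n} x) + x (snd p)) (cube n)"

definition profiles :: "nat \<Rightarrow> (nat \<Rightarrow> bit) set" where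
  "profiles n = {..n} \<rightarrow>\<^sub>E UNIV"

lemma finite_profiles [simp, intro]: "finite (profiles n)"
  by (simp add: profiles_def finite_PiE)

lemma card_profiles: "card (profiles n) = 2 ^ (n + 1)"
  by (simp add: profiles_def card_PiE)

lemma shifted_SymF:
  assumes "1 \<le> k" "k \<le> n" "snd p < n"
  shows "shifted n p \<in> SymF n (n - k)"
proof (rule SymFI[OF assms(2), where J = "{snd p}"])
  show "class_const n {snd p} (shifted n p)" by (auto simp: class_const_def shifted_def cl_def)
qed (use assms in \<open>auto simp: shifted_def bool_funs_def\<close>)

lemma accepts_cong: "(\<And>x. x \<in> queried t \<Longrightarrow> f x = g x) \<Longrightarrow> accepts t f = accepts t g"
  by (induction t) auto

text \<open>The factor \<open>2 ^ card U\<close> compares the probability that two independent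
  planted functions agree on \<open>U\<close> with that for two uniformly random functions.\<close>

definition overlap :: "nat \<Rightarrow> ((nat \<Rightarrow> bit) \<times> nat) set \<Rightarrow> (nat \<Rightarrow> bit) set \<Rightarrow> real" where
  "overlap n I U = (\<Sum>p\<in>I. \<Sum>p'\<in>I. 2 ^ card U * of_bool (\<forall>x\<in>U. shifted n p x = shifted n p' x)) / (real (card I))\<^sup>2"

text \<open>Second moment method: \<open>L f\<close> below is the likelihood ratio on the sample of the planted against
  the uniform distribution, and \<open>overlap\<close> is its second moment.\<close>

lemma second_moment:
  assumes I: "finite I" "I \<noteq> {}" and U: "U \<subseteq> cube n" and t: "queried t \<subseteq> U" and \<theta>: "\<theta> > 0"
  shows "rej_avg (bool_funs n) (\<lambda>f. f) t - rej_avg I (shifted n) t \<le> \<theta> / 2 + (overlap n I U - 1) / (2 * \<theta>)"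
proof -
  let ?B = "bool_funs n" and ?q = "card U"
  let ?ag = "\<lambda>f p. \<forall>x\<in>U. f x = shifted n p x"
  define L where "L = (\<lambda>f. (\<Sum>p\<in>I. 2 ^ ?q * of_bool (?ag f p)) / real (card I))"
  have cI: "real (card I) > 0" using I by (simp add: card_gt_0_iff)
  have cB: "real (card ?B) > 0" by (simp add: card_gt_0_iff)
  have qN: "?q \<le> 2 ^ n" using card_mono[OF finite_cube U] by (simp add: card_cube)
  have agc: "2 ^ ?q * (\<Sum>f\<in>?B. of_bool (?ag f p)) = real (card ?B)" for p
  proof -
    have "(\<Sum>f\<in>?B. of_bool (?ag f p)) = real (2 ^ (2 ^ n - ?q))"
      by (simp only: real_card_Collect_eq_sum[OF finite_bool_funs, symmetric] card_agreeing_functions[OF U])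
    then have "2 ^ ?q * (\<Sum>f\<in>?B. of_bool (?ag f p)) = (2::real) ^ (?q + (2 ^ n - ?q))"
      by (simp only: power_add) simp
    then show ?thesis using qN by (simp add: card_bool_funs)
  qed
  \<comment> \<open>Change of measure: weighting uniform functions by \<open>L\<close> gives the
    planted average of every quantity \<open>r\<close> that depends only on the values on
    \<open>U\<close>.\<close>
  have L1: "(\<Sum>f\<in>?B. L f * r f) = real (card ?B) * ((\<Sum>p\<in>I. r (shifted n p)) / real (card I))"
    if r: "\<And>f g. (\<And>x. x \<in> U \<Longrightarrow> f x = g x) \<Longrightarrow> r f = r g" for r :: "((nat \<Rightarrow> bit) \<Rightarrow> bit) \<Rightarrow> real"
  proof -
    have "(\<Sum>f\<in>?B. L f * r f) = (\<Sum>f\<in>?B. \<Sum>p\<in>I. 2 ^ ?q * of_bool (?ag f p) * r f) / real (card I)"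
      by (simp only: L_def sum_divide_distrib sum_distrib_right times_divide_eq_left)
    also have "(\<Sum>f\<in>?B. \<Sum>p\<in>I. 2 ^ ?q * of_bool (?ag f p) * r f) = (\<Sum>p\<in>I. \<Sum>f\<in>?B. 2 ^ ?q * of_bool (?ag f p) * r f)"
      by (rule sum.swap)
    also have "\<dots> = (\<Sum>p\<in>I. 2 ^ ?q * (\<Sum>f\<in>?B. of_bool (?ag f p)) * r (shifted n p))"
      unfolding sum_distrib_left sum_distrib_right
    proof (intro sum.cong refl)
      fix p f
      show "2 ^ ?q * of_bool (?ag f p) * r f = 2 ^ ?q * of_bool (?ag f p) * r (shifted n p)"
      proof (cases "?ag f p")
        case True
        then have "r f = r (shifted n p)" by (intro r) auto
        then show ?thesis by simp
      qed simp
    qed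
    also have "\<dots> = real (card ?B) * (\<Sum>p\<in>I. r (shifted n p))" unfolding agc by (rule sum_distrib_left[symmetric])
    finally show ?thesis by simp
  qed
  have mean: "(\<Sum>f\<in>?B. L f) = real (card ?B)"
    using L1[of "\<lambda>_. 1"] cI by simp
  have sq: "(\<Sum>f\<in>?B. L f * L f) = real (card ?B) * overlap n I U"
  proof -
    have "(\<Sum>f\<in>?B. L f * L f) = real (card ?B) * ((\<Sum>p\<in>I. L (shifted n p)) / real (card I))"
      by (rule L1) (simp add: L_def)
    also have "(\<Sum>p\<in>I. L (shifted n p)) / real (card I) = overlap n I U"
      by (simp only: L_def overlap_def sum_divide_distrib[symmetric] power2_eq_square divide_divide_eq_left)
    finally show ?thesis .
  qed
  let ?r = "\<lambda>f. of_bool (\<not> accepts t f) :: real"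
  have yes: "(\<Sum>f\<in>?B. L f * ?r f) = real (card ?B) * rej_avg I (shifted n) t"
    unfolding rej_avg_def
  proof (rule L1)
    fix f g :: "(nat \<Rightarrow> bit) \<Rightarrow> bit" assume "\<And>x. x \<in> U \<Longrightarrow> f x = g x"
    then show "?r f = ?r g" using t accepts_cong[of t f g] by auto
  qed
  have no: "(\<Sum>f\<in>?B. ?r f) = real (card ?B) * rej_avg ?B (\<lambda>f. f) t"
    using cB by (simp add: rej_avg_def)
  \<comment> \<open>Pointwise substitute for Cauchy-Schwarz, with \<open>\<theta>\<close> balancing
    the two terms. For \<open>s = 0\<close> it says that the right side is nonnegative.\<close>
  have pt: "(1 - l) * s \<le> \<theta> / 2 + (1 - 2 * l + l * l) / (2 * \<theta>)" if "s = 0 \<or> s = 1" for l s :: real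
  proof -
    have "0 \<le> (\<theta> - (1 - l))\<^sup>2" by simp
    then have 1: "2 * \<theta> * (1 - l) \<le> \<theta> * \<theta> + (1 - 2 * l + l * l)"
      by (simp add: power2_eq_square algebra_simps)
    have "0 \<le> (1 - l)\<^sup>2" by simp
    then have "0 \<le> 1 - 2 * l + l * l" by (simp add: power2_eq_square algebra_simps)
    moreover have "0 \<le> \<theta> * \<theta>" by simp
    ultimately have 2: "0 \<le> \<theta> * \<theta> + (1 - 2 * l + l * l)" by linarith
    from 1 2 have "2 * \<theta> * ((1 - l) * s) \<le> \<theta> * \<theta> + (1 - 2 * l + l * l)" using that by auto
    then show ?thesis using \<theta> by (simp add: field_simps)
  qed
  have "real (card ?B) * (rej_avg ?B (\<lambda>f. f) t - rej_avg I (shifted n) t) = (\<Sum>f\<in>?B. (1 - L f) * ?r f)"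
    unfolding right_diff_distrib yes[symmetric] no[symmetric] sum_subtractf[symmetric] by (simp add: left_diff_distrib)
  also have "\<dots> \<le> (\<Sum>f\<in>?B. \<theta> / 2 + (1 - 2 * L f + L f * L f) / (2 * \<theta>))"
    by (intro sum_mono pt) auto
  also have "\<dots> = real (card ?B) * (\<theta> / 2) + (real (card ?B) - 2 * (\<Sum>f\<in>?B. L f) + (\<Sum>f\<in>?B. L f * L f)) / (2 * \<theta>)"
    by (simp add: sum.distrib sum_divide_distrib[symmetric] sum_subtractf sum_distrib_left[symmetric])
  also have "\<dots> = real (card ?B) * (\<theta> / 2 + (overlap n I U - 1) / (2 * \<theta>))"
    unfolding mean sq using \<theta> by (simp add: field_simps)
  finally show ?thesis using cB by simp
qed

text \<open>Adding bits, \<open>g |x| + x i = g' |x| + x j\<close> iff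
  \<open>(g + g') |x| = x i + x j\<close>. For fixed \<open>g'\<close> the sum
  \<open>h = g + g'\<close> runs through all profiles once, so one of the two profiles drops
  out.\<close>

lemma overlap_profiles:
  assumes n: "n > 0" and U: "U \<subseteq> cube n"
  shows "overlap n (profiles n \<times> {..<n}) U =
    (\<Sum>i<n. \<Sum>j<n. \<Sum>h\<in>profiles n. 2 ^ card U * of_bool (\<forall>x\<in>U. h (wt {..<n} x) = x i + x j)) / ((real n)\<^sup>2 * 2 ^ (n + 1))"
proof -
  let ?G = "profiles n"
  let ?a = "\<lambda>i j h. 2 ^ card U * of_bool (\<forall>x\<in>U. h (wt {..<n} x) = x i + x j) :: real"
  let ?b = "\<lambda>g i g' j. 2 ^ card U * of_bool (\<forall>x\<in>U. shifted n (g, i) x = shifted n (g', j) x) :: real"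
  have bit: "a + c = b + d \<longleftrightarrow> a + b = c + d" for a b c d :: bit
    by (cases a; cases b; cases c; cases d) auto
  have one: "(\<Sum>g\<in>?G. ?b g i g' j) = (\<Sum>h\<in>?G. ?a i j h)" if g': "g' \<in> ?G" for g' i j
  proof (rule sum.reindex_bij_witness[where i = "\<lambda>h. restrict (\<lambda>w. h w + g' w) {..n}" and j = "\<lambda>g. restrict (\<lambda>w. g w + g' w) {..n}"])
    fix g assume g: "g \<in> ?G"
    show "restrict (\<lambda>w. restrict (\<lambda>w. g w + g' w) {..n} w + g' w) {..n} = g"
      using g by (auto simp: profiles_def fun_eq_iff PiE_def extensional_def add.assoc)
    show "restrict (\<lambda>w. restrict (\<lambda>w. g w + g' w) {..n} w + g' w) {..n} = g"
      using g by (auto simp: profiles_def fun_eq_iff PiE_def extensional_def add.assoc)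
    show "restrict (\<lambda>w. g w + g' w) {..n} \<in> ?G" by (simp add: profiles_def)
    show "restrict (\<lambda>w. g w + g' w) {..n} \<in> ?G" by (simp add: profiles_def)
    have "restrict (\<lambda>w. g w + g' w) {..n} (wt {..<n} x) = x i + x j \<longleftrightarrow> shifted n (g, i) x = shifted n (g', j) x"
      if "x \<in> U" for x
      using that U wt_le_n[of n x] bit by (auto simp: shifted_def)
    then show "?a i j (restrict (\<lambda>w. g w + g' w) {..n}) = ?b g i g' j" by auto
  qed
  have "(\<Sum>p\<in>?G \<times> {..<n}. \<Sum>p'\<in>?G \<times> {..<n}. 2 ^ card U * of_bool (\<forall>x\<in>U. shifted n p x = shifted n p' x)) =
     (\<Sum>g\<in>?G. \<Sum>i<n. \<Sum>g'\<in>?G. \<Sum>j<n. ?b g i g' j)"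
  proof -
    have "(\<Sum>p\<in>?G \<times> {..<n}. \<phi> p) = (\<Sum>g\<in>?G. \<Sum>i<n. \<phi> (g, i))" for \<phi> :: "(nat \<Rightarrow> bit) \<times> nat \<Rightarrow> real"
      by (simp add: sum.cartesian_product split_def)
    then show ?thesis by (simp only:)
  qed
  also have "\<dots> = (\<Sum>i<n. \<Sum>g\<in>?G. \<Sum>g'\<in>?G. \<Sum>j<n. ?b g i g' j)" by (rule sum.swap)
  also have "\<dots> = (\<Sum>i<n. \<Sum>g'\<in>?G. \<Sum>g\<in>?G. \<Sum>j<n. ?b g i g' j)" by (intro sum.cong refl sum.swap)
  also have "\<dots> = (\<Sum>i<n. \<Sum>g'\<in>?G. \<Sum>j<n. \<Sum>g\<in>?G. ?b g i g' j)" by (intro sum.cong refl sum.swap)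
  also have "\<dots> = (\<Sum>i<n. \<Sum>g'\<in>?G. \<Sum>j<n. \<Sum>h\<in>?G. ?a i j h)" by (intro sum.cong refl one)
  also have "\<dots> = 2 ^ (n + 1) * (\<Sum>i<n. \<Sum>j<n. \<Sum>h\<in>?G. ?a i j h)"
    by (simp only: sum_constant card_profiles sum_distrib_left[symmetric]) simp
  finally have "overlap n (?G \<times> {..<n}) U = 2 ^ (n + 1) * (\<Sum>i<n. \<Sum>j<n. \<Sum>h\<in>?G. ?a i j h) / (2 ^ (n + 1) * real n)\<^sup>2"
    by (simp only: overlap_def card_cartesian_product card_profiles card_lessThan) simp
  also have "\<dots> = (\<Sum>i<n. \<Sum>j<n. \<Sum>h\<in>?G. ?a i j h) / ((real n)\<^sup>2 * 2 ^ (n + 1))"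
    by (simp add: power2_eq_square)
  finally show ?thesis .
qed

text \<open>2 to the power of the number of points of \<open>U\<close> beyond the first in their
  layer; up to normalisation, the contribution of \<open>i = j\<close> to
  \<open>overlap\<close>.\<close>

definition excess :: "nat \<Rightarrow> (nat \<Rightarrow> bit) set \<Rightarrow> real" where
  "excess n U = 2 ^ card U / 2 ^ card (wt {..<n} ` U)"

lemma profiles_vanishing:
  assumes "W \<subseteq> {..n}"
  shows "card {h \<in> profiles n. \<forall>w\<in>W. h w = 0} = 2 ^ (n + 1 - card W)"
proof -
  have fW: "finite W" using assms finite_subset by blast
  have "{h \<in> profiles n. \<forall>w\<in>W. h w = 0} = PiE {..n} (\<lambda>w. if w \<in> W then {0} else UNIV)"
    using assms by (auto simp: profiles_def PiE_def Pi_def extensional_def subset_iff split: if_splits)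
  then have "card {h \<in> profiles n. \<forall>w\<in>W. h w = 0} = (\<Prod>w\<in>{..n}. if w \<in> W then 1 else 2)"
    by (simp add: card_PiE if_distrib[of card] cong: if_cong)
  also have "\<dots> = 2 ^ card ({..n} - W)" by (simp add: prod.If_cases Diff_eq)
  finally show ?thesis using assms fW by (simp add: card_Diff_subset)
qed

lemma overlap_diagonal:
  assumes U: "finite U" and ex: "excess n U \<le> sqrt n"
  shows "(\<Sum>h\<in>profiles n. 2 ^ card U * of_bool (\<forall>x\<in>U. h (wt {..<n} x) = x i + x i)) \<le> 2 ^ (n + 1) * sqrt n"
proof -
  let ?W = "wt {..<n} ` U"
  have W: "?W \<subseteq> {..n}" using wt_le_n by auto
  have cW: "card ?W \<le> n + 1" using card_mono[OF _ W] by simp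
  have b: "a + a = 0" for a :: bit by (cases a) auto
  have "(\<forall>x\<in>U. h (wt {..<n} x) = x i + x i) \<longleftrightarrow> (\<forall>w\<in>?W. h w = 0)" for h :: "nat \<Rightarrow> bit"
    by (auto simp: b)
  then have "(\<Sum>h\<in>profiles n. of_bool (\<forall>x\<in>U. h (wt {..<n} x) = x i + x i)) = real (card {h \<in> profiles n. \<forall>w\<in>?W. h w = 0})"
    by (simp only: real_card_Collect_eq_sum[OF finite_profiles])
  also have "\<dots> = 2 ^ (n + 1 - card ?W)" unfolding profiles_vanishing[OF W] by simp
  finally have "(\<Sum>h\<in>profiles n. 2 ^ card U * of_bool (\<forall>x\<in>U. h (wt {..<n} x) = x i + x i) :: real) = 2 ^ card U * 2 ^ (n + 1 - card ?W)"
    by (simp only: sum_distrib_left[symmetric])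
  also have "\<dots> = 2 ^ (n + 1) * excess n U"
  proof -
    have "(2::real) ^ (n + 1 - card ?W) * 2 ^ card ?W = 2 ^ (n + 1)"
      unfolding power_add[symmetric] using cW by simp
    then show ?thesis by (simp add: excess_def field_simps)
  qed
  also have "\<dots> \<le> 2 ^ (n + 1) * sqrt n" using ex by (rule mult_left_mono) simp
  finally show ?thesis .
qed

text \<open>The \<open>n\<close> diagonal pairs among \<open>n^2\<close> contribute at most
  \<open>sqrt n\<close> each, together \<open>1 / sqrt n\<close>. Off the diagonal the truncation is
  dropped and the sums are exchanged: for fixed \<open>h\<close> the points are independent and
  \<open>agree_count\<close> applies to each.\<close>

lemma overlap_lists:
  assumes n: "n \<ge> 2"
  shows "(\<Sum>xs\<in>{xs \<in> input_lists n q. distinct xs}. of_bool (excess n (set xs) \<le> sqrt n) * overlap n (profiles n \<times> {..<n}) (set xs))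
    \<le> (1 / sqrt n + (1 + 2 / (real n - 1)) ^ q) * (2 ^ n) ^ q"
proof -
  let ?G = "profiles n" and ?N = "2 ^ n :: real"
  let ?Ls = "{xs \<in> input_lists n q. distinct xs}"
  define c where "c = (1 + 2 / (real n - 1)) ^ q"
  have c0: "0 \<le> c" using n by (simp add: c_def)
  let ?a = "\<lambda>i j xs. \<Sum>h\<in>?G. 2 ^ card (set xs) * of_bool (\<forall>x\<in>set xs. h (wt {..<n} x) = x i + x j) :: real"
  have ov: "overlap n (?G \<times> {..<n}) (set xs) = (\<Sum>i<n. \<Sum>j<n. ?a i j xs) / ((real n)\<^sup>2 * 2 ^ (n + 1))" if "xs \<in> ?Ls" for xs
    using overlap_profiles[of n "set xs"] that n by (simp add: input_lists_def)
  have each: "(\<Sum>xs\<in>?Ls. of_bool (excess n (set xs) \<le> sqrt n) * ?a i j xs) \<le> 2 ^ (n + 1) * ?N ^ q * (of_bool (i = j) * sqrt n + c)"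
    if ij: "i < n" "j < n" for i j
  proof (cases "i = j")
    case True
    have "(\<Sum>xs\<in>?Ls. of_bool (excess n (set xs) \<le> sqrt n) * ?a i j xs) \<le> (\<Sum>xs\<in>?Ls. 2 ^ (n + 1) * sqrt n)"
      using True overlap_diagonal by (intro sum_mono) (auto simp: of_bool_def simp del: sum_of_bool_mult_eq sum_mult_of_bool_eq)
    also have "\<dots> \<le> (\<Sum>xs\<in>input_lists n q. 2 ^ (n + 1) * sqrt n)" by (rule sum_mono2) auto
    also have "\<dots> = 2 ^ (n + 1) * ?N ^ q * sqrt n" by (simp add: card_input_lists)
    also have "\<dots> \<le> 2 ^ (n + 1) * ?N ^ q * (of_bool (i = j) * sqrt n + c)"
      using True c0 by (intro mult_left_mono) auto
    finally show ?thesis .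
  next
    case False
    have "(\<Sum>xs\<in>?Ls. of_bool (excess n (set xs) \<le> sqrt n) * ?a i j xs) \<le> (\<Sum>xs\<in>?Ls. ?a i j xs)"
      by (intro sum_mono mult_left_le_one_le sum_nonneg) auto
    also have "\<dots> = (\<Sum>xs\<in>?Ls. \<Sum>h\<in>?G. 2 ^ q * of_bool (\<forall>x\<in>set xs. h (wt {..<n} x) = x i + x j))"
      by (intro sum.cong refl) (auto simp: distinct_card input_lists_def)
    also have "\<dots> \<le> (\<Sum>xs\<in>input_lists n q. \<Sum>h\<in>?G. 2 ^ q * of_bool (\<forall>x\<in>set xs. h (wt {..<n} x) = x i + x j))"
      by (rule sum_mono2) (auto intro!: sum_nonneg)
    also have "\<dots> = (\<Sum>h\<in>?G. 2 ^ q * (\<Sum>xs\<in>input_lists n q. of_bool (\<forall>x\<in>set xs. h (wt {..<n} x) = x i + x j)))"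
      by (subst sum.swap) (simp only: sum_distrib_left)
    also have "\<dots> = (\<Sum>h\<in>?G. (2 * real (card {x \<in> cube n. h (wt {..<n} x) = x i + x j})) ^ q)"
      by (simp only: real_card_Collect_eq_sum[OF finite_input_lists, symmetric] card_input_lists_all power_mult_distrib)
    also have "\<dots> \<le> (\<Sum>h\<in>?G. (?N * (1 + 2 / (real n - 1))) ^ q)"
      by (intro sum_mono power_mono agree_count ij False) auto
    also have "\<dots> = 2 ^ (n + 1) * ?N ^ q * c" by (simp add: card_profiles power_mult_distrib c_def)
    finally show ?thesis using False by simp
  qed
  have "(\<Sum>xs\<in>?Ls. of_bool (excess n (set xs) \<le> sqrt n) * overlap n (?G \<times> {..<n}) (set xs))
      = (\<Sum>xs\<in>?Ls. \<Sum>i<n. \<Sum>j<n. of_bool (excess n (set xs) \<le> sqrt n) * ?a i j xs) / ((real n)\<^sup>2 * 2 ^ (n + 1))"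
    unfolding sum_divide_distrib by (intro sum.cong refl) (simp only: ov sum_distrib_left sum_divide_distrib times_divide_eq_right)
  also have "(\<Sum>xs\<in>?Ls. \<Sum>i<n. \<Sum>j<n. of_bool (excess n (set xs) \<le> sqrt n) * ?a i j xs)
      = (\<Sum>i<n. \<Sum>xs\<in>?Ls. \<Sum>j<n. of_bool (excess n (set xs) \<le> sqrt n) * ?a i j xs)"
    by (rule sum.swap)
  also have "\<dots> = (\<Sum>i<n. \<Sum>j<n. \<Sum>xs\<in>?Ls. of_bool (excess n (set xs) \<le> sqrt n) * ?a i j xs)"
    by (intro sum.cong refl sum.swap)
  also have "\<dots> \<le> (\<Sum>i<n. \<Sum>j<n. 2 ^ (n + 1) * ?N ^ q * (of_bool (i = j) * sqrt n + c))"
    by (intro sum_mono each) auto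
  also have "\<dots> = 2 ^ (n + 1) * ?N ^ q * (real n * sqrt n + (real n)\<^sup>2 * c)"
  proof -
    have "(\<Sum>j<n. of_bool (i = j) * sqrt n + c) = sqrt n + real n * c" if "i < n" for i
      using that by (simp add: sum.distrib of_bool_def sum.delta' if_distrib[of "\<lambda>x. x * _"] cong: if_cong)
    then show ?thesis
      by (simp only: sum_distrib_left[symmetric] lessThan_iff cong: sum.cong) (simp add: power2_eq_square distrib_left mult.assoc)
  qed
  finally have "(\<Sum>xs\<in>?Ls. of_bool (excess n (set xs) \<le> sqrt n) * overlap n (?G \<times> {..<n}) (set xs))
     \<le> 2 ^ (n + 1) * ?N ^ q * (real n * sqrt n + (real n)\<^sup>2 * c) / ((real n)\<^sup>2 * 2 ^ (n + 1))"
    by (simp add: divide_right_mono)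
  also have "\<dots> = (1 / sqrt n + c) * ?N ^ q"
  proof -
    have "real n * sqrt n = (real n)\<^sup>2 * (1 / sqrt n)"
      using n by (simp add: power2_eq_square) (metis mult.commute real_div_sqrt of_nat_0_le_iff times_divide_eq_right)
    then have "real n * sqrt n + (real n)\<^sup>2 * c = (real n)\<^sup>2 * (1 / sqrt n + c)" by (simp only: distrib_left)
    then show ?thesis using n by simp
  qed
  finally show ?thesis by (simp add: c_def)
qed

text \<open>A new point doubles the quantity iff its layer was already seen. At most
  \<open>q\<close> layers were seen, each of density at most \<open>1 / sqrt n\<close>.\<close>

lemma excess_lists:
  assumes n: "n > 0" and "m \<le> q"
  shows "(\<Sum>xs\<in>input_lists n m. 2 ^ m / 2 ^ card (wt {..<n} ` set xs)) \<le> (2 ^ n * (1 + real q / sqrt n)) ^ m"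
  using assms(2)
proof (induction m)
  case 0
  then show ?case by simp
next
  case (Suc m)
  let ?N = "2 ^ n :: real"
  have "(\<Sum>xs\<in>input_lists n (Suc m). 2 ^ Suc m / 2 ^ card (wt {..<n} ` set xs)) =
     (\<Sum>xs\<in>input_lists n m. \<Sum>x\<in>cube n. 2 ^ Suc m / 2 ^ card (wt {..<n} ` set (x # xs)) :: real)"
    unfolding sum_input_lists_Suc by (rule sum.swap)
  also have "\<dots> \<le> (\<Sum>xs\<in>input_lists n m. 2 ^ m / 2 ^ card (wt {..<n} ` set xs) * (?N * (1 + real q / sqrt n)))"
  proof (rule sum_mono)
    fix xs assume xs: "xs \<in> input_lists n m"
    let ?W = "wt {..<n} ` set xs"
    have "2 ^ Suc m / 2 ^ card (wt {..<n} ` set (x # xs)) = 2 ^ m / 2 ^ card ?W * (1 + of_bool (wt {..<n} x \<in> ?W) :: real)" for x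
      by (cases "wt {..<n} x \<in> ?W") (simp_all add: insert_absorb)
    then have "(\<Sum>x\<in>cube n. 2 ^ Suc m / 2 ^ card (wt {..<n} ` set (x # xs)) :: real) =
       2 ^ m / 2 ^ card ?W * (\<Sum>x\<in>cube n. 1 + of_bool (wt {..<n} x \<in> ?W))"
      by (simp only: sum_distrib_left)
    also have "\<dots> \<le> 2 ^ m / 2 ^ card ?W * (?N * (1 + real q / sqrt n))"
    proof (rule mult_left_mono)
      have "(\<Sum>x\<in>cube n. 1 + of_bool (wt {..<n} x \<in> ?W)) = ?N + real (card {x \<in> cube n. wt {..<n} x \<in> ?W})"
        by (simp only: sum.distrib real_card_Collect_eq_sum[OF finite_cube]) (simp add: card_cube)
      also have "real (card {x \<in> cube n. wt {..<n} x \<in> ?W}) \<le> real q * (?N / sqrt n)"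
        using xs Suc.prems card_wt_image_le[of xs m "{..<n}"]
        by (intro card_layers_le n) (auto simp: input_lists_def)
      finally show "(\<Sum>x\<in>cube n. 1 + of_bool (wt {..<n} x \<in> ?W)) \<le> ?N * (1 + real q / sqrt n)"
        by (simp add: algebra_simps)
    qed simp
    finally show "(\<Sum>x\<in>cube n. 2 ^ Suc m / 2 ^ card (wt {..<n} ` set (x # xs))) \<le> 2 ^ m / 2 ^ card ?W * (?N * (1 + real q / sqrt n))" .
  qed
  also have "\<dots> = (\<Sum>xs\<in>input_lists n m. 2 ^ m / 2 ^ card (wt {..<n} ` set xs)) * (?N * (1 + real q / sqrt n))"
    by (simp only: sum_distrib_right)
  also have "\<dots> \<le> (?N * (1 + real q / sqrt n)) ^ m * (?N * (1 + real q / sqrt n))"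
    using Suc by (intro mult_right_mono) auto
  finally show ?case by (simp add: mult.commute)
qed

text \<open>Lists with repetitions get value 0, so only lists enumerating a set of full size remain
  on the right.\<close>

lemma samples_le_distinct_lists:
  fixes \<psi> :: "(nat \<Rightarrow> bit) set \<Rightarrow> real"
  assumes "u \<le> 2 ^ n" "\<And>U. 0 \<le> \<psi> U"
  shows "(1 - (real u)\<^sup>2 / 2 ^ n) * ((\<Sum>U\<in>samples n u. \<psi> U) / card (samples n u))
    \<le> (\<Sum>xs\<in>{xs \<in> input_lists n u. distinct xs}. \<psi> (set xs)) / (2 ^ n) ^ u"
proof -
  let ?\<psi> = "\<lambda>xs. if distinct xs then \<psi> (set xs) else 0"
  have "(\<Sum>xs\<in>orderings U. ?\<psi> xs) / fact u = \<psi> U" if "U \<in> samples n u" for U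
  proof -
    have U: "finite U" "card U = u" using that by (auto simp: samples_def intro: finite_subset)
    have "(\<Sum>xs\<in>orderings U. ?\<psi> xs) = (\<Sum>xs\<in>orderings U. \<psi> U)"
      by (rule sum.cong) (auto simp: orderings_def)
    then show ?thesis using card_orderings[OF U(1)] U(2) by simp
  qed
  moreover have "(\<Sum>xs\<in>input_lists n u. ?\<psi> xs) = (\<Sum>xs\<in>{xs \<in> input_lists n u. distinct xs}. \<psi> (set xs))"
    by (rule sum.inter_filter[symmetric]) simp
  ultimately show ?thesis using samples_le_lists[OF assms(1), of ?\<psi>] assms(2) by simp
qed

text \<open>The factor 1/2 gives \<open>q^2 / sqrt n \<le> ln n / 4\<close>. Hence the mean excess
  is about \<open>n powr (1 / 4)\<close> at most, and by Markov the truncation at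
  \<open>sqrt n\<close> discards only a fraction of order \<open>n powr (- 1 / 4)\<close> of the
  samples, while the truncated overlap averages to nearly 1.\<close>

lemma passive_lower:
  assumes k: "1 \<le> k" and \<epsilon>: "\<epsilon> \<le> 1 / 1000"
  shows "\<forall>\<^sub>F n in sequentially. \<forall>q. (\<exists>A. is_sample_tester n \<epsilon> (SymF n (n - k)) q q A) \<longrightarrow>
    1 / 2 * (real n powr (1 / 4) * sqrt (ln (real n))) \<le> real q"
proof -
  let ?Q = "\<lambda>n. 1 / 2 * (real n powr (1 / 4) * sqrt (ln (real n)))"
  have e1: "\<forall>\<^sub>F n in sequentially. 1 / sqrt (real n) + exp (2 * ?Q n / (real n - 1)) \<le> 101 / 100" by real_asymp
  have e2: "\<forall>\<^sub>F n in sequentially. (?Q n)\<^sup>2 / 2 powr real n \<le> 1 / 1000" by real_asymp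
  have e3: "\<forall>\<^sub>F n in sequentially. exp (1 / 4 * ln (real n)) / sqrt (real n) \<le> 1 / 100" by real_asymp
  show ?thesis using e1 e2 e3 most_functions_far[OF \<epsilon>, of k] eventually_ge_at_top[of "k + 2"]
  proof eventually_elim
    case (elim n)
    note e1 = elim(1) and e2 = elim(2) and e3 = elim(3) and far = elim(4)
    show ?case
    proof (intro allI impI, rule ccontr)
      fix q
      assume "\<exists>A. is_sample_tester n \<epsilon> (SymF n (n - k)) q q A" and "\<not> ?Q n \<le> real q"
      then obtain A where A: "is_sample_tester n \<epsilon> (SymF n (n - k)) q q A" and q: "real q \<le> ?Q n" by auto
      have n: "n \<ge> 2" "k \<le> n" "n > 0" using elim(5) by auto
      have qN: "q \<le> 2 ^ n" using A by (simp add: is_sample_tester_def)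
      let ?S = "samples n q" and ?I = "profiles n \<times> {..<n}" and ?N = "2 ^ n :: real"
      let ?Ls = "{xs \<in> input_lists n q. distinct xs}"
      let ?good = "\<lambda>U. excess n U \<le> sqrt n"
      have cS: "real (card ?S) > 0" using qN by (simp add: card_samples)
      have q2: "(real q)\<^sup>2 \<le> (?Q n)\<^sup>2" using q by (intro power_mono) auto
      have "(real q)\<^sup>2 / ?N \<le> (?Q n)\<^sup>2 / ?N" using q2 by (rule divide_right_mono) simp
      moreover have e: "2 powr real n = ?N" by (simp add: powr_realpow)
      ultimately have f: "999 / 1000 \<le> 1 - (real q)\<^sup>2 / ?N" using e2[unfolded e] by linarith
      have ov0: "0 \<le> overlap n ?I U" for U unfolding overlap_def by (intro divide_nonneg_nonneg sum_nonneg) auto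
      define avg where "avg = (\<Sum>U\<in>?S. of_bool (?good U) * overlap n ?I U) / real (card ?S)"
      define pb where "pb = (\<Sum>U\<in>?S. of_bool (\<not> ?good U)) / real (card ?S)"
      have avg0: "0 \<le> avg" "0 \<le> pb" unfolding avg_def pb_def using ov0 by (auto intro!: divide_nonneg_nonneg sum_nonneg)
      have avg: "999 / 1000 * avg \<le> 101 / 100"
      proof -
        have "999 / 1000 * avg \<le> (1 - (real q)\<^sup>2 / ?N) * avg" using f avg0 by (intro mult_right_mono) auto
        also have "\<dots> \<le> (\<Sum>xs\<in>?Ls. of_bool (?good (set xs)) * overlap n ?I (set xs)) / ?N ^ q"
          unfolding avg_def by (rule samples_le_distinct_lists[OF qN]) (simp add: ov0)
        also have "\<dots> \<le> 1 / sqrt n + (1 + 2 / (real n - 1)) ^ q"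
          using overlap_lists[OF n(1), of q] by (simp add: pos_divide_le_eq)
        also have "(1 + 2 / (real n - 1)) ^ q \<le> exp (2 * ?Q n / (real n - 1))"
        proof -
          have "(1 + 2 / (real n - 1)) ^ q \<le> exp (2 / (real n - 1)) ^ q"
            using exp_ge_add_one_self[of "2 / (real n - 1)"] n by (intro power_mono) auto
          also have "\<dots> = exp (real q * (2 / (real n - 1)))" by (rule exp_of_nat_mult[symmetric])
          also have "\<dots> \<le> exp (2 * ?Q n / (real n - 1))"
          proof -
            have "real q * (2 / (real n - 1)) \<le> ?Q n * (2 / (real n - 1))" using q n by (intro mult_right_mono) auto
            also have "\<dots> = 2 * ?Q n / (real n - 1)" by (simp only: times_divide_eq_right mult.commute[of 2])
            finally show ?thesis by (simp only: exp_le_cancel_iff)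
          qed
          finally show ?thesis .
        qed
        finally show ?thesis using e1 by linarith
      qed
      have pb: "999 / 1000 * pb \<le> 1 / 100"
      proof -
        have sn: "sqrt n > 0" using n by simp
        have "999 / 1000 * pb \<le> (1 - (real q)\<^sup>2 / ?N) * pb" using f avg0 by (intro mult_right_mono) auto
        also have "\<dots> \<le> (\<Sum>xs\<in>?Ls. of_bool (\<not> ?good (set xs))) / ?N ^ q"
          unfolding pb_def by (rule samples_le_distinct_lists[OF qN]) simp
        also have "\<dots> \<le> ((\<Sum>xs\<in>?Ls. 2 ^ q / 2 ^ card (wt {..<n} ` set xs)) / sqrt n) / ?N ^ q"
          unfolding sum_divide_distrib[of _ _ "sqrt n"]
        proof (intro divide_right_mono sum_mono)
          fix xs assume "xs \<in> ?Ls"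
          then have "excess n (set xs) = 2 ^ q / 2 ^ card (wt {..<n} ` set xs)"
            by (simp add: excess_def distinct_card input_lists_def)
          moreover have "of_bool (\<not> e \<le> s) \<le> e / s" if "0 \<le> e" "0 < s" for e s :: real
            using that by (auto simp: of_bool_def le_divide_eq)
          from this[of "excess n (set xs)" "sqrt n"] sn
          have "of_bool (\<not> ?good (set xs)) \<le> excess n (set xs) / sqrt n" by (simp add: excess_def)
          ultimately show "of_bool (\<not> ?good (set xs)) \<le> 2 ^ q / 2 ^ card (wt {..<n} ` set xs) / sqrt n"
            by (simp only:)
        qed simp
        also have "\<dots> \<le> ((\<Sum>xs\<in>input_lists n q. 2 ^ q / 2 ^ card (wt {..<n} ` set xs)) / sqrt n) / ?N ^ q"
          by (intro divide_right_mono sum_mono2) auto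
        also have "\<dots> \<le> ((?N * (1 + real q / sqrt n)) ^ q / sqrt n) / ?N ^ q"
          by (intro divide_right_mono excess_lists n) auto
        also have "\<dots> = (1 + real q / sqrt n) ^ q / sqrt n" by (simp add: power_mult_distrib)
        also have "\<dots> \<le> exp ((?Q n)\<^sup>2 / sqrt n) / sqrt n"
        proof (rule divide_right_mono)
          have "(1 + real q / sqrt n) ^ q \<le> exp (real q / sqrt n) ^ q"
            using exp_ge_add_one_self[of "real q / sqrt n"] by (intro power_mono) auto
          also have "\<dots> = exp (real q * (real q / sqrt n))" by (rule exp_of_nat_mult[symmetric])
          also have "real q * (real q / sqrt n) = (real q)\<^sup>2 / sqrt n" by (simp add: power2_eq_square)
          also have "exp ((real q)\<^sup>2 / sqrt n) \<le> exp ((?Q n)\<^sup>2 / sqrt n)"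
            unfolding exp_le_cancel_iff using q2 by (rule divide_right_mono) simp
          finally show "(1 + real q / sqrt n) ^ q \<le> exp ((?Q n)\<^sup>2 / sqrt n)" .
        qed simp
        also have "(?Q n)\<^sup>2 / sqrt n = 1 / 4 * ln n"
        proof -
          have "(?Q n)\<^sup>2 = 1 / 4 * (sqrt n * ln n)"
            unfolding power_mult_distrib[of "1 / 2"] passive_rate_sq[OF Suc_leI[OF n(3), unfolded One_nat_def[symmetric]]]
            by (simp add: power2_eq_square)
          then show ?thesis using sn by simp
        qed
        also have "exp (1 / 4 * ln n) / sqrt n \<le> 1 / 100" by (rule e3)
        finally show ?thesis .
      qed
      \<comment> \<open>\<open>second_moment\<close> with \<open>\<theta> = 1 / 10\<close>, whence
        \<open>1 / 20 = \<theta> / 2\<close> and \<open>5 = 1 / (2 * \<theta>)\<close>. On a bad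
        sample \<open>b U\<close> equals \<open>1 / 20 - 5 + 6 > 1\<close>, which makes the bound
        trivial.\<close>
      define b where "b = (\<lambda>U. 1 / 20 + 5 * (of_bool (?good U) * overlap n ?I U - 1) + 6 * of_bool (\<not> ?good U))"
      have "1 * (66 / 100) \<le> 1 / 3 + (\<Sum>U\<in>?S. b U) / card ?S"
      proof (rule sample_tester_lower_bound[OF A, where F = "shifted n" and I = ?I])
        show "finite ?I" by simp
        show "?I \<noteq> {}" using n by (auto simp: profiles_def PiE_eq_empty_iff lessThan_empty_iff)
        show "shifted n p \<in> SymF n (n - k)" if "p \<in> ?I" for p
          using that by (intro shifted_SymF[OF k n(2)]) auto
        fix U t assume U: "U \<in> ?S" and t: "depth t \<le> q" "queried t \<subseteq> U"
        have UN: "U \<subseteq> cube n" using U by (simp add: samples_def)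
        show "1 * rej_avg (bool_funs n) (\<lambda>f. f) t - b U \<le> rej_avg ?I (shifted n) t"
        proof (cases "?good U")
          case True
          have "rej_avg (bool_funs n) (\<lambda>f. f) t - rej_avg ?I (shifted n) t \<le> (1 / 10) / 2 + (overlap n ?I U - 1) / (2 * (1 / 10))"
            by (rule second_moment[OF _ _ UN t(2)]) (use n in \<open>auto simp: profiles_def PiE_eq_empty_iff lessThan_empty_iff finite_PiE\<close>)
          then show ?thesis using True by (simp add: b_def)
        next
          case False
          then show ?thesis
            using rej_avg_bounds(2)[of "bool_funs n" "\<lambda>f. f" t] rej_avg_bounds(1)[of ?I "shifted n" t] by (simp add: b_def)
        qed
      qed (use far in auto)
      also have "(\<Sum>U\<in>?S. b U) / card ?S = 1 / 20 + 5 * (avg - 1) + 6 * pb"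
      proof -
        have "(\<Sum>U\<in>?S. b U) = real (card ?S) * (1 / 20 - 5) + 5 * (\<Sum>U\<in>?S. of_bool (?good U) * overlap n ?I U) + 6 * (\<Sum>U\<in>?S. of_bool (\<not> ?good U))"
          by (simp add: b_def sum.distrib sum_distrib_left[symmetric] sum_subtractf right_diff_distrib
            del: sum_of_bool_eq sum_of_bool_mult_eq sum_mult_of_bool_eq)
        then show ?thesis unfolding avg_def pb_def using cS
          by (simp add: add_divide_distrib diff_divide_distrib del: sum_of_bool_eq sum_of_bool_mult_eq sum_mult_of_bool_eq)
      qed
      finally show False using avg pb by simp
    qed
  qed
qed

section \<open>Learning\<close>

text \<open>Union bound over hypotheses, recorded only on the middle layers \<open>M\<close>: this
  leaves \<open>exp (O(sqrt n))\<close> candidates for each \<open>J\<close>, where counting on all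
  layers would give \<open>exp (O(n))\<close>. The other layers have mass at most
  \<open>\<epsilon> / 2\<close>, so a hypothesis that is not \<open>\<epsilon>\<close>-close still
  errs on \<open>\<epsilon> / 2\<close> of the cube inside \<open>M\<close> and survives
  \<open>q\<close> examples with probability at most
  \<open>exp (- \<epsilon> * q / 2)\<close>.\<close>

lemma bad_hypotheses_count:
  fixes t :: real
  assumes n: "k \<le> n" "n > 0" and t: "t > 0" "t\<^sup>2 = 2 / \<epsilon>" and \<epsilon>: "0 < \<epsilon>" "\<epsilon> \<le> 1"
  shows "real (card {xs \<in> input_lists n q. \<exists>g\<in>SymF n (n - k). (\<forall>x\<in>set xs. g x = f x) \<and> \<not> close_to n \<epsilon> f g})
    \<le> real n ^ k * exp (2 ^ k * (t * sqrt n + 1)) * exp (- (\<epsilon> / 2 * real q)) * (2 ^ n) ^ q"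
proof -
  let ?N = "2 ^ n :: real"
  define M where "M = {x \<in> cube n. \<bar>real n - 2 * real (wt {..<n} x)\<bar> < t * sqrt n}"
  define W where "W = {w::nat. \<bar>real n - 2 * real w\<bar> < t * sqrt n}"
  define D where "D = (\<lambda>S. {x \<in> M. (f x = 1) \<noteq> (x \<in> S)})"
  let ?J = "{J. J \<subseteq> {..<n} \<and> card J = k}"
  define Sup where "Sup = (\<lambda>J. (\<lambda>g. {x \<in> M. g x = 1}) ` {g. class_const n J g})"
  let ?A = "\<lambda>S. {xs \<in> input_lists n q. \<forall>x\<in>set xs. x \<notin> D S}"
  define Big where "Big = (\<lambda>J. {S \<in> Sup J. \<epsilon> / 2 * ?N \<le> real (card (D S))})"
  have MN: "M \<subseteq> cube n" by (auto simp: M_def)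
  have s0: "0 \<le> t * sqrt n" using t by simp
  have W: "finite W" "real (card W) \<le> t * sqrt n + 1"
    unfolding W_def using card_mid_weights[OF s0] by auto
  have wW: "wt {..<n} ` M \<subseteq> W" by (auto simp: M_def W_def)
  have fS: "finite (Sup J)" for J unfolding Sup_def by (rule card_class_const_supports(1)[OF MN])
  have cS: "real (card (Sup J)) \<le> exp (2 ^ k * (t * sqrt n + 1))" if "J \<in> ?J" for J
  proof -
    have fJ: "finite J" using that finite_subset by blast
    have "card (Sup J) \<le> 2 ^ card (key n J ` M)" unfolding Sup_def by (rule card_class_const_supports(2)[OF MN])
    then have "real (card (Sup J)) \<le> real (2 ^ card (key n J ` M))" by (rule of_nat_mono)
    also have "\<dots> = 2 ^ card (key n J ` M)" by simp
    also have "\<dots> \<le> exp (real (card (key n J ` M)))" by (rule two_power_le_exp)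
    also have "real (card (key n J ` M)) \<le> real (2 ^ k * card W)"
      using card_keys[OF fJ W(1) wW] that by (intro of_nat_mono) auto
    also have "\<dots> = 2 ^ k * real (card W)" by simp
    also have "\<dots> \<le> 2 ^ k * (t * sqrt n + 1)" using W(2) by (rule mult_left_mono) simp
    finally show ?thesis by simp
  qed
  have out: "real (card (cube n - M)) \<le> \<epsilon> / 2 * ?N"
  proof -
    have "cube n - M = {x \<in> cube n. t * sqrt n \<le> \<bar>real n - 2 * real (wt {..<n} x)\<bar>}" by (auto simp: M_def)
    then show ?thesis using chebyshev_weight[OF t(1) n(2)] t(2) by (simp add: mult.commute)
  qed
  have "{xs \<in> input_lists n q. \<exists>g\<in>SymF n (n - k). (\<forall>x\<in>set xs. g x = f x) \<and> \<not> close_to n \<epsilon> f g} \<subseteq> (\<Union>J\<in>?J. \<Union>S\<in>Big J. ?A S)"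
  proof safe
    fix xs g assume xs: "xs \<in> input_lists n q" and g: "g \<in> SymF n (n - k)" "\<forall>x\<in>set xs. g x = f x" "\<not> close_to n \<epsilon> f g"
    obtain J where J: "J \<in> ?J" "class_const n J g" using g(1) SymF_iff[OF n(1)] by blast
    let ?S = "{x \<in> M. g x = 1}"
    have DS: "D ?S = disagree n f g \<inter> M"
    proof -
      have "(f x = 1) \<noteq> (g x = 1) \<longleftrightarrow> f x \<noteq> g x" for x by (metis bit_not_one_iff)
      then show ?thesis using MN by (auto simp: D_def disagree_def)
    qed
    have "disagree n f g \<subseteq> D ?S \<union> (cube n - M)" unfolding DS by (auto simp: disagree_def)
    then have "card (disagree n f g) \<le> card (D ?S \<union> (cube n - M))"
      using MN by (intro card_mono) (auto simp: D_def intro: finite_subset)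
    also have "\<dots> \<le> card (D ?S) + card (cube n - M)" by (rule card_Un_le)
    finally have "real (card (disagree n f g)) \<le> real (card (D ?S)) + real (card (cube n - M))" by linarith
    then have "\<epsilon> / 2 * ?N \<le> real (card (D ?S))" using g(3) out by (simp add: close_to_def)
    then have "?S \<in> Big J" using J(2) by (auto simp: Big_def Sup_def)
    moreover have "xs \<in> ?A ?S" using xs g(2) unfolding DS by (auto simp: disagree_def)
    ultimately show "xs \<in> (\<Union>J\<in>?J. \<Union>S\<in>Big J. ?A S)" using J(1) by blast
  qed
  then have "card {xs \<in> input_lists n q. \<exists>g\<in>SymF n (n - k). (\<forall>x\<in>set xs. g x = f x) \<and> \<not> close_to n \<epsilon> f g}
      \<le> card (\<Union>J\<in>?J. \<Union>S\<in>Big J. ?A S)"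
    using finite_witness_sets fS by (intro card_mono) (auto simp: Big_def)
  also have "\<dots> \<le> (\<Sum>J\<in>?J. card (\<Union>S\<in>Big J. ?A S))" by (rule card_UN_le[OF finite_witness_sets])
  also have "\<dots> \<le> (\<Sum>J\<in>?J. \<Sum>S\<in>Big J. card (?A S))"
    using fS by (intro sum_mono card_UN_le) (auto simp: Big_def)
  finally have "real (card {xs \<in> input_lists n q. \<exists>g\<in>SymF n (n - k). (\<forall>x\<in>set xs. g x = f x) \<and> \<not> close_to n \<epsilon> f g})
     \<le> real (\<Sum>J\<in>?J. \<Sum>S\<in>Big J. card (?A S))" by (rule of_nat_mono)
  also have "\<dots> = (\<Sum>J\<in>?J. \<Sum>S\<in>Big J. real (card (?A S)))" by simp
  also have "\<dots> \<le> real (card ?J) * (exp (2 ^ k * (t * sqrt n + 1)) * (exp (- (\<epsilon> / 2 * real q)) * ?N ^ q))"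
  proof (rule sum_bounded_above)
    fix J assume J: "J \<in> ?J"
    have "(\<Sum>S\<in>Big J. real (card (?A S))) \<le> real (card (Big J)) * (exp (- (\<epsilon> / 2 * real q)) * ?N ^ q)"
    proof (rule sum_bounded_above)
      fix S assume S: "S \<in> Big J"
      have DN: "D S \<subseteq> cube n" using MN by (auto simp: D_def)
      have "real (card (?A S)) = real (card {x \<in> cube n. x \<notin> D S}) ^ q" by (rule card_input_lists_all)
      also have "{x \<in> cube n. x \<notin> D S} = cube n - D S" by auto
      also have "real (card (cube n - D S)) = ?N - real (card (D S))" by (rule card_cube_diff[OF DN])
      also have "(?N - real (card (D S))) ^ q \<le> (exp (- (\<epsilon> / 2)) * ?N) ^ q"
      proof (rule power_mono)
        have "?N - real (card (D S)) \<le> (1 - \<epsilon> / 2) * ?N" using S by (simp add: Big_def algebra_simps)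
        also have "\<dots> \<le> exp (- (\<epsilon> / 2)) * ?N"
          using exp_ge_add_one_self[of "- (\<epsilon> / 2)"] by (intro mult_right_mono) auto
        finally show "?N - real (card (D S)) \<le> exp (- (\<epsilon> / 2)) * ?N" .
        show "0 \<le> ?N - real (card (D S))" using card_le_cube[OF DN] by simp
      qed
      also have "\<dots> = exp (- (\<epsilon> / 2 * real q)) * ?N ^ q"
        by (simp add: power_mult_distrib exp_of_nat_mult[symmetric] mult.commute)
      finally show "real (card (?A S)) \<le> exp (- (\<epsilon> / 2 * real q)) * ?N ^ q" .
    qed
    also have "\<dots> \<le> exp (2 ^ k * (t * sqrt n + 1)) * (exp (- (\<epsilon> / 2 * real q)) * ?N ^ q)"
    proof (rule mult_right_mono)
      have "card (Big J) \<le> card (Sup J)" using fS by (intro card_mono) (auto simp: Big_def)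
      then show "real (card (Big J)) \<le> exp (2 ^ k * (t * sqrt n + 1))" using cS[OF J] by linarith
    qed simp
    finally show "(\<Sum>S\<in>Big J. real (card (?A S))) \<le> exp (2 ^ k * (t * sqrt n + 1)) * (exp (- (\<epsilon> / 2 * real q)) * ?N ^ q)" .
  qed
  also have "\<dots> \<le> real (n ^ k) * (exp (2 ^ k * (t * sqrt n + 1)) * (exp (- (\<epsilon> / 2 * real q)) * ?N ^ q))"
    using card_SymF_witness_sets[of n k] by (intro mult_right_mono of_nat_mono) auto
  finally show ?thesis by (simp add: mult.assoc)
qed

lemma learner_exists:
  assumes \<epsilon>: "0 < \<epsilon>" "\<epsilon> \<le> 1"
  shows "\<exists>C>0. \<forall>\<^sub>F n in sequentially. \<exists>q L. is_proper_learner n \<epsilon> (SymF n (n - k)) q L \<and> real q \<le> C * sqrt (real n)"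
proof -
  define t where "t = sqrt (2 / \<epsilon>)"
  have t: "t > 0" "t\<^sup>2 = 2 / \<epsilon>" using \<epsilon> by (auto simp: t_def)
  \<comment> \<open>The three summands pay, in units of \<open>sqrt n\<close>, for the choice of
    \<open>J\<close> (as \<open>ln n \<le> sqrt n\<close>), for the hypotheses on the middle layers,
    and for a final error \<open>exp (- 2) \<le> 1 / 3\<close>.\<close>
  define C where "C = 2 / \<epsilon> * (real k + 2 ^ k * (t + 1) + 2)"
  have C: "C > 0" using \<epsilon> t by (simp add: C_def add_nonneg_pos)
  show ?thesis
  proof (intro exI[of _ "C + 1"] conjI)
    show "C + 1 > 0" using C by simp
    have "\<forall>\<^sub>F n in sequentially. ln (real n) \<le> sqrt (real n)" by real_asymp
    then show "\<forall>\<^sub>F n in sequentially. \<exists>q L. is_proper_learner n \<epsilon> (SymF n (n - k)) q L \<and> real q \<le> (C + 1) * sqrt (real n)"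
      using eventually_ge_at_top[of "k + 1"]
    proof eventually_elim
      case (elim n)
      have n: "k \<le> n" "n > 0" using elim by auto
      have sn: "1 \<le> sqrt n" using n by simp
      define q where "q = nat \<lceil>C * sqrt n\<rceil>"
      have q: "C * sqrt n \<le> q" "real q \<le> (C + 1) * sqrt n"
      proof -
        have "0 \<le> C * sqrt n" using C by simp
        then have "C * sqrt n \<le> q" "real q \<le> C * sqrt n + 1" unfolding q_def by linarith+
        then show "C * sqrt n \<le> q" "real q \<le> (C + 1) * sqrt n" using sn unfolding distrib_right by linarith+
      qed
      let ?P = "SymF n (n - k)"
      \<comment> \<open>Any hypothesis fitting the examples will do; one exists on every run, namely
        the unknown function itself.\<close>
      define G where "G = (\<lambda>s. SOME g. g \<in> ?P \<and> (\<forall>(x, b)\<in>set s. g x = b))"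
      have "is_proper_learner n \<epsilon> ?P q (\<lambda>s. return_pmf (G s))"
        unfolding is_proper_learner_def
      proof
        fix f assume f: "f \<in> ?P"
        let ?s = "\<lambda>xs. map (\<lambda>x. (x, f x)) xs"
        let ?bad = "{xs \<in> input_lists n q. \<exists>g\<in>?P. (\<forall>x\<in>set xs. g x = f x) \<and> \<not> close_to n \<epsilon> f g}"
        have G: "G (?s xs) \<in> ?P \<and> (\<forall>x\<in>set xs. G (?s xs) x = f x)" for xs
        proof -
          have "\<exists>g. g \<in> ?P \<and> (\<forall>(x, b)\<in>set (?s xs). g x = b)" using f by auto
          from someI_ex[OF this] show ?thesis unfolding G_def by auto
        qed
        have "real (card ?bad) \<le> real n ^ k * exp (2 ^ k * (t * sqrt n + 1)) * exp (- (\<epsilon> / 2 * real q)) * (2 ^ n) ^ q"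
          by (rule bad_hypotheses_count[OF n t \<epsilon>])
        also have "\<dots> \<le> 1 / 3 * (2 ^ n) ^ q"
        proof (rule mult_right_mono)
          have "real n ^ k = exp (real k * ln n)" using n by (simp add: exp_of_nat_mult)
          also have "\<dots> \<le> exp (real k * sqrt n)" using elim(1) by (simp add: mult_left_mono)
          finally have "real n ^ k * exp (2 ^ k * (t * sqrt n + 1)) * exp (- (\<epsilon> / 2 * real q))
             \<le> exp (real k * sqrt n) * exp (2 ^ k * (t * sqrt n + 1)) * exp (- (\<epsilon> / 2 * real q))"
            by (intro mult_right_mono) auto
          also have "\<dots> = exp (real k * sqrt n + 2 ^ k * (t * sqrt n + 1) - \<epsilon> / 2 * real q)"
            by (simp add: exp_add[symmetric])
          also have "\<dots> \<le> exp (- 2)"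
          proof -
            have "(real k + 2 ^ k * (t + 1) + 2) * sqrt n = \<epsilon> / 2 * (C * sqrt n)" using \<epsilon> by (simp add: C_def)
            also have "\<dots> \<le> \<epsilon> / 2 * real q" using q(1) \<epsilon> by (intro mult_left_mono) auto
            finally have 1: "(real k + 2 ^ k * (t + 1) + 2) * sqrt n \<le> \<epsilon> / 2 * real q" .
            define A where "A = 2 ^ k * (t + 1)"
            have "t * sqrt n + 1 \<le> (t + 1) * sqrt n" using sn unfolding distrib_right by linarith
            then have "2 ^ k * (t * sqrt n + 1) \<le> 2 ^ k * ((t + 1) * sqrt n)" by (rule mult_left_mono) simp
            also have "\<dots> = A * sqrt n" by (simp add: A_def)
            finally have 2: "2 ^ k * (t * sqrt n + 1) \<le> A * sqrt n" .
            have "(real k + A + 2) * sqrt n = real k * sqrt n + A * sqrt n + 2 * sqrt n" by (simp only: distrib_right)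
            then have "real k * sqrt n + 2 ^ k * (t * sqrt n + 1) + 2 \<le> \<epsilon> / 2 * real q"
              using 1 2 sn unfolding A_def[symmetric] by linarith
            then show ?thesis by simp
          qed
          also have "exp (- 2) \<le> (1 / 3 :: real)"
            using exp_ge_add_one_self[of "2::real"] by (simp add: exp_minus field_simps)
          finally show "real n ^ k * exp (2 ^ k * (t * sqrt n + 1)) * exp (- (\<epsilon> / 2 * real q)) \<le> 1 / 3" .
        qed simp
        finally have bad: "real (card ?bad) \<le> 1 / 3 * (2 ^ n) ^ q" .
        let ?good = "{g \<in> ?P. close_to n \<epsilon> f g}"
        have "measure_pmf.prob (pmf_of_set (input_lists n q) \<bind> (\<lambda>xs. return_pmf (G (?s xs)))) ?good =
           (\<Sum>xs\<in>input_lists n q. of_bool (G (?s xs) \<in> ?good)) / (2 ^ n) ^ q"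
          by (subst prob_bind_pmf_of_set) (auto simp: card_input_lists indicator_def of_bool_def measure_return_pmf simp del: sum_of_bool_eq)
        moreover have "(\<Sum>xs\<in>input_lists n q. 1 - of_bool (xs \<in> ?bad)) \<le> (\<Sum>xs\<in>input_lists n q. of_bool (G (?s xs) \<in> ?good) :: real)"
        proof (rule sum_mono)
          fix xs assume "xs \<in> input_lists n q"
          then show "1 - of_bool (xs \<in> ?bad) \<le> (of_bool (G (?s xs) \<in> ?good) :: real)"
            using G[of xs] by (auto simp: of_bool_def)
        qed
        moreover have "(\<Sum>xs\<in>input_lists n q. 1 - of_bool (xs \<in> ?bad)) = (2 ^ n) ^ q - real (card ?bad)"
        proof -
          have "real (card ?bad) = (\<Sum>xs\<in>input_lists n q. of_bool (xs \<in> ?bad))"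
            unfolding real_card_Collect_eq_sum[OF finite_input_lists] by (intro sum.cong refl) simp
          then show ?thesis by (simp only: sum_subtractf) (simp add: card_input_lists)
        qed
        ultimately have "((2 ^ n) ^ q - real (card ?bad)) / (2 ^ n) ^ q \<le> measure_pmf.prob (pmf_of_set (input_lists n q) \<bind> (\<lambda>xs. return_pmf (G (?s xs)))) ?good"
          by (simp only:) (rule divide_right_mono, auto)
        moreover have "2 / 3 \<le> ((2 ^ n) ^ q - real (card ?bad)) / (2 ^ n) ^ q"
          using bad by (simp add: field_simps)
        ultimately show "2 / 3 \<le> measure_pmf.prob (pmf_of_set (input_lists n q) \<bind> (\<lambda>xs. return_pmf (G (?s xs)))) ?good"
          by linarith
      qed
      then show ?case using q(2) by blast
    qed
  qed
qed

section \<open>Lower bound for learning from symmetric functions\<close>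

definition lift_weight :: "nat \<Rightarrow> (nat \<Rightarrow> bit) \<Rightarrow> (nat \<Rightarrow> bit) \<Rightarrow> bit" where
  "lift_weight n g = restrict (\<lambda>x. g (wt {..<n} x)) (cube n)"

lemma lift_weight_SymF: "k \<le> n \<Longrightarrow> lift_weight n g \<in> SymF n (n - k)"
  by (rule SymFI[where J = "{}"]) (auto simp: class_const_def cl_def lift_weight_def bool_funs_def)

text \<open>Flipping the function on all layers not seen in the sample is invisible to the learner, but
  moves the function by almost \<open>2 ^ n\<close> points.\<close>

lemma learner_lower:
  assumes n: "k \<le> n" "n > 0" and \<epsilon>: "\<epsilon> \<le> 1 / 1000" and L: "is_proper_learner n \<epsilon> (SymF n (n - k)) q L"
  shows "1 / 10 * sqrt (real n) \<le> real q"
proof (rule ccontr)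
  assume "\<not> 1 / 10 * sqrt (real n) \<le> real q"
  then have q: "real q \<le> 1 / 10 * sqrt n" by simp
  let ?N = "2 ^ n :: real" and ?P = "SymF n (n - k)"
  define GG where "GG = {..n} \<rightarrow>\<^sub>E (UNIV :: bit set)"
  have GG: "finite GG" "real (card GG) > 0" by (auto simp: GG_def finite_PiE card_PiE)
  define p where "p = (\<lambda>xs g. measure_pmf.prob (L (map (\<lambda>x. (x, lift_weight n g x)) xs)) {h \<in> ?P. close_to n \<epsilon> (lift_weight n g) h})"
  have low: "2 / 3 * real (card GG) \<le> (\<Sum>xs\<in>input_lists n q. \<Sum>g\<in>GG. p xs g) / ?N ^ q"
  proof -
    have "real (card GG) * (2 / 3) \<le> (\<Sum>g\<in>GG. (\<Sum>xs\<in>input_lists n q. p xs g) / ?N ^ q)"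
    proof (rule sum_bounded_below)
      fix g
      have "2 / 3 \<le> measure_pmf.prob (pmf_of_set (input_lists n q) \<bind> (\<lambda>xs. L (map (\<lambda>x. (x, lift_weight n g x)) xs)))
          {h \<in> ?P. close_to n \<epsilon> (lift_weight n g) h}"
        using L lift_weight_SymF[OF n(1)] by (simp add: is_proper_learner_def)
      then show "2 / 3 \<le> (\<Sum>xs\<in>input_lists n q. p xs g) / ?N ^ q"
        by (simp add: prob_bind_pmf_of_set card_input_lists p_def)
    qed
    then show ?thesis by (subst sum.swap) (simp add: sum_divide_distrib mult.commute)
  qed
  have up: "(\<Sum>g\<in>GG. p xs g) \<le> 1 / 2 * real (card GG)" if xs: "xs \<in> input_lists n q" for xs
  proof -
    let ?W = "wt {..<n} ` set xs"
    \<comment> \<open>Depends on the sample only, hence for a fixed sample it is an involution of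
      the profiles that keeps all seen labels.\<close>
    define flip where "flip = (\<lambda>g. restrict (\<lambda>w. if w \<in> ?W then g w else g w + 1 :: bit) {..n})"
    have ff: "flip (flip g) = g" if "g \<in> GG" for g
      using that by (auto simp: flip_def GG_def fun_eq_iff PiE_def extensional_def add.assoc)
    have fG: "flip g \<in> GG" for g by (simp add: flip_def GG_def)
    have same: "lift_weight n (flip g) x = lift_weight n g x" if "x \<in> set xs" for g x
      using that wt_le_n[of n] xs by (auto simp: lift_weight_def flip_def input_lists_def)
    have unseen: "real (card {x \<in> cube n. wt {..<n} x \<notin> ?W}) \<ge> 9 / 10 * ?N"
    proof -
      have "real (card {x \<in> cube n. wt {..<n} x \<in> ?W}) \<le> real q * (?N / sqrt n)"
        using xs card_wt_image_le[of xs q "{..<n}"] by (intro card_layers_le n) (auto simp: input_lists_def)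
      also have "\<dots> \<le> 1 / 10 * sqrt n * (?N / sqrt n)" using q by (intro mult_right_mono) auto
      also have "\<dots> = 1 / 10 * ?N" using n by simp
      finally have "real (card {x \<in> cube n. wt {..<n} x \<in> ?W}) \<le> 1 / 10 * ?N" .
      moreover have "card {x \<in> cube n. wt {..<n} x \<in> ?W} + card {x \<in> cube n. wt {..<n} x \<notin> ?W} = card (cube n)"
        by (subst card_Un_disjoint[symmetric]) (auto intro: arg_cong[where f = card])
      then have "real (card {x \<in> cube n. wt {..<n} x \<in> ?W}) + real (card {x \<in> cube n. wt {..<n} x \<notin> ?W}) = ?N"
        unfolding card_cube of_nat_add[symmetric] by simp
      ultimately show ?thesis by linarith
    qed
    have pair: "p xs g + p xs (flip g) \<le> 1" for g
    proof -
      let ?A = "{h \<in> ?P. close_to n \<epsilon> (lift_weight n g) h}" and ?B = "{h \<in> ?P. close_to n \<epsilon> (lift_weight n (flip g)) h}"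
      \<comment> \<open>A hypothesis close to both functions would force their disagreement, at
        least 9/10 of the cube, below \<open>2 * \<epsilon>\<close>.\<close>
      have "?A \<inter> ?B = {}"
      proof (rule ccontr)
        assume "?A \<inter> ?B \<noteq> {}"
        then obtain h where h: "real (card (disagree n (lift_weight n g) h)) < \<epsilon> * ?N"
          "real (card (disagree n (lift_weight n (flip g)) h)) < \<epsilon> * ?N" by (auto simp: close_to_def)
        have "{x \<in> cube n. wt {..<n} x \<notin> ?W} \<subseteq> disagree n (lift_weight n g) h \<union> disagree n (lift_weight n (flip g)) h"
        proof
          fix x assume x: "x \<in> {x \<in> cube n. wt {..<n} x \<notin> ?W}"
          then have "lift_weight n (flip g) x = lift_weight n g x + 1" using wt_le_n[of n] by (auto simp: lift_weight_def flip_def)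
          then have "lift_weight n (flip g) x \<noteq> lift_weight n g x" by (cases "lift_weight n g x") auto
          then show "x \<in> disagree n (lift_weight n g) h \<union> disagree n (lift_weight n (flip g)) h"
            using x by (auto simp: disagree_def)
        qed
        then have "card {x \<in> cube n. wt {..<n} x \<notin> ?W} \<le> card (disagree n (lift_weight n g) h \<union> disagree n (lift_weight n (flip g)) h)"
          by (intro card_mono) (auto simp: disagree_def)
        also have "\<dots> \<le> card (disagree n (lift_weight n g) h) + card (disagree n (lift_weight n (flip g)) h)" by (rule card_Un_le)
        finally have "9 / 10 * ?N \<le> 2 * (\<epsilon> * ?N)" using unseen h by linarith
        moreover have "\<epsilon> * ?N \<le> 1 / 1000 * ?N" using \<epsilon> by (intro mult_right_mono) auto
        moreover have "?N > 0" by simp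
        ultimately show False by linarith
      qed
      then have "measure_pmf.prob M ?A + measure_pmf.prob M ?B = measure_pmf.prob M (?A \<union> ?B)" for M
        by (intro measure_pmf.finite_measure_Union[symmetric]) auto
      moreover have "map (\<lambda>x. (x, lift_weight n (flip g) x)) xs = map (\<lambda>x. (x, lift_weight n g x)) xs"
        using same by simp
      ultimately show ?thesis unfolding p_def by (simp only: measure_pmf.prob_le_1)
    qed
    \<comment> \<open>Pairing each profile with its flip shows that the average success probability
      is at most 1/2, below the required 2/3.\<close>
    have "(\<Sum>g\<in>GG. p xs (flip g)) = (\<Sum>g\<in>GG. p xs g)"
      by (rule sum.reindex_bij_witness[where i = flip and j = flip]) (auto simp: ff fG)
    then have "2 * (\<Sum>g\<in>GG. p xs g) = (\<Sum>g\<in>GG. p xs g + p xs (flip g))" by (simp add: sum.distrib)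
    also have "\<dots> \<le> real (card GG) * 1" by (rule sum_bounded_above) (rule pair)
    finally show ?thesis by simp
  qed
  have "(\<Sum>xs\<in>input_lists n q. \<Sum>g\<in>GG. p xs g) \<le> real (card (input_lists n q)) * (1 / 2 * real (card GG))"
    by (rule sum_bounded_above) (rule up)
  then have "(\<Sum>xs\<in>input_lists n q. \<Sum>g\<in>GG. p xs g) / ?N ^ q \<le> 1 / 2 * real (card GG)"
    by (simp add: card_input_lists field_simps)
  then show False using low GG(2) by linarith
qed

section \<open>The query complexities of partially symmetric functions\<close>

text \<open>A tree of depth 0 ignores its input, so without queries a symmetric function and a far
  one are accepted with the same probability. Far functions exist because most functions are
  far.\<close>

lemma classical_lower:
  assumes "k \<ge> 1" "0 < \<epsilon>" "\<epsilon> \<le> 1 / 1000"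
  shows "\<forall>\<^sub>F n in sequentially. \<forall>q. (\<exists>D. is_tester n \<epsilon> (SymF n (n - k)) q D) \<longrightarrow> 1 \<le> real q"
  using most_functions_far[OF assms(3), of k] eventually_ge_at_top[of k]
proof eventually_elim
  case (elim n)
  show ?case
  proof (intro allI impI, rule ccontr)
    fix q assume "\<exists>D. is_tester n \<epsilon> (SymF n (n - k)) q D" and "\<not> 1 \<le> real q"
    then obtain D where D: "is_tester n \<epsilon> (SymF n (n - k)) 0 D" by (cases q) auto
    let ?P = "SymF n (n - k)"
    have "\<not> (\<forall>f\<in>bool_funs n. \<not> far_from n \<epsilon> f ?P)"
    proof
      assume "\<forall>f\<in>bool_funs n. \<not> far_from n \<epsilon> f ?P"
      then have "{f \<in> bool_funs n. \<not> far_from n \<epsilon> f ?P} = bool_funs n" by blast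
      then show False using elim(1) by (simp add: card_bool_funs)
    qed
    then obtain f where f: "f \<in> bool_funs n" "far_from n \<epsilon> f ?P" by blast
    let ?g = "lift_weight n (\<lambda>_. 0)"
    have "accepts t f = accepts t ?g" if "t \<in> set_pmf D" for t
    proof -
      have "depth t = 0" using D that by (auto simp: is_tester_def)
      then show ?thesis by (cases t) auto
    qed
    then have "measure_pmf.prob D {t. accepts t f} = measure_pmf.prob D {t. accepts t ?g}"
      by (intro measure_pmf.finite_measure_eq_AE) (auto simp: AE_measure_pmf_iff)
    moreover have "2 / 3 \<le> measure_pmf.prob D {t. accepts t ?g}"
      using D lift_weight_SymF[OF elim(2)] by (simp add: is_tester_def tests_def)
    moreover have "2 / 3 \<le> measure_pmf.prob D {t. \<not> accepts t f}"
      using D f by (simp add: is_tester_def tests_def)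
    ultimately show False by (simp add: prob_compl)
  qed
qed

lemma poly_bounded_small:
  assumes "poly_bounded u"
  shows "\<forall>\<^sub>F n in sequentially. u n \<le> 2 ^ n \<and> 10 * (u n)\<^sup>2 \<le> 2 ^ n"
proof -
  obtain d where d: "\<forall>\<^sub>F n in sequentially. u n \<le> n ^ d" using assms by (auto simp: poly_bounded_def)
  have "\<forall>\<^sub>F n in sequentially. 10 * (real n ^ d)\<^sup>2 \<le> 2 powr real n" by real_asymp
  then show ?thesis using d
  proof eventually_elim
    case (elim n)
    have "real (u n) \<le> real n ^ d" using of_nat_mono[OF elim(2), where 'a = real] by simp
    then have "10 * (real (u n))\<^sup>2 \<le> 10 * (real n ^ d)\<^sup>2" by (intro mult_left_mono power_mono) auto
    also have "\<dots> \<le> 2 ^ n" using elim(1) by (simp add: powr_realpow)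
    finally have "real (10 * (u n)\<^sup>2) \<le> real (2 ^ n)" by simp
    then have 1: "10 * (u n)\<^sup>2 \<le> 2 ^ n" by (simp only: of_nat_le_iff)
    have "u n \<le> 10 * (u n)\<^sup>2" by (simp add: power2_eq_square)
    then show ?case using 1 by linarith
  qed
qed

theorem theorem9:
  fixes k :: nat and \<epsilon> :: real
  assumes "k \<ge> 1" and "0 < \<epsilon>" and "\<epsilon> \<le> 1 / 1000"
  shows "enat_bigtheta (\<lambda>n. Q_classical n \<epsilon> (SymF n (n - k))) (\<lambda>n. 1) \<and>
         poly_sample_bigtheta (\<lambda>n u. Q_active n \<epsilon> (SymF n (n - k)) u) (\<lambda>n. ln (real n)) \<and>
         enat_bigtheta (\<lambda>n. Q_passive n \<epsilon> (SymF n (n - k)))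
           (\<lambda>n. real n powr (1 / 4) * sqrt (ln (real n))) \<and>
         enat_bigtheta (\<lambda>n. Q_learn n \<epsilon> (SymF n (n - k))) (\<lambda>n. sqrt (real n))"
proof (intro conjI)
  have \<epsilon>1: "\<epsilon> \<le> 1" using assms(3) by simp
  show "enat_bigtheta (\<lambda>n. Q_classical n \<epsilon> (SymF n (n - k))) (\<lambda>n. 1)"
    unfolding enat_bigtheta_def
  proof
    obtain q where q: "\<forall>\<^sub>F n in sequentially. \<exists>D. is_tester n \<epsilon> (SymF n (n - k)) q D"
      using classical_tester_exists[OF assms(1,2)] by blast
    show "enat_bigo (\<lambda>n. Q_classical n \<epsilon> (SymF n (n - k))) (\<lambda>n. 1)"
      by (rule enat_bigoI[OF Q_classical_def, where c = "real q + 1"])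
        (use q in \<open>auto elim!: eventually_mono\<close>)
    show "enat_bigomega (\<lambda>n. Q_classical n \<epsilon> (SymF n (n - k))) (\<lambda>n. 1)"
      by (rule enat_bigomegaI[OF Q_classical_def, where c = 1]) (use classical_lower[OF assms] in auto)
  qed
  show "poly_sample_bigtheta (\<lambda>n u. Q_active n \<epsilon> (SymF n (n - k)) u) (\<lambda>n. ln (real n))"
    unfolding poly_sample_bigtheta_def
  \<comment> \<open>The exponent 3 is the sample size assumed in
    \<open>active_tester_exists\<close>: room for \<open>O(ln n)\<close> blocks of
    \<open>n + 1\<close> points.\<close>
  proof (intro conjI allI impI exI[of _ 3])
    fix u assume u: "poly_bounded u"
    show "enat_bigomega (\<lambda>n. Q_active n \<epsilon> (SymF n (n - k)) (u n)) (\<lambda>n. ln (real n))"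
      by (rule enat_bigomegaI[OF Q_active_def, where c = "1 / 2"])
        (use active_lower[OF assms(1,3) u] in auto)
  next
    fix u assume u: "poly_bounded u \<and> (\<forall>\<^sub>F n in sequentially. n ^ 3 \<le> u n)"
    obtain C where C: "C > 0" "\<forall>\<^sub>F n in sequentially. \<forall>u. n ^ 3 \<le> u \<longrightarrow> u \<le> 2 ^ n \<longrightarrow> 10 * u\<^sup>2 \<le> 2 ^ n \<longrightarrow>
        (\<exists>q A. is_sample_tester n \<epsilon> (SymF n (n - k)) u q A \<and> real q \<le> C * ln (real n))"
      using active_tester_exists[OF assms(2) \<epsilon>1, of k] by blast
    have "\<forall>\<^sub>F n in sequentially. \<exists>q. (\<exists>A. is_sample_tester n \<epsilon> (SymF n (n - k)) (u n) q A) \<and> real q \<le> C * ln (real n)"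
      using C(2) conjunct2[OF u] poly_bounded_small[OF conjunct1[OF u]] by eventually_elim blast
    then show "enat_bigo (\<lambda>n. Q_active n \<epsilon> (SymF n (n - k)) (u n)) (\<lambda>n. ln (real n))"
      by (intro enat_bigoI[OF Q_active_def C(1)])
  qed
  show "enat_bigtheta (\<lambda>n. Q_passive n \<epsilon> (SymF n (n - k))) (\<lambda>n. real n powr (1 / 4) * sqrt (ln (real n)))"
    unfolding enat_bigtheta_def
  proof
    obtain C where C: "C > 0" "\<forall>\<^sub>F n in sequentially. \<exists>q A. is_sample_tester n \<epsilon> (SymF n (n - k)) q q A \<and>
        real q \<le> C * (real n powr (1 / 4) * sqrt (ln (real n)))"
      using passive_tester_exists[OF assms(2) \<epsilon>1, of k] by blast
    show "enat_bigo (\<lambda>n. Q_passive n \<epsilon> (SymF n (n - k))) (\<lambda>n. real n powr (1 / 4) * sqrt (ln (real n)))"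
      by (rule enat_bigoI[OF Q_passive_def C(1)]) (use C(2) in \<open>auto elim!: eventually_mono\<close>)
    show "enat_bigomega (\<lambda>n. Q_passive n \<epsilon> (SymF n (n - k))) (\<lambda>n. real n powr (1 / 4) * sqrt (ln (real n)))"
      by (rule enat_bigomegaI[OF Q_passive_def, where c = "1 / 2"]) (use passive_lower[OF assms(1,3)] in auto)
  qed
  show "enat_bigtheta (\<lambda>n. Q_learn n \<epsilon> (SymF n (n - k))) (\<lambda>n. sqrt (real n))"
    unfolding enat_bigtheta_def
  proof
    obtain C where C: "C > 0" "\<forall>\<^sub>F n in sequentially. \<exists>q L. is_proper_learner n \<epsilon> (SymF n (n - k)) q L \<and>
        real q \<le> C * sqrt (real n)"
      using learner_exists[OF assms(2) \<epsilon>1, of k] by blast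
    show "enat_bigo (\<lambda>n. Q_learn n \<epsilon> (SymF n (n - k))) (\<lambda>n. sqrt (real n))"
      by (rule enat_bigoI[OF Q_learn_def C(1)]) (use C(2) in \<open>auto elim!: eventually_mono\<close>)
    have "\<forall>\<^sub>F n in sequentially. \<forall>q. (\<exists>L. is_proper_learner n \<epsilon> (SymF n (n - k)) q L) \<longrightarrow> 1 / 10 * sqrt (real n) \<le> real q"
      using eventually_ge_at_top[of "k + 1"]
    proof eventually_elim
      case (elim n)
      then have "k \<le> n" "n > 0" by auto
      then show ?case using learner_lower[OF _ _ assms(3)] by blast
    qed
    then show "enat_bigomega (\<lambda>n. Q_learn n \<epsilon> (SymF n (n - k))) (\<lambda>n. sqrt (real n))"
      by (intro enat_bigomegaI[OF Q_learn_def, where c = "1 / 10"]) auto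
  qed
qed

end
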